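(* Let $r\in\{0,1,2,\dots,24\}$ and let $l$ be a positive integer with $24\mid r(l-1)$; if $r$ is odd, assume moreover that $l$ is a perfect square. For an integer $n$ define $R(n;r,l)$ as follows (here $d$ always denotes $l/a$, and $a^{r/2}$ is the positive real root). If $r$ is even, $$R(n;r,l)=\sum_{0<a\mid l}a^{r/2}(-1)^{r(d-1)/4}\sum_{\substack{0<t\mid\gcd(a,d)\\ 24a\mid\gcd(24a,n-rl)t}}\mu(t)\frac dt\,P_r\!\left(\frac{nl/a^2-r}{24}\right).$$ If $r$ is odd, $$R(n;r,l)=\sum_{\substack{0<a\mid l\\ 24a\mid \mathrm{rad}(a,d)(n-rl)}}\left(\frac{2\cdot(-1)^{(r-1)/2}}{d}\right)\left(\frac{\mathrm{rad}_E(a,d)}{\mathrm{rad}_O(a,d)}\right)\frac{d\,a^{r/2}}{\sqrt{\mathrm{rad}'(a,d)}}P_r\!\left(\frac{nl/a^2-r}{24}\right)\left(\frac{\mathrm{rad}(a,d)(n-rl)/(24a)}{\mathrm{rad}_O(a,d)}\right)\prod_{p\mid\mathrm{rad}_E(a,d)}\left(p-1-p\left(\frac{\mathrm{rad}(a,d)(n-rl)/(24a)}{p}\right)^2\right).$$ Then for every $n\in\mathbb Z$, $$R(n;r,l)=R(r;r,l)\,P_r\!\left(\frac{n-r}{24}\right).$$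
   Context: $P_r(n)$ is defined by $\eta(\tau)^r=q^{r/24}\sum_{n\ge0}P_r(n)q^n$, where $q=e^{2\pi i\tau}$ and $\eta(\tau)=q^{1/24}\prod_{n\ge1}(1-q^n)$; for rational $x$ that is not a non-negative integer, $P_r(x)=0$. $\mu$ is the Möbius function. $\left(\frac{m}{n}\right)$ is the Kronecker–Jacobi symbol (Legendre symbol for odd prime $n$; $\left(\frac m2\right)=0$ for even $m$ and $(-1)^{(m^2-1)/8}$ for odd $m$; $\left(\frac m{-1}\right)=\pm1$ according to the sign of $m$ ($+1$ for $m\ge0$); $\left(\frac m1\right)=1$; completely multiplicative in $n$). For a positive integer $m$: $\mathrm{rad}_E(m)=\prod p$ over primes $p$ with $p^\beta\parallel m$, $\beta\ge1$ even; $\mathrm{rad}_O(m)=\prod p$ over primes $p$ with $p^\beta\parallel m$, $\beta$ odd; $\mathrm{rad}(m)=\mathrm{rad}_E(m)\mathrm{rad}_O(m)$; $\mathrm{rad}'(m)=\mathrm{rad}_E(m)^2\mathrm{rad}_O(m)$. For several arguments, $f(a,b,\dots)$ means $f(\gcd(a,b,\dots))$. Empty products equal $1$. *)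

theory Defs
  imports "HOL-Complex_Analysis.Complex_Analysis" "HOL-Number_Theory.Number_Theory"
    "HOL-Computational_Algebra.Computational_Algebra"
begin

section \<open>Powers of the Dedekind eta function\<close>

text \<open>
  \<open>q\<^sup>x\<close> with \<open>q = e\<^sup>2\<^sup>\<pi>\<^sup>i\<^sup>\<tau>\<close>. For non-integral \<open>x\<close> this depends on \<open>\<tau>\<close> and not only on \<open>q\<close>.
\<close>
definition qpow :: "real \<Rightarrow> complex \<Rightarrow> complex" where
  "qpow x \<tau> = exp (2 * of_real pi * \<i> * of_real x * \<tau>)"

definition dedekind_eta :: "complex \<Rightarrow> complex" where
  "dedekind_eta \<tau> = qpow (1/24) \<tau> * (\<Prod>n. 1 - qpow 1 \<tau> ^ Suc n)"

definition is_eta_power_expansion :: "nat \<Rightarrow> (nat \<Rightarrow> int) \<Rightarrow> bool" where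
  "is_eta_power_expansion r c \<longleftrightarrow>
     (\<forall>\<tau>. Im \<tau> > 0 \<longrightarrow>
        summable (\<lambda>n. of_int (c n) * qpow 1 \<tau> ^ n) \<and>
        dedekind_eta \<tau> ^ r = qpow (real r / 24) \<tau> * (\<Sum>n. of_int (c n) * qpow 1 \<tau> ^ n))"

text \<open>
  Such a sequence exists and is unique; see \<open>eta_power_coeff_eq_iff\<close> below.
\<close>
definition eta_power_coeff :: "nat \<Rightarrow> nat \<Rightarrow> int" where
  "eta_power_coeff r = (THE c. is_eta_power_expansion r c)"

definition eta_P :: "nat \<Rightarrow> rat \<Rightarrow> int" where
  "eta_P r x = (if x \<in> \<nat> then eta_power_coeff r (nat \<lfloor>x\<rfloor>) else 0)"


subsection \<open>Well-definedness of the coefficients\<close>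

definition euler_prod :: "complex \<Rightarrow> complex" where
  "euler_prod z = (\<Prod>n. 1 - z ^ Suc n)"

lemma euler_prod_uniform_limit:
  assumes "0 \<le> \<rho>" "\<rho> < 1"
  shows "uniform_limit (cball 0 \<rho>) (\<lambda>N z. \<Prod>n<N. 1 - z ^ Suc n) euler_prod sequentially"
proof -
  have "uniformly_convergent_on (cball 0 \<rho>) (\<lambda>N z::complex. \<Sum>n<N. norm ((1 - z ^ Suc n) - 1))"
  proof (rule Weierstrass_m_test'_ev)
    show "summable (\<lambda>n. \<rho> ^ Suc n)"
      using assms by (subst summable_Suc_iff) (auto intro!: summable_geometric)
    show "\<forall>\<^sub>F n in sequentially. \<forall>z\<in>cball 0 \<rho>. norm (norm ((1 - z ^ Suc n) - 1 :: complex)) \<le> \<rho> ^ Suc n"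
    proof (intro always_eventually allI ballI)
      fix n and z :: complex
      assume "z \<in> cball 0 \<rho>"
      hence "norm z ^ Suc n \<le> \<rho> ^ Suc n"
        by (intro power_mono) auto
      thus "norm (norm ((1 - z ^ Suc n) - 1)) \<le> \<rho> ^ Suc n"
        by (simp add: norm_power norm_mult)
    qed
  qed
  hence "uniformly_convergent_on (cball 0 \<rho>) (\<lambda>N z::complex. \<Prod>n<N. 1 - z ^ Suc n)"
    by (intro uniformly_convergent_on_prod') (auto intro!: continuous_intros)
  then obtain g where g: "uniform_limit (cball 0 \<rho>) (\<lambda>N z::complex. \<Prod>n<N. 1 - z ^ Suc n) g sequentially"
    by (auto simp: uniformly_convergent_on_def)
  have "g z = euler_prod z" if z: "z \<in> cball 0 \<rho>" for z
  proof -
    have lim: "(\<lambda>N. \<Prod>n<N. 1 - z ^ Suc n) \<longlonglongrightarrow> g z"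
      using tendsto_uniform_limitI[OF g z] .
    have "summable (\<lambda>n. norm z ^ Suc n)"
      using z assms by (subst summable_Suc_iff) (auto intro!: summable_geometric)
    hence "abs_convergent_prod (\<lambda>n. 1 - z ^ Suc n)"
      by (intro summable_imp_abs_convergent_prod) (simp add: norm_power norm_mult)
    hence "convergent_prod (\<lambda>n. 1 - z ^ Suc n)"
      by (rule abs_convergent_prod_imp_convergent_prod)
    from convergent_prod_LIMSEQ[OF this]
    have "(\<lambda>N. \<Prod>n\<le>N. 1 - z ^ Suc n) \<longlonglongrightarrow> euler_prod z"
      by (simp add: euler_prod_def)
    moreover from lim have "(\<lambda>N. \<Prod>n\<le>N. 1 - z ^ Suc n) \<longlonglongrightarrow> g z"
      by (subst (asm) filterlim_sequentially_Suc [symmetric]) (simp add: lessThan_Suc_atMost)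
    ultimately show ?thesis
      using LIMSEQ_unique by blast
  qed
  thus ?thesis
    using g by (subst uniform_limit_cong'[where g = "\<lambda>N z. \<Prod>n<N. 1 - z ^ Suc n" and i = g]) auto
qed

lemma holomorphic_euler_prod: "euler_prod holomorphic_on ball 0 1"
proof (rule holomorphic_uniform_sequence)
  show "(\<lambda>z. \<Prod>n<N. 1 - z ^ Suc n) holomorphic_on ball 0 1" for N
    by (intro holomorphic_intros)
  fix z :: complex
  assume z: "z \<in> ball 0 1"
  define d where "d = (1 - norm z) / 2"
  have d: "d > 0" "norm z + d < 1"
    using z by (auto simp: d_def field_simps)
  have sub: "cball z d \<subseteq> cball 0 (norm z + d)"
    by (simp add: cball_subset_cball_iff)
  have "uniform_limit (cball z d) (\<lambda>N z. \<Prod>n<N. 1 - z ^ Suc n) euler_prod sequentially"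
    by (rule uniform_limit_on_subset[OF euler_prod_uniform_limit sub]) (use d in auto)
  moreover have "cball z d \<subseteq> ball 0 1"
    using sub d by (fastforce simp: subset_iff)
  ultimately show "\<exists>d>0. cball z d \<subseteq> ball 0 1 \<and>
      uniform_limit (cball z d) (\<lambda>N z. \<Prod>n<N. 1 - z ^ Suc n) euler_prod sequentially"
    using d by blast
qed auto

lemma fps_nth_mult_in_Ints:
  fixes F G :: "complex fps"
  assumes "\<And>n. fps_nth F n \<in> \<int>" "\<And>n. fps_nth G n \<in> \<int>"
  shows   "fps_nth (F * G) n \<in> \<int>"
  unfolding fps_mult_nth using assms by (intro Ints_sum Ints_mult)

lemma fps_nth_power_in_Ints:
  fixes F :: "complex fps"
  assumes "\<And>n. fps_nth F n \<in> \<int>"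
  shows   "fps_nth (F ^ k) n \<in> \<int>"
  by (induction k arbitrary: n) (auto intro!: fps_nth_mult_in_Ints assms simp: fps_one_nth)

lemma fps_nth_euler_prod_in_Ints: "fps_nth (fps_expansion euler_prod 0) m \<in> \<int>"
proof -
  define f where "f = (\<lambda>N z::complex. \<Prod>n<N. 1 - z ^ Suc n)"
  define F :: "nat \<Rightarrow> complex fps" where "F = (\<lambda>N. \<Prod>n<N. 1 - fps_X ^ Suc n)"
  have fF: "f N has_fps_expansion F N" for N
    unfolding f_def F_def by (intro fps_expansion_intros)
  have F_Ints: "fps_nth (F N) k \<in> \<int>" for N k
  proof (induction N arbitrary: k)
    case (Suc N)
    have "fps_nth (1 - fps_X ^ Suc N :: complex fps) k \<in> \<int>" for k
      by (auto simp del: power_Suc simp add: fps_one_nth fps_X_power_nth)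
    thus ?case
      unfolding F_def prod.lessThan_Suc
      by (intro fps_nth_mult_in_Ints) (use Suc.IH in \<open>auto simp: F_def\<close>)
  qed (auto simp: F_def fps_one_nth)
  have "uniform_limit (ball 0 (1/2)) f euler_prod sequentially"
    unfolding f_def
    by (rule uniform_limit_on_subset[OF euler_prod_uniform_limit[of "1/2"]]) auto
  hence "(\<lambda>N. (deriv ^^ m) (f N) 0) \<longlonglongrightarrow> (deriv ^^ m) euler_prod 0"
    by (rule higher_deriv_complex_uniform_limit)
       (auto simp: f_def intro!: always_eventually holomorphic_intros)
  hence "(\<lambda>N. (deriv ^^ m) (f N) 0 / fact m) \<longlonglongrightarrow> (deriv ^^ m) euler_prod 0 / fact m"
    by (intro tendsto_intros) auto
  also have "(\<lambda>N. (deriv ^^ m) (f N) 0 / fact m) = (\<lambda>N. fps_nth (F N) m)"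
    by (simp add: fps_nth_fps_expansion[OF fF])
  finally have lim: "(\<lambda>N. fps_nth (F N) m) \<longlonglongrightarrow> fps_nth (fps_expansion euler_prod 0) m"
    by (simp add: fps_expansion_def)
  show ?thesis
    by (rule Lim_in_closed_set[OF closed_Ints _ _ lim]) (use F_Ints in auto)
qed

lemma norm_qpow_1: "norm (qpow 1 \<tau>) = exp (-2 * pi * Im \<tau>)"
  by (simp add: qpow_def)

lemma norm_qpow_1_less: "Im \<tau> > 0 \<Longrightarrow> norm (qpow 1 \<tau>) < 1"
  by (simp add: norm_qpow_1)

lemma qpow_1_surj:
  assumes "z \<noteq> 0" "norm z < 1"
  obtains \<tau> where "Im \<tau> > 0" "qpow 1 \<tau> = z"
proof
  define \<tau> where "\<tau> = Ln z / (2 * of_real pi * \<i>)"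
  show q: "qpow 1 \<tau> = z"
    using assms by (simp add: qpow_def \<tau>_def)
  have "exp (-2 * pi * Im \<tau>) < 1"
    using norm_qpow_1[of \<tau>] assms q by simp
  thus "Im \<tau> > 0"
    by (simp add: zero_less_mult_iff)
qed

lemma dedekind_eta_power:
  "dedekind_eta \<tau> ^ r = qpow (real r / 24) \<tau> * euler_prod (qpow 1 \<tau>) ^ r"
proof -
  have "qpow (1/24) \<tau> ^ r = qpow (real r / 24) \<tau>"
    by (simp add: qpow_def exp_of_nat_mult [symmetric] field_simps)
  thus ?thesis
    by (simp add: dedekind_eta_def euler_prod_def power_mult_distrib)
qed

lemma qpow_nonzero: "qpow x \<tau> \<noteq> 0"
  by (simp add: qpow_def)

lemma is_eta_power_expansion_exists: "\<exists>c. is_eta_power_expansion r c"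
proof -
  define E where "E = fps_expansion (\<lambda>z. euler_prod z ^ r) 0"
  have hol: "(\<lambda>z. euler_prod z ^ r) holomorphic_on ball 0 1"
    by (intro holomorphic_intros holomorphic_euler_prod)
  have "euler_prod has_fps_expansion fps_expansion euler_prod 0"
    by (rule has_fps_expansion_fps_expansion[OF _ _ holomorphic_euler_prod]) auto
  hence "(\<lambda>z. euler_prod z ^ r) has_fps_expansion fps_expansion euler_prod 0 ^ r"
    by (rule has_fps_expansion_power)
  hence "fps_nth E n = fps_nth (fps_expansion euler_prod 0 ^ r) n" for n
    by (simp add: fps_nth_fps_expansion E_def fps_expansion_def)
  hence "fps_nth E n \<in> \<int>" for n
    by (simp add: fps_nth_power_in_Ints fps_nth_euler_prod_in_Ints)
  hence "\<forall>n. \<exists>k. fps_nth E n = of_int k"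
    by (metis Ints_cases)
  then obtain c where c: "\<And>n. fps_nth E n = of_int (c n)"
    by metis
  have "is_eta_power_expansion r c"
    unfolding is_eta_power_expansion_def
  proof (intro allI impI)
    fix \<tau> :: complex assume "Im \<tau> > 0"
    hence z: "qpow 1 \<tau> \<in> ball 0 1"
      using norm_qpow_1_less by simp
    have "(\<lambda>n. of_int (c n) * qpow 1 \<tau> ^ n) sums (euler_prod (qpow 1 \<tau>) ^ r)"
      using holomorphic_power_series[OF hol z] by (simp add: c [symmetric] E_def fps_expansion_def)
    thus "summable (\<lambda>n. of_int (c n) * qpow 1 \<tau> ^ n) \<and>
        dedekind_eta \<tau> ^ r = qpow (real r / 24) \<tau> * (\<Sum>n. of_int (c n) * qpow 1 \<tau> ^ n)"
      by (auto simp: sums_iff dedekind_eta_power)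
  qed
  thus ?thesis by blast
qed

lemma is_eta_power_expansion_unique:
  assumes "is_eta_power_expansion r c" "is_eta_power_expansion r c'"
  shows   "c = c'"
proof -
  define A :: "complex fps" where "A = Abs_fps (\<lambda>n. of_int (c n) - of_int (c' n))"
  have sums0: "(\<lambda>n. fps_nth A n * z ^ n) sums 0" if z: "z \<noteq> 0" "norm z < 1" for z
  proof -
    obtain \<tau> where \<tau>: "Im \<tau> > 0" "qpow 1 \<tau> = z"
      using qpow_1_surj[OF z] .
    have s: "(\<lambda>n. of_int (d n) * z ^ n) sums (euler_prod z ^ r)"
      if "is_eta_power_expansion r d" for d
      using that \<tau> by (auto simp: is_eta_power_expansion_def dedekind_eta_power sums_iff qpow_nonzero)
    show ?thesis
      using sums_diff[OF s[OF assms(1)] s[OF assms(2)]] by (simp add: A_def algebra_simps)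
  qed
  have "fps_conv_radius A \<ge> ereal (norm (1/2 :: complex))"
    unfolding fps_conv_radius_def
    by (rule conv_radius_geI) (use sums0[of "1/2"] in \<open>auto simp: sums_iff\<close>)
  hence rad: "fps_conv_radius A > 0"
    by (rule less_le_trans[rotated]) auto
  have exp: "eval_fps A has_fps_expansion A"
    using rad by (simp add: has_fps_expansion_def)
  have ev: "eventually (\<lambda>z. eval_fps A z = 0) (at 0)"
  proof -
    have "eventually (\<lambda>z::complex. z \<in> ball 0 1 - {0}) (at 0)"
      by (rule eventually_at_in_open) auto
    thus ?thesis
      by eventually_elim (use sums0 in \<open>auto simp: eval_fps_def sums_iff\<close>)
  qed
  have "isCont (eval_fps A) 0"
    using rad by (intro continuous_eval_fps) (simp_all add: zero_ereal_def)
  hence "(eval_fps A \<longlongrightarrow> eval_fps A 0) (at 0)"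
    by (simp add: isCont_def)
  moreover have "(eval_fps A \<longlongrightarrow> 0) (at 0)"
    using ev by (rule tendsto_eventually)
  ultimately have "eval_fps A 0 = 0"
    by (rule LIM_unique)
  with ev have "eventually (\<lambda>z. eval_fps A z = 0) (nhds 0)"
    by (simp add: eventually_nhds_conv_at)
  hence "eval_fps A has_fps_expansion 0"
    by (simp add: has_fps_expansion_0_iff)
  hence "fps_nth A n = 0" for n
    using fps_nth_fps_expansion[OF exp] fps_nth_fps_expansion[of "eval_fps A" 0] by simp
  thus ?thesis
    by (auto simp: A_def fun_eq_iff)
qed

theorem eta_power_coeff_eq_iff: "eta_power_coeff r = c \<longleftrightarrow> is_eta_power_expansion r c"
  unfolding eta_power_coeff_def
  by (metis is_eta_power_expansion_exists is_eta_power_expansion_unique the_equality)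


section \<open>Arithmetic functions\<close>

definition moebius_mu :: "nat \<Rightarrow> int" where
  "moebius_mu n = (if squarefree n then (-1) ^ card (prime_factors n) else 0)"

definition kronecker_prime :: "int \<Rightarrow> nat \<Rightarrow> int" where
  "kronecker_prime m p =
     (if p = 2 then (if even m then 0 else (-1) ^ nat ((m\<^sup>2 - 1) div 8))
      else Legendre m (int p))"

text \<open>
  The factor in front is \<open>(m/-1)\<close> for negative \<open>n\<close>. The symbol is not needed for \<open>n = 0\<close>;
  there the usual convention is used.
\<close>
definition kronecker :: "int \<Rightarrow> int \<Rightarrow> int" where
  "kronecker m n =
     (if n = 0 then (if \<bar>m\<bar> = 1 then 1 else 0)
      else (if n < 0 \<and> m < 0 then -1 else 1) *
           (\<Prod>p\<in>#prime_factorization (nat \<bar>n\<bar>). kronecker_prime m p))"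

definition rad_E :: "nat \<Rightarrow> nat" where
  "rad_E m = \<Prod>{p \<in> prime_factors m. even (multiplicity p m)}"

definition rad_O :: "nat \<Rightarrow> nat" where
  "rad_O m = \<Prod>{p \<in> prime_factors m. odd (multiplicity p m)}"

definition rad :: "nat \<Rightarrow> nat" where
  "rad m = rad_E m * rad_O m"

definition rad' :: "nat \<Rightarrow> nat" where
  "rad' m = (rad_E m)\<^sup>2 * rad_O m"


section \<open>The sums \<open>R(n; r, l)\<close>\<close>

text \<open>
  If \<open>r\<close> is even, \<open>24\<close> divides \<open>r(l-1)\<close> and \<open>d\<close> divides \<open>l\<close>, then \<open>4\<close> divides \<open>r(d-1)\<close>,
  so that the exponent of \<open>-1\<close> is an exact quotient.
\<close>
definition R_even :: "int \<Rightarrow> nat \<Rightarrow> nat \<Rightarrow> real" where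
  "R_even n r l =
     (\<Sum>a | 0 < a \<and> a dvd l.
        let d = l div a in
        real a powr (real r / 2) * (-1) ^ (r * (d - 1) div 4) *
        (\<Sum>t | 0 < t \<and> t dvd gcd a d \<and>
               24 * int a dvd gcd (24 * int a) (n - int r * int l) * int t.
           of_int (moebius_mu t) * (real d / real t) *
           of_int (eta_P r ((of_int n * of_nat l / (of_nat a)\<^sup>2 - of_nat r) / 24))))"

text \<open>
  The range of summation makes the division in the definition of \<open>u\<close> exact.
\<close>
definition R_odd :: "int \<Rightarrow> nat \<Rightarrow> nat \<Rightarrow> real" where
  "R_odd n r l =
     (\<Sum>a | 0 < a \<and> a dvd l \<and>
            24 * int a dvd int (rad (gcd a (l div a))) * (n - int r * int l).
        let d = l div a;
            g = gcd a d;
            u = int (rad g) * (n - int r * int l) div (24 * int a)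
        in
        of_int (kronecker (2 * (-1) ^ ((r - 1) div 2)) (int d)) *
        of_int (kronecker (int (rad_E g)) (int (rad_O g))) *
        (real d * real a powr (real r / 2) / sqrt (real (rad' g))) *
        of_int (eta_P r ((of_int n * of_nat l / (of_nat a)\<^sup>2 - of_nat r) / 24)) *
        of_int (kronecker u (int (rad_O g))) *
        of_int (\<Prod>p | prime p \<and> p dvd rad_E g. int p - 1 - int p * (kronecker u (int p))\<^sup>2))"

definition R :: "int \<Rightarrow> nat \<Rightarrow> nat \<Rightarrow> real" where
  "R n r l = (if even r then R_even n r l else R_odd n r l)"

end

theory Submission
  imports Defs
begin

text \<open>
  Apply the primitive Hecke operator of determinant \<open>l\<close> to \<open>\<eta>\<^sup>r\<close>: take a weighted sum \<open>F\<close> of the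
  functions \<open>\<eta>((a \<tau> + b) / d)\<^sup>r\<close> over the primitive matrices with rows \<open>(a, b)\<close>, \<open>(0, d)\<close> and \<open>a d = l\<close>.
  The multiplier system of \<open>\<eta>\<close> determines weights for which \<open>F(-1/\<tau>) = (\<tau>/i)\<^bsup>r/2\<^esup> F(\<tau>)\<close>, just
  as for \<open>\<eta>\<^sup>r\<close>. Summing over \<open>b\<close> turns the weights into Ramanujan sums (\<open>r\<close> even) or quadratic Gauss
  sums (\<open>r\<close> odd), so that \<open>F = \<Sum> R(n; r, l) q\<^bsup>n/24\<^esup>\<close>. Only \<open>n \<equiv> r (mod 24)\<close> with \<open>n > r - 24\<close> occur
  because \<open>r \<le> 24\<close>; hence \<open>F / \<eta>\<^sup>r\<close> is holomorphic in \<open>q\<close> on the whole unit disc. As it is invariant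
  under \<open>\<tau> \<mapsto> -1/\<tau>\<close>, the maximum principle forces it to be constant.
\<close>

section \<open>The inversion formula for \<open>\<eta>\<close>\<close>

text \<open>The weights are simple because \<open>24 dvd r * (l - 1)\<close> makes
  \<open>N = 24 div gcd 24 r\<close> prime to \<open>l\<close>, so all upper right entries can be
  taken divisible by \<open>N\<close>. Rewriting such a matrix after \<tau> \<mapsto> -1/\<tau>
  involves a modular matrix with both diagonal entries divisible by \<open>N\<close>. In the
  \<open>r\<close>-th power of its multiplier the main phase is then trivial; a Jacobi symbol and an
  eighth root of unity survive, or just a sign if \<open>r\<close> is even. For odd
  \<open>r\<close>, compatibility with the exchange of matrices rests on quadratic reciprocity and
  on \<open>l\<close> being a square. The eighth roots finally combine with the sign of the
  quadratic Gauss sum into a real character, so Gauss's evaluation is needed with its sign and not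
  only in modulus. The inversion of \<eta> comes from Jacobi's theta product: a quotient of two such
  products is elliptic without poles, hence constant. Comparing its value at the origin with those
  at the half periods gives \<eta>(-1/\<tau>) up to a sixth root of unity, which positivity on the
  imaginary axis removes.\<close>

definition qprod :: "complex \<Rightarrow> complex \<Rightarrow> complex" where
  "qprod q x = (\<Prod>n. 1 - q ^ n * x)"

lemma qprod_convergent:
  fixes q x :: complex
  assumes "norm q < 1"
  shows "convergent_prod (\<lambda>n. 1 - q ^ n * x)"
proof -
  have "summable (\<lambda>n. norm q ^ n * norm x)"
    using assms by (intro summable_mult2 summable_geometric) auto
  hence "abs_convergent_prod (\<lambda>n. 1 - q ^ n * x)"
    by (intro summable_imp_abs_convergent_prod) (simp add: norm_power norm_mult)
  thus ?thesis
    by (rule abs_convergent_prod_imp_convergent_prod)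
qed

lemma qprod_LIMSEQ:
  assumes "norm q < 1"
  shows "(\<lambda>N. \<Prod>n<N. 1 - q ^ n * x) \<longlonglongrightarrow> qprod q x"
proof -
  have "(\<lambda>N. \<Prod>n\<le>N. 1 - q ^ n * x) \<longlonglongrightarrow> qprod q x"
    unfolding qprod_def by (rule convergent_prod_LIMSEQ[OF qprod_convergent[OF assms]])
  thus ?thesis
    by (subst filterlim_sequentially_Suc [symmetric]) (simp add: lessThan_Suc_atMost)
qed

lemma qprod_rec:
  assumes "norm q < 1"
  shows "qprod q x = (1 - x) * qprod q (q * x)"
proof (rule LIMSEQ_unique)
  show "(\<lambda>N. \<Prod>n<Suc N. 1 - q ^ n * x) \<longlonglongrightarrow> qprod q x"
    by (subst filterlim_sequentially_Suc) (rule qprod_LIMSEQ[OF assms])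
  have "(\<lambda>N. (1 - x) * (\<Prod>n<N. 1 - q ^ n * (q * x))) \<longlonglongrightarrow> (1 - x) * qprod q (q * x)"
    by (intro tendsto_intros qprod_LIMSEQ assms)
  also have "(\<lambda>N. (1 - x) * (\<Prod>n<N. 1 - q ^ n * (q * x))) = (\<lambda>N. \<Prod>n<Suc N. 1 - q ^ n * x)"
    by (subst prod.lessThan_Suc_shift) (simp add: mult_ac)
  finally show "(\<lambda>N. \<Prod>n<Suc N. 1 - q ^ n * x) \<longlonglongrightarrow> (1 - x) * qprod q (q * x)" .
qed

lemma qprod_eq_0_iff:
  assumes "norm q < 1"
  shows "qprod q x = 0 \<longleftrightarrow> (\<exists>n. q ^ n * x = 1)"
  using has_prod_eq_0_iff[OF convergent_prod_has_prod[OF qprod_convergent[OF assms, of x]]]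
  by (auto simp: qprod_def)

lemma qprod_nonzero:
  assumes "norm q < 1" "norm x < 1"
  shows "qprod q x \<noteq> 0"
proof
  assume "qprod q x = 0"
  then obtain n where n: "q ^ n * x = 1"
    using qprod_eq_0_iff assms by blast
  have "norm (q ^ n * x) \<le> 1 * norm x"
    unfolding norm_mult norm_power using assms by (intro mult_right_mono power_le_one) auto
  thus False using n assms by simp
qed

lemma qprod_self: "qprod q q = euler_prod q"
  by (simp add: qprod_def euler_prod_def mult.commute)

lemma qprod_holomorphic [holomorphic_intros]:
  assumes q: "norm q < 1" and f: "f holomorphic_on A"
  shows "(\<lambda>z. qprod q (f z)) holomorphic_on A"
proof -
  have "qprod q holomorphic_on UNIV"
  proof (rule holomorphic_uniform_sequence)
    show "(\<lambda>x. \<Prod>n<N. 1 - q ^ n * x) holomorphic_on UNIV" for N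
      by (intro holomorphic_intros)
    fix x :: complex
    define C where "C = norm x + 1"
    have "uniformly_convergent_on (cball x 1) (\<lambda>N z::complex. \<Sum>n<N. norm ((1 - q ^ n * z) - 1))"
    proof (rule Weierstrass_m_test'_ev)
      show "summable (\<lambda>n. norm q ^ n * C)"
        using q by (intro summable_mult2 summable_geometric) auto
      show "\<forall>\<^sub>F n in sequentially. \<forall>z\<in>cball x 1. norm (norm ((1 - q ^ n * z) - 1 :: complex)) \<le> norm q ^ n * C"
      proof (intro always_eventually allI ballI)
        fix n and z :: complex
        assume "z \<in> cball x 1"
        hence "norm z \<le> C"
          using norm_triangle_ineq4[of z x] norm_triangle_sub[of z x] by (simp add: C_def dist_norm norm_minus_commute)
        thus "norm (norm ((1 - q ^ n * z) - 1)) \<le> norm q ^ n * C"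
          by (simp add: norm_power norm_mult mult_left_mono)
      qed
    qed
    hence "uniformly_convergent_on (cball x 1) (\<lambda>N z::complex. \<Prod>n<N. 1 - q ^ n * z)"
      by (intro uniformly_convergent_on_prod') (auto intro!: continuous_intros)
    then obtain g where g: "uniform_limit (cball x 1) (\<lambda>N z::complex. \<Prod>n<N. 1 - q ^ n * z) g sequentially"
      by (auto simp: uniformly_convergent_on_def)
    have "g z = qprod q z" if z: "z \<in> cball x 1" for z
      using tendsto_uniform_limitI[OF g z] qprod_LIMSEQ[OF q] LIMSEQ_unique by blast
    hence "uniform_limit (cball x 1) (\<lambda>N z. \<Prod>n<N. 1 - q ^ n * z) (qprod q) sequentially"
      using g by (subst uniform_limit_cong'[where g = "\<lambda>N z. \<Prod>n<N. 1 - q ^ n * z" and i = g]) auto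
    thus "\<exists>d>0. cball x d \<subseteq> UNIV \<and>
        uniform_limit (cball x d) (\<lambda>N z. \<Prod>n<N. 1 - q ^ n * z) (qprod q) sequentially"
      by (intro exI[of _ 1]) auto
  qed auto
  from holomorphic_on_compose_gen[OF f this] show ?thesis
    by (simp add: o_def)
qed

lemma qprod_square:
  assumes "norm q < 1"
  shows "qprod q x * qprod q (-x) = qprod (q\<^sup>2) (x\<^sup>2)"
proof (rule LIMSEQ_unique)
  have q2: "norm (q\<^sup>2) < 1"
    using assms by (simp add: norm_power power_less_one_iff)
  show "(\<lambda>N. \<Prod>n<N. 1 - (q\<^sup>2) ^ n * x\<^sup>2) \<longlonglongrightarrow> qprod (q\<^sup>2) (x\<^sup>2)"
    by (rule qprod_LIMSEQ[OF q2])
  have "(\<lambda>N. (\<Prod>n<N. 1 - q ^ n * x) * (\<Prod>n<N. 1 - q ^ n * (-x))) \<longlonglongrightarrow> qprod q x * qprod q (-x)"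
    by (intro tendsto_intros qprod_LIMSEQ assms)
  also have "(\<lambda>N. (\<Prod>n<N. 1 - q ^ n * x) * (\<Prod>n<N. 1 - q ^ n * (-x))) = (\<lambda>N. \<Prod>n<N. 1 - (q\<^sup>2) ^ n * x\<^sup>2)"
    by (simp add: prod.distrib [symmetric] power2_eq_square algebra_simps power_mult_distrib)
  finally show "(\<lambda>N. \<Prod>n<N. 1 - (q\<^sup>2) ^ n * x\<^sup>2) \<longlonglongrightarrow> qprod q x * qprod q (-x)" .
qed

lemma qprod_even_odd:
  assumes "norm q < 1"
  shows "qprod q x = qprod (q\<^sup>2) x * qprod (q\<^sup>2) (q * x)"
proof (rule LIMSEQ_unique)
  have q2: "norm (q\<^sup>2) < 1"
    using assms by (simp add: norm_power power_less_one_iff)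
  have "strict_mono (\<lambda>N::nat. 2 * N)"
    by (auto simp: strict_mono_def)
  from LIMSEQ_subseq_LIMSEQ[OF qprod_LIMSEQ[OF assms] this]
  show "(\<lambda>N. \<Prod>n<2*N. 1 - q ^ n * x) \<longlonglongrightarrow> qprod q x"
    by (simp add: o_def)
  have "(\<lambda>N. (\<Prod>n<N. 1 - (q\<^sup>2) ^ n * x) * (\<Prod>n<N. 1 - (q\<^sup>2) ^ n * (q * x))) \<longlonglongrightarrow>
          qprod (q\<^sup>2) x * qprod (q\<^sup>2) (q * x)"
    by (intro tendsto_intros qprod_LIMSEQ q2)
  moreover have "(\<Prod>n<N. 1 - (q\<^sup>2) ^ n * x) * (\<Prod>n<N. 1 - (q\<^sup>2) ^ n * (q * x)) = (\<Prod>n<2*N. 1 - q ^ n * x)" for N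
    by (induction N) (auto simp: power_mult [symmetric] mult_ac)
  ultimately show "(\<lambda>N. \<Prod>n<2*N. 1 - q ^ n * x) \<longlonglongrightarrow> qprod (q\<^sup>2) x * qprod (q\<^sup>2) (q * x)"
    by simp
qed

text \<open>Euler's identity that partitions into odd parts are equinumerous with partitions into distinct parts.\<close>
lemma qprod_half_periods:
  assumes "norm s < 1"
  shows "qprod (s\<^sup>2) s * qprod (s\<^sup>2) (-s) * qprod (s\<^sup>2) (-(s\<^sup>2)) = 1"
proof -
  define q where "q = s\<^sup>2"
  have q: "norm q < 1" and q2: "norm (q\<^sup>2) < 1"
    using assms by (simp_all add: q_def norm_power power_less_one_iff)
  have "qprod q s * qprod q (-s) = qprod (q\<^sup>2) q"
    using qprod_square[OF q, of s] by (simp add: q_def)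
  moreover have "qprod q q * qprod q (-q) = qprod (q\<^sup>2) (q\<^sup>2)"
    by (rule qprod_square[OF q])
  moreover have "qprod q q = qprod (q\<^sup>2) q * qprod (q\<^sup>2) (q\<^sup>2)"
    using qprod_even_odd[OF q, of q] by (simp add: power2_eq_square)
  moreover have "qprod (q\<^sup>2) (q\<^sup>2) \<noteq> 0"
    by (rule qprod_nonzero[OF q2 q2])
  ultimately have "(qprod q s * qprod q (-s) * qprod q (-q) - 1) * qprod (q\<^sup>2) (q\<^sup>2) = 0"
    by (simp add: algebra_simps)
  thus ?thesis
    using \<open>qprod (q\<^sup>2) (q\<^sup>2) \<noteq> 0\<close> by (simp add: q_def)
qed

section \<open>The exponential and Jacobi's theta product\<close>

definition cis2 :: "complex \<Rightarrow> complex" where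
  "cis2 z = exp (2 * of_real pi * \<i> * z)"

lemma cis2_add: "cis2 (x + y) = cis2 x * cis2 y"
  by (simp add: cis2_def distrib_left exp_add)

lemma cis2_diff: "cis2 (x - y) = cis2 x / cis2 y"
  by (simp add: cis2_def right_diff_distrib exp_diff)

lemma cis2_minus: "cis2 (-x) = 1 / cis2 x"
  by (simp add: cis2_def exp_minus field_simps)

lemma cis2_nz [simp]: "cis2 x \<noteq> 0"
  by (simp add: cis2_def)

lemma cis2_0 [simp]: "cis2 0 = 1"
  by (simp add: cis2_def)

lemma cis2_power: "cis2 x ^ n = cis2 (of_nat n * x)"
  by (simp add: cis2_def exp_of_nat_mult [symmetric] mult_ac)

lemma cis2_eq_1_iff: "cis2 x = 1 \<longleftrightarrow> (\<exists>n::int. x = of_int n)"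
  unfolding cis2_def exp_eq_1 by (auto simp: complex_eq_iff)

lemma cis2_of_int [simp]: "cis2 (of_int n) = 1"
  using cis2_eq_1_iff by blast

lemma cis2_of_nat [simp]: "cis2 (of_nat n) = 1"
  using cis2_of_int[of "int n"] by simp

lemma cis2_1 [simp]: "cis2 1 = 1"
  using cis2_of_nat[of 1] by simp

lemma cis2_half [simp]: "cis2 (1/2) = -1"
  by (simp add: cis2_def)

lemma cis2_quarter [simp]: "cis2 (1/4) = \<i>"
  by (simp add: cis2_def exp_eq_polar complex_eq_iff)

lemma norm_cis2: "norm (cis2 z) = exp (-2 * pi * Im z)"
  by (simp add: cis2_def)

lemma norm_cis2_less_1: "Im z > 0 \<Longrightarrow> norm (cis2 z) < 1"
  by (simp add: norm_cis2)

lemma cis2_holomorphic [holomorphic_intros]: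
  "f holomorphic_on A \<Longrightarrow> (\<lambda>z. cis2 (f z)) holomorphic_on A"
  unfolding cis2_def by (intro holomorphic_intros)

text \<open>
  The product side of Jacobi's triple product, without the factor \<open>euler_prod (cis2 \<tau>)\<close>.
\<close>
definition jprod :: "complex \<Rightarrow> complex \<Rightarrow> complex" where
  "jprod \<tau> z = qprod (cis2 \<tau>) (cis2 z) * qprod (cis2 \<tau>) (cis2 (\<tau> - z))"

lemma jprod_plus_1: "jprod \<tau> (z + 1) = jprod \<tau> z"
  by (simp add: jprod_def cis2_add cis2_diff)

text \<open>Shifting by \<tau> removes the factor \<open>1 - cis2 z\<close> from the first product
  and adds \<open>1 - cis2 (-z)\<close> to the second; the quotient of these two is the automorphy
  factor.\<close>

lemma jprod_plus_period:
  assumes "Im \<tau> > 0"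
  shows "jprod \<tau> (z + \<tau>) = - cis2 (-z) * jprod \<tau> z"
proof -
  note q = norm_cis2_less_1[OF assms]
  have "(1 - cis2 z) * jprod \<tau> (z + \<tau>) =
          ((1 - cis2 z) * qprod (cis2 \<tau>) (cis2 \<tau> * cis2 z)) * qprod (cis2 \<tau>) (cis2 (-z))"
    by (simp add: jprod_def cis2_add mult_ac)
  also have "\<dots> = qprod (cis2 \<tau>) (cis2 z) * ((1 - cis2 (-z)) * qprod (cis2 \<tau>) (cis2 \<tau> * cis2 (-z)))"
    by (simp add: qprod_rec[OF q, symmetric])
  also have "\<dots> = (1 - cis2 z) * (- cis2 (-z) * jprod \<tau> z)"
    by (simp add: jprod_def cis2_diff cis2_minus field_simps)
  finally have eq: "(1 - cis2 z) * jprod \<tau> (z + \<tau>) = (1 - cis2 z) * (- cis2 (-z) * jprod \<tau> z)" .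
  show ?thesis
  proof (cases "cis2 z = 1")
    \<comment> \<open>Cancellation is impossible here, but both sides vanish since
      \<open>qprod (cis2 \<tau>) 1 = 0\<close>.\<close>
    case True
    have "qprod (cis2 \<tau>) 1 = 0"
      using qprod_rec[OF q, of 1] by simp
    thus ?thesis using True
      by (simp add: jprod_def cis2_add cis2_minus)
  next
    case False
    thus ?thesis using eq by (metis mult_left_cancel right_minus_eq)
  qed
qed

text \<open>Modulo the periods each half period is fixed by z \<mapsto> \<tau> - z. Hence the two
  products in \<open>jprod\<close> agree there up to at most one factor, and its value is a constant
  times a square.\<close>

lemma jprod_half: "jprod \<tau> (1/2) = qprod (cis2 \<tau>) (-1) * qprod (cis2 \<tau>) (- cis2 \<tau>)"
  by (simp add: jprod_def cis2_diff)

lemma jprod_1_half: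
  assumes "Im \<tau> > 0"
  shows "jprod \<tau> (1/2) = 2 * qprod (cis2 \<tau>) (- cis2 \<tau>) ^ 2"
  using qprod_rec[OF norm_cis2_less_1[OF assms], of "-1"] by (simp add: jprod_half power2_eq_square)

lemma jprod_half_period: "jprod \<tau> (\<tau>/2) = qprod (cis2 \<tau>) (cis2 (\<tau>/2)) ^ 2"
  by (simp add: jprod_def power2_eq_square)

lemma jprod_half_periods: "jprod \<tau> (1/2 + \<tau>/2) = qprod (cis2 \<tau>) (- cis2 (\<tau>/2)) ^ 2"
proof -
  have "\<tau> - (1/2 + \<tau>/2) = \<tau>/2 - 1/2"
    by (simp add: field_simps)
  thus ?thesis
    by (simp add: jprod_def power2_eq_square cis2_add cis2_diff)
qed

lemma jprod_minus_period:
  assumes "Im \<tau> > 0"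
  shows "jprod \<tau> (z - \<tau>) = - cis2 (z - \<tau>) * jprod \<tau> z"
proof -
  have "jprod \<tau> z = - (jprod \<tau> (z - \<tau>) / cis2 (z - \<tau>))"
    using jprod_plus_period[OF assms, of "z - \<tau>"] unfolding cis2_minus by simp
  thus ?thesis by simp
qed

lemma jprod_holomorphic [holomorphic_intros]:
  assumes "Im \<tau> > 0" "f holomorphic_on A"
  shows "(\<lambda>z. jprod \<tau> (f z)) holomorphic_on A"
  unfolding jprod_def by (intro holomorphic_intros assms norm_cis2_less_1)

text \<open>The quotient of \<open>jprod \<tau>\<close> by the factor \<open>1 - cis2 z\<close> that carries its zero at the origin.\<close>
definition jprod' :: "complex \<Rightarrow> complex \<Rightarrow> complex" where
  "jprod' \<tau> z = qprod (cis2 \<tau>) (cis2 (\<tau> + z)) * qprod (cis2 \<tau>) (cis2 (\<tau> - z))"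

lemma jprod_eq_jprod': "Im \<tau> > 0 \<Longrightarrow> jprod \<tau> z = (1 - cis2 z) * jprod' \<tau> z"
  using qprod_rec[OF norm_cis2_less_1, of \<tau> "cis2 z"]
  by (simp add: jprod_def jprod'_def cis2_add mult_ac)

lemma jprod'_0: "jprod' \<tau> 0 = euler_prod (cis2 \<tau>) ^ 2"
  by (simp add: jprod'_def qprod_self power2_eq_square)

lemma jprod'_nonzero:
  assumes "\<bar>Im z\<bar> < Im \<tau>"
  shows "jprod' \<tau> z \<noteq> 0"
proof -
  have "norm (cis2 \<tau>) < 1" "norm (cis2 (\<tau> + z)) < 1" "norm (cis2 (\<tau> - z)) < 1"
    by (rule norm_cis2_less_1; use assms in simp)+
  thus ?thesis
    by (simp add: jprod'_def qprod_nonzero)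
qed

lemma jprod'_holomorphic [holomorphic_intros]:
  assumes "Im \<tau> > 0" "f holomorphic_on A"
  shows "(\<lambda>z. jprod' \<tau> (f z)) holomorphic_on A"
  unfolding jprod'_def by (intro holomorphic_intros assms norm_cis2_less_1)

text \<open>Numerator and denominator are first divided by \<open>z\<close> separately. Each
  quotient extends holomorphically over the origin, and the second one has no zeros because 0 is the
  only integer in \<open>A\<close>.\<close>

lemma cis2_ratio_holomorphic:
  assumes "open A" "\<And>z n. z \<in> A \<Longrightarrow> z = of_int n \<Longrightarrow> n = 0"
  shows "(\<lambda>z. if z = 0 then c else (1 - cis2 (c * z)) / (1 - cis2 z)) holomorphic_on A"
proof -
  define f where "f = (\<lambda>c z. if z = 0 then deriv (\<lambda>z. 1 - cis2 (c * z)) 0 else (1 - cis2 (c * z)) / z)"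
  have d: "deriv (\<lambda>z. 1 - cis2 (c * z)) 0 = - (2 * of_real pi * \<i> * c)" for c
    unfolding cis2_def by (rule DERIV_imp_deriv) (auto intro!: derivative_eq_intros)
  have hol: "f c holomorphic_on A" for c
    unfolding f_def
    by (rule pole_theorem_open_0[where g = "\<lambda>z. 1 - cis2 (c * z)" and a = 0])
       (auto intro!: holomorphic_intros assms)
  note d1 = d[of 1, simplified]
  have nz: "f 1 z \<noteq> 0" if "z \<in> A" for z
    using assms(2)[OF that] that by (auto simp: f_def d1 cis2_eq_1_iff)
  have "(\<lambda>z. f c z / f 1 z) holomorphic_on A"
    by (intro holomorphic_on_divide hol nz)
  also have "(\<lambda>z. f c z / f 1 z) = (\<lambda>z. if z = 0 then c else (1 - cis2 (c * z)) / (1 - cis2 z))"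
    by (auto simp: f_def d d1 fun_eq_iff)
  finally show ?thesis .
qed

text \<open>
  The exponential factor makes the quotient doubly periodic. It has a removable singularity at the
  origin, so its modulus attains a maximum on a period parallelogram.
\<close>
lemma jprod_inversion_constant:
  fixes y :: real
  assumes y: "y > 0"
  defines "\<tau> \<equiv> \<i> * of_real y" and "\<tau>' \<equiv> \<i> / of_real y"
  defines "G \<equiv> \<lambda>z. cis2 (z\<^sup>2 * \<tau>' / 2 + z / 2 + z * \<tau>' / 2) * jprod \<tau>' (- z * \<tau>') / jprod \<tau> z"
  assumes z: "\<bar>Re z\<bar> < 1" "\<bar>Im z\<bar> < y" "z \<noteq> 0"
  shows "G z = - \<tau>' * euler_prod (cis2 \<tau>') ^ 2 / euler_prod (cis2 \<tau>) ^ 2"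
proof -
  have im: "Im \<tau> > 0" "Im \<tau>' > 0" and tt: "\<tau> * \<tau>' = -1" and re: "Re \<tau> = 0" "Im \<tau> = y"
    using y by (auto simp: \<tau>_def \<tau>'_def)
  define A where "A = {z. \<bar>Re z\<bar> < 1 \<and> \<bar>Im z\<bar> < y}"
  \<comment> \<open>\<open>H\<close> is \<open>G\<close> with the zeros of both theta products at
    the origin cancelled; \<open>-\<tau>'\<close> is the limit of the quotient of the cancelled
    factors.\<close>
  define H where "H = (\<lambda>z. cis2 (z\<^sup>2 * \<tau>' / 2 + z / 2 + z * \<tau>' / 2) *
     (if z = 0 then -\<tau>' else (1 - cis2 (-\<tau>' * z)) / (1 - cis2 z)) * jprod' \<tau>' (-\<tau>' * z) / jprod' \<tau> z)"
  have A_eq: "A = box (-1 - \<i> * of_real y) (1 + \<i> * of_real y)"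
    by (auto simp: A_def in_box_complex_iff)
  have A: "open A" "connected A"
    unfolding A_eq by (auto intro: convex_connected convex_box)
  have nz: "jprod' \<tau> z \<noteq> 0" if "z \<in> A" for z
    using that by (intro jprod'_nonzero) (auto simp: A_def re)
  have hol: "H holomorphic_on A"
    unfolding H_def
    by (intro holomorphic_intros cis2_ratio_holomorphic A im nz)
       (auto simp: A_def)
  have G_H: "G z = H z" if "z \<noteq> 0" for z
    using that by (simp add: G_def H_def jprod_eq_jprod' im mult_ac)
  define \<epsilon> where "\<epsilon> = (\<lambda>z. z\<^sup>2 * \<tau>' / 2 + z / 2 + z * \<tau>' / 2)"
  have G_eq: "G z = cis2 (\<epsilon> z) * jprod \<tau>' (- z * \<tau>') / jprod \<tau> z" for z
    by (simp add: G_def \<epsilon>_def)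
  have tt': "\<tau> * (\<tau>' * w) = -w" for w
    using tt by (simp add: mult.assoc [symmetric])
  have per1: "G (z + 1) = G z" for z
  proof -
    have "- (z + 1) * \<tau>' = - z * \<tau>' - \<tau>'"
      by (simp add: algebra_simps)
    hence "jprod \<tau>' (- (z + 1) * \<tau>') = - cis2 (- z * \<tau>' - \<tau>') * jprod \<tau>' (- z * \<tau>')"
      using jprod_minus_period[OF im(2)] by simp
    moreover have "\<epsilon> (z + 1) = \<epsilon> z + (1/2 - (- z * \<tau>' - \<tau>'))"
      by (simp add: \<epsilon>_def field_simps power2_eq_square)
    ultimately show ?thesis
      unfolding G_eq by (simp only: jprod_plus_1 cis2_add cis2_diff[of "1/2"]) simp
  qed
  have per2: "G (z + \<tau>) = G z" for z
  proof -
    have "- (z + \<tau>) * \<tau>' = - z * \<tau>' + 1"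
      using tt by (simp add: algebra_simps)
    hence "jprod \<tau>' (- (z + \<tau>) * \<tau>') = jprod \<tau>' (- z * \<tau>')"
      by (simp only: jprod_plus_1)
    moreover have "\<epsilon> (z + \<tau>) = \<epsilon> z + (- z - 1/2)"
      by (simp add: \<epsilon>_def field_simps power2_eq_square tt tt')
    ultimately show ?thesis
      unfolding G_eq by (simp only: jprod_plus_period[OF im(1)] cis2_add[of "\<epsilon> z"] cis2_diff[of "-z"]) simp
  qed
  have per1': "G (z - 1) = G z" and per2': "G (z - \<tau>) = G z" for z
    using per1[of "z - 1"] per2[of "z - \<tau>"] by simp_all
  define K where "K = cbox (- 1/2 - \<i> * of_real (y/2)) (1/2 + \<i> * of_real (y/2))"
  have KA: "K \<subseteq> A"
    using y by (auto simp: K_def A_def in_cbox_complex_iff)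
  have red: "\<exists>z'\<in>K. H z' = H z" if "z \<in> A" for z
  proof -
    define z1 where "z1 = (if Re z > 1/2 then z - 1 else if Re z < -1/2 then z + 1 else z)"
    define z2 where "z2 = (if Im z1 > y/2 then z1 - \<tau> else if Im z1 < -y/2 then z1 + \<tau> else z1)"
    have "G z2 = G z"
      by (simp add: z1_def z2_def per1 per2 per1' per2')
    have z2: "Re z2 = (if Re z > 1/2 then Re z - 1 else if Re z < -1/2 then Re z + 1 else Re z)"
         "Im z2 = (if Im z > y/2 then Im z - y else if Im z < -y/2 then Im z + y else Im z)"
      by (simp_all add: z1_def z2_def re)
    have z: "\<bar>Re z\<bar> < 1" "\<bar>Im z\<bar> < y"
      using that by (auto simp: A_def)
    have Re: "(Re z2 = 0 \<longleftrightarrow> Re z = 0) \<and> \<bar>Re z2\<bar> \<le> 1/2"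
      using z(1) unfolding z2(1) abs_less_iff abs_le_iff
      by (cases "Re z > 1/2"; cases "Re z < -1/2"; simp; linarith)
    have Im: "(Im z2 = 0 \<longleftrightarrow> Im z = 0) \<and> \<bar>Im z2\<bar> \<le> y/2"
      using z(2) unfolding z2(2) abs_less_iff abs_le_iff
      by (cases "Im z > y/2"; cases "Im z < -y/2"; simp; linarith)
    \<comment> \<open>\<open>G\<close> and \<open>H\<close> are known to agree only away from 0, so
      the reduction into \<open>K\<close> must neither reach nor leave the origin.\<close>
    have "z2 = 0 \<longleftrightarrow> z = 0"
      using Re Im by (simp add: complex_eq_iff)
    moreover note \<open>G z2 = G z\<close>
    ultimately have "H z2 = H z"
      using G_H by metis
    moreover have "z2 \<in> K"
      using Re Im unfolding K_def in_cbox_complex_iff by (simp, linarith)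
    ultimately show ?thesis by blast
  qed
  have "compact K" "K \<noteq> {}"
    using y by (auto simp: K_def box_ne_empty Basis_complex_def)
  moreover have "continuous_on K (\<lambda>z. norm (H z))"
    by (rule continuous_on_norm[OF holomorphic_on_imp_continuous_on[OF holomorphic_on_subset[OF hol KA]]])
  ultimately obtain z0 where z0: "z0 \<in> K" "\<And>z. z \<in> K \<Longrightarrow> norm (H z) \<le> norm (H z0)"
    using continuous_attains_sup by metis
  have "H constant_on A"
  proof (rule maximum_modulus_principle[OF hol A A(1) order_refl])
    show "z0 \<in> A" using z0 KA by blast
    show "norm (H z) \<le> norm (H z0)" if "z \<in> A" for z
      using red[OF that] z0 by metis
  qed
  hence "H z = H 0"
    using z y by (auto simp: constant_on_def A_def)
  also have "H 0 = - \<tau>' * euler_prod (cis2 \<tau>') ^ 2 / euler_prod (cis2 \<tau>) ^ 2"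
    by (simp add: H_def jprod'_0)
  finally show ?thesis
    using G_H z by simp
qed

text \<open>
  The constant is known as a limit at \<open>0\<close>; its cube is also the product of the values at the
  three half periods, in which the infinite products cancel.
\<close>
lemma euler_prod_inversion_power6:
  fixes y :: real
  assumes y: "y > 0"
  defines "\<tau> \<equiv> \<i> * of_real y" and "\<tau>' \<equiv> \<i> / of_real y"
  shows "euler_prod (cis2 \<tau>') ^ 6 = of_real (y ^ 3) * cis2 ((\<tau> - \<tau>') / 4) * euler_prod (cis2 \<tau>) ^ 6"
proof -
  have im: "Im \<tau> > 0" "Im \<tau>' > 0" and tt: "\<tau> * \<tau>' = -1" and re: "Re \<tau> = 0" "Im \<tau> = y"
    using y by (auto simp: \<tau>_def \<tau>'_def)
  define s s' where "s = cis2 (\<tau>/2)" and "s' = cis2 (\<tau>'/2)"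
  have s: "norm s < 1" "norm s' < 1" "s \<noteq> 0" "s' \<noteq> 0"
    using im by (auto simp: s_def s'_def norm_cis2_less_1)
  have ss: "cis2 \<tau> = s\<^sup>2" "cis2 \<tau>' = s'\<^sup>2"
    by (simp_all add: s_def s'_def cis2_power)
  have tt': "\<tau> * (\<tau>' * w) = -w" for w
    using tt by (simp add: mult.assoc [symmetric])
  define G where "G = (\<lambda>z. cis2 (z\<^sup>2 * \<tau>' / 2 + z / 2 + z * \<tau>' / 2) * jprod \<tau>' (- z * \<tau>') / jprod \<tau> z)"
  define C where "C = - \<tau>' * euler_prod (cis2 \<tau>') ^ 2 / euler_prod (cis2 \<tau>) ^ 2"
  have G: "G z = C" if "\<bar>Re z\<bar> < 1" "\<bar>Im z\<bar> < y" "z \<noteq> 0" for z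
    unfolding G_def C_def \<tau>_def \<tau>'_def by (rule jprod_inversion_constant[OF y that])
  define p1 p2 p3 where "p1 = qprod (s\<^sup>2) s" and "p2 = qprod (s\<^sup>2) (-s)" and "p3 = qprod (s\<^sup>2) (-(s\<^sup>2))"
  define p1' p2' p3' where "p1' = qprod (s'\<^sup>2) s'" and "p2' = qprod (s'\<^sup>2) (-s')" and "p3' = qprod (s'\<^sup>2) (-(s'\<^sup>2))"
  have pp: "p1 * p2 * p3 = 1" "p1' * p2' * p3' = 1"
    using qprod_half_periods s by (auto simp: p1_def p2_def p3_def p1'_def p2'_def p3'_def)
  have T1: "jprod \<tau> (1/2) = 2 * p3\<^sup>2" "jprod \<tau> (\<tau>/2) = p1\<^sup>2" "jprod \<tau> (1/2 + \<tau>/2) = p2\<^sup>2"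
    using im by (simp_all add: jprod_1_half jprod_half_period jprod_half_periods p1_def p2_def p3_def ss s_def)
  have half: "jprod \<tau>' (1/2) = 2 * p3'\<^sup>2" "jprod \<tau>' (\<tau>'/2) = p1'\<^sup>2" "jprod \<tau>' (1/2 + \<tau>'/2) = p2'\<^sup>2"
    using im by (simp_all add: jprod_1_half jprod_half_period jprod_half_periods p1'_def p2'_def p3'_def ss s'_def)
  \<comment> \<open>For z = 1/2 and z = (1 + \<tau>)/2 the argument \<open>- z * \<tau>'\<close> is
    a half period only after adding \<tau>'; the shift costs an automorphy factor.\<close>
  have m1: "jprod \<tau>' (- \<tau>' / 2) = - p1'\<^sup>2 / s'"
    using jprod_minus_period[OF im(2), of "\<tau>'/2"] half by (simp add: s'_def cis2_minus)
  have m2: "jprod \<tau>' (1/2 - \<tau>' / 2) = p2'\<^sup>2 / s'"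
  proof -
    have "1/2 - \<tau>' / 2 = (1/2 + \<tau>'/2) - \<tau>'"
      by simp
    also have "jprod \<tau>' \<dots> = - cis2 (1/2 - \<tau>'/2) * jprod \<tau>' (1/2 + \<tau>'/2)"
      using jprod_minus_period[OF im(2), of "1/2 + \<tau>'/2"] by (simp add: algebra_simps)
    finally show ?thesis
      by (simp add: half s'_def cis2_diff)
  qed
  have e1: "G (1/2) = cis2 (3 * \<tau>' / 8 + 1/4) * (- p1'\<^sup>2 / s') / (2 * p3\<^sup>2)"
  proof -
    have "(1/2)\<^sup>2 * \<tau>' / 2 + (1/2) / 2 + (1/2) * \<tau>' / 2 = 3 * \<tau>' / 8 + 1/4"
      by (simp add: field_simps power2_eq_square)
    moreover have "- (1/2) * \<tau>' = - \<tau>' / 2"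
      by simp
    ultimately show ?thesis
      unfolding G_def T1 by (simp only: m1)
  qed
  have e2: "G (\<tau>/2) = cis2 (\<tau>/8 - 1/4) * (2 * p3'\<^sup>2) / p1\<^sup>2"
  proof -
    have "(\<tau>/2)\<^sup>2 * \<tau>' / 2 + (\<tau>/2) / 2 + (\<tau>/2) * \<tau>' / 2 = \<tau>/8 - 1/4"
      by (simp add: field_simps power2_eq_square tt tt')
    moreover have "- (\<tau>/2) * \<tau>' = 1/2"
      using tt by simp
    ultimately show ?thesis
      unfolding G_def T1 by (simp only: half)
  qed
  have e3: "G (1/2 + \<tau>/2) = cis2 (3 * \<tau>'/8 + \<tau>/8 - 1/4) * (p2'\<^sup>2 / s') / p2\<^sup>2"
  proof -
    have "(1/2 + \<tau>/2)\<^sup>2 * \<tau>' / 2 + (1/2 + \<tau>/2) / 2 + (1/2 + \<tau>/2) * \<tau>' / 2 = 3 * \<tau>'/8 + \<tau>/8 - 1/4"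
      by (simp add: field_simps power2_eq_square tt tt')
    moreover have "- (1/2 + \<tau>/2) * \<tau>' = 1/2 - \<tau>' / 2"
      using tt by (simp add: field_simps)
    ultimately show ?thesis
      unfolding G_def T1 by (simp only: m2)
  qed
  have "C ^ 3 = G (1/2) * G (\<tau>/2) * G (1/2 + \<tau>/2)"
    using y by (simp add: G re complex_eq_iff power3_eq_cube)
  also have "\<dots> = (cis2 (3 * \<tau>' / 8 + 1/4) * cis2 (\<tau>/8 - 1/4) * cis2 (3 * \<tau>'/8 + \<tau>/8 - 1/4) / s'\<^sup>2) *
      (- (p1' * p2' * p3')\<^sup>2 / (p1 * p2 * p3)\<^sup>2)"
    unfolding e1 e2 e3 by (simp add: power2_eq_square mult_ac)
  also have "cis2 (3 * \<tau>' / 8 + 1/4) * cis2 (\<tau>/8 - 1/4) * cis2 (3 * \<tau>'/8 + \<tau>/8 - 1/4) / s'\<^sup>2 =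
      cis2 ((3 * \<tau>' / 8 + 1/4) + (\<tau>/8 - 1/4) + (3 * \<tau>'/8 + \<tau>/8 - 1/4) - \<tau>')"
    unfolding cis2_diff[of _ \<tau>'] cis2_add[symmetric] ss ..
  also have "(3 * \<tau>' / 8 + 1/4) + (\<tau>/8 - 1/4) + (3 * \<tau>'/8 + \<tau>/8 - 1/4) - \<tau>' = (\<tau> - \<tau>') / 4 - 1/4"
    by (simp add: field_simps)
  finally have "C ^ 3 = \<i> * cis2 ((\<tau> - \<tau>') / 4)"
    by (simp add: pp cis2_diff)
  moreover have "C ^ 3 = (- \<tau>') ^ 3 * euler_prod (cis2 \<tau>') ^ 6 / euler_prod (cis2 \<tau>) ^ 6"
    by (simp add: C_def power_mult_distrib power_divide power_mult [symmetric])
  moreover have "euler_prod (cis2 \<tau>) \<noteq> 0"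
    using s by (simp add: ss qprod_self [symmetric] qprod_nonzero norm_power power_less_one_iff)
  ultimately have eq: "(- \<tau>') ^ 3 * euler_prod (cis2 \<tau>') ^ 6 = \<i> * cis2 ((\<tau> - \<tau>') / 4) * euler_prod (cis2 \<tau>) ^ 6"
    by (metis nonzero_divide_eq_eq power_not_zero)
  have \<tau>': "(- \<tau>') ^ 3 * of_real (y ^ 3) = \<i>"
    using y by (simp add: \<tau>'_def power3_eq_cube field_simps)
  have "\<i> * euler_prod (cis2 \<tau>') ^ 6 = of_real (y ^ 3) * ((- \<tau>') ^ 3 * euler_prod (cis2 \<tau>') ^ 6)"
    unfolding \<tau>'[symmetric] by (simp only: mult_ac)
  also have "\<dots> = \<i> * (of_real (y ^ 3) * cis2 ((\<tau> - \<tau>') / 4) * euler_prod (cis2 \<tau>) ^ 6)"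
    unfolding eq by (simp only: mult_ac)
  finally show ?thesis
    by simp
qed

section \<open>From the theta product to \<eta>\<close>

lemma Im_inversion_pos: "Im \<tau> > 0 \<Longrightarrow> Im (-1/\<tau>) > 0"
  by (auto simp: Im_divide intro!: divide_pos_pos) (metis less_irrefl sum_power2_gt_zero_iff)

lemma dedekind_eta_altdef: "dedekind_eta \<tau> = cis2 (\<tau> / 24) * euler_prod (cis2 \<tau>)"
  by (simp add: dedekind_eta_def qpow_def cis2_def euler_prod_def field_simps)

lemma euler_prod_nonzero: "norm q < 1 \<Longrightarrow> euler_prod q \<noteq> 0"
  using qprod_nonzero[of q q] by (simp add: qprod_self)

lemma dedekind_eta_holomorphic:
  assumes "f holomorphic_on A" "\<And>z. z \<in> A \<Longrightarrow> Im (f z) > 0"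
  shows "(\<lambda>z. dedekind_eta (f z)) holomorphic_on A"
proof -
  have "(\<lambda>z. euler_prod (cis2 (f z))) holomorphic_on A"
    by (rule holomorphic_on_compose_gen[of "\<lambda>z. cis2 (f z)" A euler_prod "ball 0 1", unfolded o_def])
       (use assms in \<open>auto simp: norm_cis2_less_1 intro!: holomorphic_intros holomorphic_euler_prod\<close>)
  thus ?thesis
    unfolding dedekind_eta_altdef by (intro holomorphic_intros assms) auto
qed

lemma euler_prod_of_real:
  assumes "0 \<le> x" "x < 1"
  obtains p where "p \<ge> 0" "euler_prod (of_real x) = of_real p"
proof -
  have lim: "(\<lambda>N. \<Prod>n<N. 1 - of_real x ^ n * of_real x) \<longlonglongrightarrow> euler_prod (of_real x)"
    using qprod_LIMSEQ[of "of_real x" "of_real x"] assms by (simp add: qprod_self)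
  have *: "(\<Prod>n<N. 1 - of_real x ^ n * of_real x) = (of_real (\<Prod>n<N. 1 - x ^ Suc n) :: complex)" for N
    by (simp add: mult.commute)
  have "1 - x ^ Suc n \<ge> 0" for n
    using power_le_one[of x "Suc n"] assms by linarith
  hence "(\<Prod>n<N. 1 - of_real x ^ n * of_real x) \<in> (\<real>\<^sub>\<ge>\<^sub>0 :: complex set)" for N
    unfolding * by (subst nonneg_Reals_of_real_iff) (auto intro!: prod_nonneg)
  hence "euler_prod (of_real x) \<in> \<real>\<^sub>\<ge>\<^sub>0"
    by (intro Lim_in_closed_set[OF closed_nonneg_Reals_complex _ _ lim]) auto
  thus ?thesis
    by (auto elim!: nonneg_Reals_cases intro: that)
qed

lemma cis2_imaginary: "cis2 (\<i> * of_real y) = of_real (exp (-2 * pi * y))"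
  by (simp add: cis2_def exp_of_real [symmetric] mult_ac)

lemma dedekind_eta_imaginary:
  assumes "y > 0"
  obtains p where "p \<ge> 0" "dedekind_eta (\<i> * of_real y) = of_real p"
proof -
  have "exp (-2 * pi * y) < 1"
    using assms by simp
  then obtain p where p: "p \<ge> 0" "euler_prod (cis2 (\<i> * of_real y)) = of_real p"
    unfolding cis2_imaginary by (rule euler_prod_of_real[rotated]) auto
  have "dedekind_eta (\<i> * of_real y) = of_real (exp (-2 * pi * (y / 24)) * p)"
    unfolding dedekind_eta_altdef p(2) using cis2_imaginary[of "y / 24"] by simp
  thus ?thesis
    using p(1) by (intro that[of "exp (-2 * pi * (y / 24)) * p"]) auto
qed

text \<open>On the imaginary axis \<eta> has non-negative real values, so sixth roots can be taken
  in \<open>euler_prod_inversion_power6\<close> without ambiguity.\<close>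

lemma dedekind_eta_inversion_imaginary:
  assumes y: "y > 0"
  shows "dedekind_eta (\<i> / of_real y) = of_real (sqrt y) * dedekind_eta (\<i> * of_real y)"
proof -
  obtain a where a: "a \<ge> 0" "dedekind_eta (\<i> * of_real y) = of_real a"
    using dedekind_eta_imaginary[OF y] .
  obtain b where b: "b \<ge> 0" "dedekind_eta (\<i> / of_real y) = of_real b"
    using dedekind_eta_imaginary[of "1 / y"] y by auto
  have "dedekind_eta (\<i> / of_real y) ^ 6 = of_real (y ^ 3) * dedekind_eta (\<i> * of_real y) ^ 6"
    unfolding dedekind_eta_altdef power_mult_distrib euler_prod_inversion_power6[OF y]
    by (simp add: cis2_power diff_divide_distrib cis2_diff mult.commute[of 4])
  hence "b ^ 6 = y ^ 3 * a ^ 6"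
    unfolding a b of_real_power[symmetric] of_real_mult[symmetric] of_real_eq_iff .
  also have "y ^ 3 = (sqrt y ^ 2) ^ 3"
    using y by simp
  also have "\<dots> * a ^ 6 = (sqrt y * a) ^ 6"
    by (simp only: power_mult_distrib power_mult [symmetric]) simp
  finally have "b = sqrt y * a"
    using a b y by (subst (asm) power_eq_iff_eq_base) auto
  thus ?thesis
    by (simp add: a b)
qed

text \<open>Analytic continuation from the imaginary axis, whose points accumulate at
  \<open>\<i>\<close>. The root is holomorphic because -i\<tau> stays in the right half plane, away
  from the cut of \<open>csqrt\<close>.\<close>

theorem dedekind_eta_inversion:
  assumes "Im \<tau> > 0"
  shows "dedekind_eta (-1/\<tau>) = csqrt (-\<i> * \<tau>) * dedekind_eta \<tau>"
proof -
  define A where "A = {\<tau>. Im \<tau> > 0}"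
  define U where "U = (\<lambda>y::real. \<i> * of_real y) ` {0<..}"
  have A: "open A" "connected A"
    unfolding A_def by (auto simp: open_halfspace_Im_gt intro: convex_connected convex_halfspace_Im_gt)
  have nz: "z \<noteq> 0" and im: "Im (-1/z) > 0" and re: "Re (-\<i> * z) > 0" if "z \<in> A" for z
    using that by (auto simp: A_def Im_divide power2_eq_square intro!: divide_pos_pos)
                  (simp add: sum_squares_gt_zero_iff)
  have hol: "(\<lambda>\<tau>. dedekind_eta (-1/\<tau>) - csqrt (-\<i> * \<tau>) * dedekind_eta \<tau>) holomorphic_on A"
    by (intro holomorphic_intros dedekind_eta_holomorphic holomorphic_on_csqrt im nz)
       (use re in \<open>auto simp: A_def complex_nonpos_Reals_iff\<close>)
  have lim: "\<i> islimpt U"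
  proof -
    have "(\<lambda>n. \<i> * of_real (1 + 1 / real (Suc n))) \<longlonglongrightarrow> \<i> * of_real (1 + 0)"
      by (intro tendsto_intros LIMSEQ_Suc lim_inverse_n'[unfolded inverse_eq_divide])
    hence "(\<lambda>n. \<i> * of_real (1 + 1 / real (Suc n))) \<longlonglongrightarrow> \<i>" by simp
    moreover have "\<i> * of_real (1 + 1 / real (Suc n)) \<in> U - {\<i>}" for n
      unfolding U_def by (auto simp: complex_eq_iff intro!: imageI add_pos_pos)
    ultimately show ?thesis
      unfolding islimpt_sequential by (intro exI[of _ "\<lambda>n. \<i> * of_real (1 + 1 / real (Suc n))"]) blast
  qed
  have "dedekind_eta (-1/\<tau>) - csqrt (-\<i> * \<tau>) * dedekind_eta \<tau> = 0"
  proof (rule analytic_continuation[OF hol A _ _ lim])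
    fix z assume "z \<in> U"
    then obtain y :: real where y: "y > 0" "z = \<i> * of_real y"
      by (auto simp: U_def)
    have "-1 / z = \<i> / of_real y" "-\<i> * z = of_real y"
      using y by (simp_all add: field_simps)
    thus "dedekind_eta (-1/z) - csqrt (-\<i> * z) * dedekind_eta z = 0"
      using dedekind_eta_inversion_imaginary[OF y(1)] y by simp
  qed (use assms in \<open>auto simp: U_def A_def\<close>)
  thus ?thesis by simp
qed

section \<open>The Jacobi symbol\<close>

text \<open>The classical symbol only for odd \<open>n\<close>: at the prime 2 the plain
  \<open>Legendre x 2\<close> is taken, unlike in \<open>kronecker\<close>. Multiplicativity in
  \<open>x\<close> and reciprocity are therefore stated for odd moduli.\<close>

definition jacobi :: "int \<Rightarrow> nat \<Rightarrow> int" where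
  "jacobi x n = (\<Prod>p\<in>#prime_factorization n. Legendre x (int p))"

lemma Legendre_range: "Legendre a p \<in> {-1, 0, 1}"
  by (auto simp: Legendre_def)

lemma Legendre_cong: "[a = b] (mod p) \<Longrightarrow> Legendre a p = Legendre b p"
proof -
  assume ab: "[a = b] (mod p)"
  hence "[x = a] (mod p) \<longleftrightarrow> [x = b] (mod p)" "[a = x] (mod p) \<longleftrightarrow> [b = x] (mod p)" for x
    by (auto simp: cong_def)
  thus ?thesis
    by (simp add: Legendre_def QuadRes_def)
qed

lemma Legendre_eq_0_iff: "Legendre a p = 0 \<longleftrightarrow> p dvd a"
  by (auto simp: Legendre_def cong_0_iff)

text \<open>The residues -1, 0, 1 are distinct modulo p > 2, so congruences obtained from Euler's
  criterion can be turned into equations.\<close>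

lemma Legendre_eqI:
  assumes "[Legendre a p = b] (mod p)" "b \<in> {-1, 0, 1}" "p > 2"
  shows "Legendre a p = b"
proof -
  have "p dvd Legendre a p - b"
    using assms by (simp add: cong_iff_dvd_diff)
  moreover have "\<bar>Legendre a p - b\<bar> < p"
    using Legendre_range[of a p] assms by auto
  ultimately show ?thesis
    using zdvd_imp_le[of p "\<bar>Legendre a p - b\<bar>"] by fastforce
qed

lemma Legendre_mult:
  assumes "prime p" "p > (2::nat)"
  shows "Legendre (a * b) (int p) = Legendre a (int p) * Legendre b (int p)"
proof (rule Legendre_eqI)
  let ?h = "(p - 1) div 2"
  have "[Legendre (a * b) (int p) = (a * b) ^ ?h] (mod int p)"
    by (rule euler_criterion[OF assms])
  also have "(a * b) ^ ?h = a ^ ?h * b ^ ?h"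
    by (rule power_mult_distrib)
  also have "[\<dots> = Legendre a (int p) * Legendre b (int p)] (mod int p)"
    by (intro cong_mult cong_sym[OF euler_criterion[OF assms]])
  finally show "[Legendre (a * b) (int p) = Legendre a (int p) * Legendre b (int p)] (mod int p)" .
qed (use assms Legendre_range[of a p] Legendre_range[of b p] in auto)

lemma Legendre_minus_1:
  assumes "prime p" "p > (2::nat)"
  shows "Legendre (-1) (int p) = (if p mod 4 = 3 then -1 else 1)"
proof (rule Legendre_eqI)
  have "odd p"
    using assms prime_odd_nat by auto
  hence "odd ((p - 1) div 2) \<longleftrightarrow> p mod 4 = 3"
    by presburger
  hence "(if p mod 4 = 3 then -1 else 1) = (-1::int) ^ ((p - 1) div 2)"
    by (auto simp: power_minus_odd)
  thus "[Legendre (-1) (int p) = (if p mod 4 = 3 then -1 else 1)] (mod int p)"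
    using euler_criterion[OF assms] by simp
qed (use assms in auto)

lemma jacobi_1_right [simp]: "jacobi x 1 = 1" "jacobi x (Suc 0) = 1"
  by (simp_all add: jacobi_def)

lemma jacobi_mult_right: "m > 0 \<Longrightarrow> n > 0 \<Longrightarrow> jacobi x (m * n) = jacobi x m * jacobi x n"
  by (simp add: jacobi_def prime_factorization_mult)

lemma jacobi_prime: "prime p \<Longrightarrow> jacobi x p = Legendre x (int p)"
  by (simp add: jacobi_def prime_factorization_prime)

lemma odd_prime_gt_2: "prime (p::nat) \<Longrightarrow> odd p \<Longrightarrow> p > 2"
  using prime_gt_1_nat[of p] by presburger

lemma odd_nat_induct [consumes 1, case_names one factor]:
  fixes n :: nat
  assumes "odd n" "P 1" "\<And>p n. prime p \<Longrightarrow> odd p \<Longrightarrow> odd n \<Longrightarrow> P n \<Longrightarrow> P (p * n)"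
  shows "P n"
proof -
  have "odd n \<longrightarrow> P n"
    by (induction n rule: prime_divisors_induct) (use assms in auto)
  thus ?thesis using assms by simp
qed

lemma jacobi_cong:
  assumes "[x = y] (mod int n)"
  shows "jacobi x n = jacobi y n"
  unfolding jacobi_def
proof (intro arg_cong[where f = prod_mset] image_mset_cong Legendre_cong)
  fix p assume "p \<in># prime_factorization n"
  hence "int p dvd int n" by auto
  thus "[x = y] (mod int p)"
    using assms cong_dvd_modulus by blast
qed

lemma jacobi_mult_left:
  assumes "odd n"
  shows "jacobi (x * y) n = jacobi x n * jacobi y n"
  using assms
proof (induction n rule: odd_nat_induct)
  case (factor p n)
  thus ?case
    by (simp add: jacobi_mult_right jacobi_prime prime_gt_0_nat odd_pos Legendre_mult odd_prime_gt_2)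
qed auto

lemma jacobi_1_left [simp]: "odd n \<Longrightarrow> jacobi 1 n = 1"
proof (induction n rule: odd_nat_induct)
  case (factor p n)
  have "Legendre 1 (int p) = 1"
    using factor(1,2) Legendre_mult[of p 1 1] odd_prime_gt_2[of p] Legendre_eq_0_iff[of 1 "int p"]
    by auto
  with factor show ?case
    by (simp add: jacobi_mult_right jacobi_prime prime_gt_0_nat odd_pos)
qed auto

lemma jacobi_range: "jacobi x n \<in> {-1, 0, 1}"
proof (induction n rule: prime_divisors_induct)
  case (factor p n)
  show ?case
  proof (cases "n = 0")
    case False
    thus ?thesis using factor Legendre_range[of x "int p"]
      by (auto simp: jacobi_mult_right jacobi_prime prime_gt_0_nat)
  qed (simp add: jacobi_def)
qed (simp_all add: jacobi_def)

lemma jacobi_eq_0_iff: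
  assumes "n > 0"
  shows "jacobi x n = 0 \<longleftrightarrow> \<not> coprime x (int n)"
  using assms
proof (induction n rule: prime_divisors_induct)
  case (factor p n)
  have "coprime x (int p) \<longleftrightarrow> \<not> int p dvd x"
    using factor(1) by (metis coprime_commute prime_imp_coprime prime_nat_int_transfer
        coprime_common_divisor dvd_refl not_prime_unit)
  with factor show ?case
    by (auto simp: jacobi_mult_right jacobi_prime prime_gt_0_nat Legendre_eq_0_iff)
qed auto

lemma jacobi_square:
  assumes "n > 0" "coprime x (int n)"
  shows "jacobi x n * jacobi x n = 1"
  using jacobi_range[of x n] jacobi_eq_0_iff[of n x] assms by auto

lemma mod4_mult_eq_3: 
  "odd (m::nat) \<Longrightarrow> odd n \<Longrightarrow> (m * n) mod 4 = 3 \<longleftrightarrow> (m mod 4 = 3) \<noteq> (n mod 4 = 3)"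
proof -
  assume "odd m" "odd n"
  hence "m mod 4 = 1 \<or> m mod 4 = 3" "n mod 4 = 1 \<or> n mod 4 = 3" by presburger+
  thus ?thesis by (subst mod_mult_eq [symmetric]) auto
qed

lemma jacobi_minus_1:
  assumes "odd n"
  shows "jacobi (-1) n = (if n mod 4 = 3 then -1 else 1)"
  using assms
proof (induction n rule: odd_nat_induct)
  case (factor p n)
  have "(p * n) mod 4 = 3 \<longleftrightarrow> (p mod 4 = 3) \<noteq> (n mod 4 = 3)"
    by (intro mod4_mult_eq_3 factor)
  with factor show ?case
    by (auto simp: jacobi_mult_right jacobi_prime prime_gt_0_nat odd_pos Legendre_minus_1 odd_prime_gt_2)
qed auto

text \<open>Lifted from primes in one argument at a time. The signs multiply correctly because, by
  \<open>mod4_mult_eq_3\<close>, being 3 modulo 4 is additive modulo 2 along products of odd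
  numbers.\<close>

theorem jacobi_reciprocity:
  assumes "odd m" "odd n" "coprime m n"
  shows "jacobi (int m) n * jacobi (int n) m = (if m mod 4 = 3 \<and> n mod 4 = 3 then -1 else 1)"
proof -
  have base: "jacobi (int p) q * jacobi (int q) p = (if p mod 4 = 3 \<and> q mod 4 = 3 then -1 else 1)"
    if "prime p" "prime q" "odd p" "odd q" "p \<noteq> q" for p q
  proof -
    have "Legendre p q * Legendre q p = (-1::int) ^ ((p - 1) div 2 * ((q - 1) div 2))"
      using that by (intro Quadratic_Reciprocity odd_prime_gt_2) auto
    moreover have "odd ((p - 1) div 2) \<longleftrightarrow> p mod 4 = 3" "odd ((q - 1) div 2) \<longleftrightarrow> q mod 4 = 3"
      using that(3,4) by presburger+
    ultimately show ?thesis
      using that by (auto simp: jacobi_prime)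
  qed
  have step: "jacobi (int p) n * jacobi (int n) p = (if p mod 4 = 3 \<and> n mod 4 = 3 then -1 else 1)"
    if "odd n" "prime p" "odd p" "coprime p n" for p n
    using that
  proof (induction n rule: odd_nat_induct)
    case (factor q n)
    have "jacobi (int p) q * jacobi (int q) p = (if p mod 4 = 3 \<and> q mod 4 = 3 then -1 else 1)"
      using factor by (intro base) auto
    moreover have "jacobi (int p) n * jacobi (int n) p = (if p mod 4 = 3 \<and> n mod 4 = 3 then -1 else 1)"
      using factor by simp
    moreover have "(q * n) mod 4 = 3 \<longleftrightarrow> (q mod 4 = 3) \<noteq> (n mod 4 = 3)"
      by (intro mod4_mult_eq_3 factor)
    moreover have "jacobi (int p) (q * n) * jacobi (int (q * n)) p =
       (jacobi (int p) q * jacobi (int q) p) * (jacobi (int p) n * jacobi (int n) p)"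
      using factor by (simp add: jacobi_mult_right jacobi_mult_left prime_gt_0_nat odd_pos)
    ultimately show ?case
      by (auto split: if_splits)
  qed auto
  show ?thesis
    using assms
  proof (induction m rule: odd_nat_induct)
    case (factor q m)
    have "jacobi (int q) n * jacobi (int n) q = (if q mod 4 = 3 \<and> n mod 4 = 3 then -1 else 1)"
      using factor by (intro step) auto
    moreover have "jacobi (int m) n * jacobi (int n) m = (if m mod 4 = 3 \<and> n mod 4 = 3 then -1 else 1)"
      using factor by simp
    moreover have "(q * m) mod 4 = 3 \<longleftrightarrow> (q mod 4 = 3) \<noteq> (m mod 4 = 3)"
      by (intro mod4_mult_eq_3 factor)
    moreover have "jacobi (int (q * m)) n * jacobi (int n) (q * m) =
       (jacobi (int q) n * jacobi (int n) q) * (jacobi (int m) n * jacobi (int n) m)"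
      using factor by (simp add: jacobi_mult_right jacobi_mult_left prime_gt_0_nat odd_pos)
    ultimately show ?case
      by (auto split: if_splits)
  qed auto
qed

text \<open>\<open>2 \<equiv> - (n - 2) (mod n)\<close>, so reciprocity for \<open>n\<close> and \<open>n - 2\<close> reduces the modulus by two.\<close>
lemma jacobi_2:
  assumes "odd n"
  shows "jacobi 2 n = (if n mod 8 = 1 \<or> n mod 8 = 7 then 1 else -1)"
  using assms
proof (induction n rule: nat_less_induct)
  case (1 n)
  show ?case
  proof (cases "n = 1")
    case False
    with 1 have n: "n \<ge> 3" "odd n" by presburger+
    define k where "k = n - 2"
    have k: "odd k" "k < n" "n = k + 2"
      using n by (auto simp: k_def)
    have cop: "coprime k n"
      using k(1) unfolding k(3) coprime_iff_gcd_eq_1 gcd_add2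
      by (simp add: coprime_iff_gcd_eq_1 [symmetric])
    have "[2 = (-1) * int k] (mod int n)"
      using k by (simp add: cong_iff_dvd_diff)
    hence "jacobi 2 n = jacobi (-1) n * jacobi (int k) n"
      using n by (metis jacobi_cong jacobi_mult_left)
    also have "jacobi (int k) n = jacobi (int n) k"
    proof -
      have "\<not> (k mod 4 = 3 \<and> n mod 4 = 3)"
        using k by presburger
      hence "jacobi (int k) n * jacobi (int n) k = 1"
        using jacobi_reciprocity[OF k(1) n(2) cop] by auto
      thus ?thesis
        using jacobi_range[of "int k" n] jacobi_range[of "int n" k] by auto
    qed
    also have "jacobi (int n) k = jacobi 2 k"
      using k by (intro jacobi_cong) (simp add: cong_iff_dvd_diff)
    also have "jacobi 2 k = (if k mod 8 = 1 \<or> k mod 8 = 7 then 1 else -1)"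
      using 1 k by blast
    also have "jacobi (-1) n = (if n mod 4 = 3 then -1 else 1)"
      by (rule jacobi_minus_1) fact
    finally have eq: "jacobi 2 n = (if n mod 4 = 3 then -1 else 1) * (if k mod 8 = 1 \<or> k mod 8 = 7 then 1 else -1)" .
    have "k mod 8 = 1 \<or> k mod 8 = 3 \<or> k mod 8 = 5 \<or> k mod 8 = 7"
      using k(1) by presburger
    moreover have "n mod 8 = (k mod 8 + 2) mod 8" "n mod 4 = (k mod 8 + 2) mod 4"
      unfolding k(3) mod_add_left_eq[symmetric, of k 2 8] mod_add_left_eq[symmetric, of k 2 4]
        mod_add_left_eq[symmetric, of "k mod 8" 2 4] by (simp_all add: mod_mod_cancel)
    ultimately show ?thesis
      unfolding eq by (elim disjE) simp_all
  qed auto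
qed

lemma kronecker_eq_jacobi:
  assumes "odd n"
  shows "kronecker x (int n) = jacobi x n"
proof -
  have "kronecker_prime x p = Legendre x (int p)" if "p \<in># prime_factorization n" for p
    using that assms by (auto simp: kronecker_prime_def)
  hence "image_mset (kronecker_prime x) (prime_factorization n) = image_mset (\<lambda>p. Legendre x (int p)) (prime_factorization n)"
    by (intro image_mset_cong) simp
  thus ?thesis
    using odd_pos[OF assms] by (simp add: kronecker_def jacobi_def)
qed

section \<open>The multiplier system of \<open>\<eta>\<close>\<close>

lemma cis2_cong:
  assumes "[a = b] (mod m)" "m \<noteq> 0"
  shows "cis2 (of_int a / of_int m) = cis2 (of_int b / of_int m)"
proof -
  obtain k where "a = b + m * k"
    using assms(1) by (metis cong_iff_lin cong_sym)
  hence "of_int a / of_int m = of_int b / of_int m + (of_int k :: complex)"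
    using assms(2) by (simp add: field_simps)
  thus ?thesis
    by (simp add: cis2_add)
qed

lemma cis2_half_int: "cis2 (of_int a / 2) = (if even a then 1 else -1)"
proof -
  have "cis2 (of_int a / of_int 2) = cis2 (of_int (a mod 2) / of_int 2)"
    by (intro cis2_cong) (auto simp: cong_def)
  moreover have "a mod 2 = (if even a then 0 else 1)"
    by presburger
  ultimately show ?thesis
    by auto
qed

lemma cis2_eighth: "Re (cis2 (1/8)) = sqrt 2 / 2" "Im (cis2 (1/8)) = sqrt 2 / 2"
  by (simp_all add: cis2_def Re_exp Im_exp cos_45 sin_45)

lemma dedekind_eta_plus_int: "dedekind_eta (\<tau> + of_int k) = cis2 (of_int k / 24) * dedekind_eta \<tau>"
  by (simp add: dedekind_eta_altdef cis2_add add_divide_distrib mult_ac)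

text \<open>If w is the principal root, then Re (w * w) > 0 confines w to the sector of arguments
  below pi/4 in modulus. Products of two such roots stay in the right half plane, which is how all
  branches below are decided.\<close>

lemma csqrt_Re_gt:
  assumes "Re z > 0"
  shows "\<bar>Im (csqrt z)\<bar> < Re (csqrt z)"
proof -
  have "Re (csqrt z ^ 2) > 0"
    using assms by simp
  hence "(Im (csqrt z))\<^sup>2 < (Re (csqrt z))\<^sup>2"
    by (simp add: power2_eq_square)
  moreover have "Re (csqrt z) \<ge> 0"
    using csqrt_principal[of z] by auto
  ultimately show ?thesis
    by (metis abs_of_nonneg abs_square_less_1 power2_abs power_less_imp_less_base)
qed

lemma square_eq_Re_pos:
  fixes x y :: complex
  assumes "x\<^sup>2 = y\<^sup>2" "Re x > 0" "Re y > 0"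
  shows "x = y"
  using assms by (auto simp: power2_eq_iff)

text \<open>Both sides have the same square and positive real part: the three roots have arguments
  below pi/4 in modulus, and \<open>cis2 (1/8)\<close> rotates by exactly pi/4.\<close>

lemma csqrt_mult_Re_pos:
  assumes "Re a > 0" "Re b > 0" "Re c > 0" "a * b = c * \<i> \<or> a * b = - c * \<i>"
  shows "csqrt a * csqrt b = csqrt c * cis2 (if a * b = c * \<i> then 1/8 else -1/8)"
proof (rule square_eq_Re_pos)
  note gt = csqrt_Re_gt[OF assms(1)] csqrt_Re_gt[OF assms(2)] csqrt_Re_gt[OF assms(3)]
  have "\<bar>Im (csqrt a) * Im (csqrt b)\<bar> < Re (csqrt a) * Re (csqrt b)"
    unfolding abs_mult using gt by (intro mult_strict_mono') auto
  thus "Re (csqrt a * csqrt b) > 0"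
    by simp
  have m: "cis2 (-(1/8)) = 1 / cis2 (1/8)" and sq: "cis2 (1/8) ^ 2 = \<i>"
    using cis2_minus[of "1/8"] by (simp_all add: cis2_power)
  have "cis2 (-(1/8)) = cnj (cis2 (1/8))"
    by (simp add: cis2_def exp_cnj)
  hence m': "Re (cis2 (-(1/8))) = sqrt 2 / 2" "Im (cis2 (-(1/8))) = - (sqrt 2 / 2)"
    by (simp_all add: cis2_eighth)
  have "sqrt 2 * Im (csqrt c) < sqrt 2 * Re (csqrt c)" "sqrt 2 * - Im (csqrt c) < sqrt 2 * Re (csqrt c)"
    using gt(3) by (intro mult_strict_left_mono; auto)+
  thus "Re (csqrt c * cis2 (if a * b = c * \<i> then 1/8 else -1/8)) > 0"
    by (auto simp: cis2_eighth m' algebra_simps simp del: csqrt.simps)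
  show "(csqrt a * csqrt b)\<^sup>2 = (csqrt c * cis2 (if a * b = c * \<i> then 1/8 else -1/8))\<^sup>2"
    using assms(4) by (auto simp: power_mult_distrib sq m power_divide simp del: csqrt.simps)
qed

text \<open>With the factor -i the radicand has real part c Im \<tau>, so for c > 0 it lies in the
  right half plane and no branch cut is met.\<close>

definition eta_mult :: "int \<Rightarrow> int \<Rightarrow> int \<Rightarrow> int \<Rightarrow> complex \<Rightarrow> bool" where
  "eta_mult a b c d \<kappa> \<longleftrightarrow> (\<forall>\<tau>. Im \<tau> > 0 \<longrightarrow>
     dedekind_eta ((of_int a * \<tau> + of_int b) / (of_int c * \<tau> + of_int d)) =
       \<kappa> * csqrt (-\<i> * (of_int c * \<tau> + of_int d)) * dedekind_eta \<tau>)"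

lemma eta_mult_base: "eta_mult a (a * d - 1) 1 d (cis2 (of_int (a + d) / 24))"
  unfolding eta_mult_def
proof (intro allI impI)
  fix \<tau> :: complex assume \<tau>: "Im \<tau> > 0"
  define z where "z = \<tau> + of_int d"
  have z: "Im z > 0" "z \<noteq> 0"
    using \<tau> by (auto simp: z_def complex_eq_iff)
  have "(of_int a * \<tau> + of_int (a * d - 1)) / (of_int 1 * \<tau> + of_int d) = -1 / z + of_int a"
    using z(2) by (simp add: z_def field_simps)
  hence "dedekind_eta ((of_int a * \<tau> + of_int (a * d - 1)) / (of_int 1 * \<tau> + of_int d)) =
           cis2 (of_int a / 24) * (csqrt (-\<i> * z) * (cis2 (of_int d / 24) * dedekind_eta \<tau>))"
    using dedekind_eta_inversion[OF z(1)]
    by (simp only: dedekind_eta_plus_int) (simp add: z_def dedekind_eta_plus_int)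
  thus "dedekind_eta ((of_int a * \<tau> + of_int (a * d - 1)) / (of_int 1 * \<tau> + of_int d)) =
          cis2 (of_int (a + d) / 24) * csqrt (-\<i> * (of_int 1 * \<tau> + of_int d)) * dedekind_eta \<tau>"
    by (simp add: z_def cis2_add add_divide_distrib)
qed

lemma eta_mult_translate:
  assumes "eta_mult a b c d \<kappa>"
  shows "eta_mult a (b + k * a) c (d + k * c) (\<kappa> * cis2 (of_int k / 24))"
  unfolding eta_mult_def
proof (intro allI impI)
  fix \<tau> :: complex assume \<tau>: "Im \<tau> > 0"
  have eq: "of_int x * \<tau> + of_int (y + k * x) = of_int x * (\<tau> + of_int k) + of_int y" for x y
    by (simp add: algebra_simps)
  show "dedekind_eta ((of_int a * \<tau> + of_int (b + k * a)) / (of_int c * \<tau> + of_int (d + k * c))) =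
       \<kappa> * cis2 (of_int k / 24) * csqrt (-\<i> * (of_int c * \<tau> + of_int (d + k * c))) * dedekind_eta \<tau>"
    unfolding eq using assms \<tau> unfolding eta_mult_def
    by (subst spec[of _ "\<tau> + of_int k"]) (auto simp: dedekind_eta_plus_int)
qed

text \<open>Right multiplication by the matrix of \<tau> \<mapsto> -1/\<tau>, which replaces the
  lower row (c, d) by (d, -c). The two radicands multiply to \<open>\<i>\<close> times the desired
  one; this produces the eighth root of unity.\<close>

lemma eta_mult_invert:
  assumes "eta_mult b (-a) d (-c) \<kappa>" "c > 0" "d > 0"
  shows "eta_mult a b c d (\<kappa> * cis2 (1/8))"
  unfolding eta_mult_def
proof (intro allI impI)
  fix \<tau> :: complex assume \<tau>: "Im \<tau> > 0"
  hence nz: "\<tau> \<noteq> 0" by auto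
  have im: "Im (-1/\<tau>) > 0"
    by (rule Im_inversion_pos[OF \<tau>])
  have "(of_int a * \<tau> + of_int b) / (of_int c * \<tau> + of_int d) =
        (of_int b * (-1/\<tau>) + of_int (-a)) / (of_int d * (-1/\<tau>) + of_int (-c))"
  proof -
    have "of_int b * (-1/\<tau>) + of_int (-a) = (of_int a * \<tau> + of_int b) / (-\<tau>)"
         "of_int d * (-1/\<tau>) + of_int (-c) = (of_int c * \<tau> + of_int d) / (-\<tau>)"
      using nz by (simp_all add: field_simps)
    moreover have "(x / (-\<tau>)) / (y / (-\<tau>)) = x / y" for x y
      using nz by simp
    ultimately show ?thesis
      by (simp only:)
  qed
  also have "dedekind_eta \<dots> = \<kappa> * csqrt (-\<i> * (of_int d * (-1/\<tau>) + of_int (-c))) * dedekind_eta (-1/\<tau>)"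
    using assms(1) im unfolding eta_mult_def by blast
  also have "\<dots> = \<kappa> * (csqrt (-\<i> * (of_int d * (-1/\<tau>) + of_int (-c))) * csqrt (-\<i> * \<tau>)) * dedekind_eta \<tau>"
    unfolding dedekind_eta_inversion[OF \<tau>] by (simp only: mult_ac)
  also have "csqrt (-\<i> * (of_int d * (-1/\<tau>) + of_int (-c))) * csqrt (-\<i> * \<tau>) =
      csqrt (-\<i> * (of_int c * \<tau> + of_int d)) * cis2 (1/8)"
  proof -
    have e: "-\<i> * (of_int d * (-1/\<tau>) + of_int (-c)) * (-\<i> * \<tau>) = -\<i> * (of_int c * \<tau> + of_int d) * \<i>"
      using nz by (simp add: field_simps)
    have "Re (-\<i> * (of_int d * z + of_int (-c))) = of_int d * Im z" for z
      by simp
    hence "Re (-\<i> * (of_int d * (-1/\<tau>) + of_int (-c))) = of_int d * Im (-1/\<tau>)" .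
    also have "\<dots> > 0"
      using im assms(3) by (intro mult_pos_pos) auto
    finally show ?thesis
      using csqrt_mult_Re_pos[OF _ _ _ disjI1[OF e]] e \<tau> assms(2) by simp
  qed
  finally show "dedekind_eta ((of_int a * \<tau> + of_int b) / (of_int c * \<tau> + of_int d)) =
     \<kappa> * cis2 (1/8) * csqrt (-\<i> * (of_int c * \<tau> + of_int d)) * dedekind_eta \<tau>"
    by (simp only: mult_ac)
qed

text \<open>For negative \<open>d\<close> the smaller matrix is negated to keep its lower left entry
  positive. The radicands now multiply to \<open>- \<i>\<close> times the desired one.\<close>

lemma eta_mult_invert':
  assumes "eta_mult (-b) a (-d) c \<kappa>" "c > 0" "d < 0"
  shows "eta_mult a b c d (\<kappa> * cis2 (-1/8))"
  unfolding eta_mult_def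
proof (intro allI impI)
  fix \<tau> :: complex assume \<tau>: "Im \<tau> > 0"
  hence nz: "\<tau> \<noteq> 0" by auto
  have im: "Im (-1/\<tau>) > 0"
    by (rule Im_inversion_pos[OF \<tau>])
  have "(of_int a * \<tau> + of_int b) / (of_int c * \<tau> + of_int d) =
        (of_int (-b) * (-1/\<tau>) + of_int a) / (of_int (-d) * (-1/\<tau>) + of_int c)"
  proof -
    have "of_int (-b) * (-1/\<tau>) + of_int a = (of_int a * \<tau> + of_int b) / \<tau>"
         "of_int (-d) * (-1/\<tau>) + of_int c = (of_int c * \<tau> + of_int d) / \<tau>"
      using nz by (simp_all add: field_simps)
    moreover have "(x / \<tau>) / (y / \<tau>) = x / y" for x y
      using nz by simp
    ultimately show ?thesis
      by (simp only:)
  qed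
  also have "dedekind_eta \<dots> = \<kappa> * csqrt (-\<i> * (of_int (-d) * (-1/\<tau>) + of_int c)) * dedekind_eta (-1/\<tau>)"
    using assms(1) im unfolding eta_mult_def by blast
  also have "\<dots> = \<kappa> * (csqrt (-\<i> * (of_int (-d) * (-1/\<tau>) + of_int c)) * csqrt (-\<i> * \<tau>)) * dedekind_eta \<tau>"
    unfolding dedekind_eta_inversion[OF \<tau>] by (simp only: mult_ac)
  also have "csqrt (-\<i> * (of_int (-d) * (-1/\<tau>) + of_int c)) * csqrt (-\<i> * \<tau>) =
      csqrt (-\<i> * (of_int c * \<tau> + of_int d)) * cis2 (-1/8)"
  proof -
    have e: "-\<i> * (of_int (-d) * (-1/\<tau>) + of_int c) * (-\<i> * \<tau>) = - (-\<i> * (of_int c * \<tau> + of_int d)) * \<i>"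
      using nz by (simp add: field_simps)
    have pos: "Re (-\<i> * (of_int c * \<tau> + of_int d)) > 0"
      using \<tau> assms(2) by simp
    have "w * \<i> \<noteq> - w * \<i>" if "Re w > 0" for w
      using that by (auto simp: complex_eq_iff)
    hence ne: "-\<i> * (of_int (-d) * (-1/\<tau>) + of_int c) * (-\<i> * \<tau>) \<noteq> -\<i> * (of_int c * \<tau> + of_int d) * \<i>"
      unfolding e using pos by metis
    have "Re (-\<i> * (of_int (-d) * z + of_int c)) = of_int (-d) * Im z" for z
      by simp
    hence "Re (-\<i> * (of_int (-d) * (-1/\<tau>) + of_int c)) = of_int (-d) * Im (-1/\<tau>)" .
    also have "\<dots> > 0"
      using im assms(3) by (intro mult_pos_pos) auto
    finally show ?thesis
      using csqrt_mult_Re_pos[OF _ _ pos disjI2[OF e]] ne \<tau> by simp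
  qed
  finally show "dedekind_eta ((of_int a * \<tau> + of_int b) / (of_int c * \<tau> + of_int d)) =
     \<kappa> * cis2 (-1/8) * csqrt (-\<i> * (of_int c * \<tau> + of_int d)) * dedekind_eta \<tau>"
    by (simp only: mult_ac)
qed

text \<open>The part common to odd and even \<open>c\<close> of the exponent, in units of 1/24, in
  the classical multiplier formula. The remaining terms there are multiples of 3 and drop out of
  eighth powers.\<close>

definition eta_exponent :: "int \<Rightarrow> int \<Rightarrow> int \<Rightarrow> int \<Rightarrow> int" where
  "eta_exponent a b c d = (a + d) * c - b * d * (c\<^sup>2 - 1)"

text \<open>
  For odd \<open>c\<close> this is the classical formula for the multiplier of \<open>\<eta>\<close>, normalised by
  \<open>csqrt (-\<i> (c \<tau> + d))\<close> in place of \<open>csqrt (c \<tau> + d)\<close>. For even \<open>c\<close> the eighth power suffices.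
\<close>
definition eta_char :: "int \<Rightarrow> int \<Rightarrow> int \<Rightarrow> int \<Rightarrow> complex \<Rightarrow> bool" where
  "eta_char a b c d \<kappa> \<longleftrightarrow> eta_mult a b c d \<kappa> \<and> \<kappa> ^ 8 = cis2 (of_int (eta_exponent a b c d) / 3) \<and>
     (odd c \<longrightarrow> \<kappa> = of_int (jacobi d (nat c)) * cis2 (of_int (eta_exponent a b c d - 3 * c + 3) / 24))"

lemma coprime_if_det:
  fixes a b c d :: int
  assumes "a * d - b * c = 1"
  shows "coprime d c"
  using assms by (metis coprime_iff_gcd_eq_1 dvd_diff dvd_mult dvd_mult2 gcd_dvd1 gcd_dvd2 is_unit_gcd_iff)

lemma three_dvd: "3 dvd (c::int) * (c\<^sup>2 - 1)"
proof -
  have "3 dvd c \<or> 3 dvd c - 1 \<or> 3 dvd c + 1"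
    by presburger
  moreover have "c * (c\<^sup>2 - 1) = c * ((c - 1) * (c + 1))"
    by (simp add: power2_eq_square algebra_simps)
  ultimately show ?thesis
    by (auto simp del: mult_cancel_left)
qed

lemma twentyfour_dvd:
  assumes "odd (c::int)"
  shows "24 dvd c * (c\<^sup>2 - 1)"
proof -
  obtain k where k: "c = 2 * k + 1"
    using assms by (elim oddE)
  have "even (k * (k + 1))" by simp
  then obtain j where j: "k * (k + 1) = 2 * j" by (elim evenE)
  have "c * (c\<^sup>2 - 1) = 4 * (k * (k + 1)) * c"
    by (simp add: k power2_eq_square algebra_simps)
  also have "\<dots> = 8 * (j * c)"
    unfolding j by simp
  finally have "8 dvd c * (c\<^sup>2 - 1)"
    by (rule dvdI)
  moreover have "8 dvd x \<Longrightarrow> 3 dvd x \<Longrightarrow> 24 dvd x" for x :: int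
    by presburger
  ultimately show ?thesis
    using three_dvd by blast
qed

text \<open>Translation by \<open>k\<close> should add just \<open>k\<close>. The error is a
  multiple of \<open>c * (c\<^sup>2 - 1)\<close>, which vanishes modulo 3 for every \<open>c\<close>
  and modulo 24 for odd \<open>c\<close>: the two precisions recorded in
  \<open>eta_char\<close>.\<close>

lemma eta_exponent_translate:
  assumes "a * d - b * c = 1"
  shows "eta_exponent a (b + k * a) c (d + k * c) =
           eta_exponent a b c d + k - c * (c\<^sup>2 - 1) * (2 * k * b + k\<^sup>2 * a)"
proof -
  have ad: "a * d = 1 + b * c" using assms by simp
  have "eta_exponent a (b + k * a) c (d + k * c) = eta_exponent a b c d + k * c\<^sup>2
          - (c\<^sup>2 - 1) * (k * b * c + k * (a * d) + k\<^sup>2 * a * c)"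
    by (simp add: eta_exponent_def algebra_simps power2_eq_square)
  also have "\<dots> = eta_exponent a b c d + k - c * (c\<^sup>2 - 1) * (2 * k * b + k\<^sup>2 * a)"
    unfolding ad by (simp add: algebra_simps power2_eq_square)
  finally show ?thesis .
qed

lemma eta_char_translate:
  assumes "eta_char a b c d \<kappa>" "a * d - b * c = 1" "c > 0"
  shows "eta_char a (b + k * a) c (d + k * c) (\<kappa> * cis2 (of_int k / 24))"
proof -
  define E where "E = eta_exponent a b c d"
  define E' where "E' = eta_exponent a (b + k * a) c (d + k * c)"
  have E': "E' = E + k - c * (c\<^sup>2 - 1) * (2 * k * b + k\<^sup>2 * a)"
    unfolding E_def E'_def by (rule eta_exponent_translate[OF assms(2)])
  have "[E' = E + k] (mod 3)"
    unfolding E' cong_iff_dvd_diff using dvd_mult2[OF three_dvd[of c]] by simp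
  hence "cis2 (of_int E' / 3) = cis2 (of_int (E + k) / 3)"
    using cis2_cong[of E' "E + k" 3] by simp
  hence 1: "cis2 (of_int E' / 3) = (\<kappa> * cis2 (of_int k / 24)) ^ 8"
    using assms(1) by (simp add: eta_char_def E_def power_mult_distrib cis2_power add_divide_distrib cis2_add)
  have 2: "\<kappa> * cis2 (of_int k / 24) = of_int (jacobi (d + k * c) (nat c)) * cis2 (of_int (E' - 3 * c + 3) / 24)" if "odd c"
  proof -
    have "24 dvd - (c * (c\<^sup>2 - 1) * (2 * k * b + k\<^sup>2 * a))"
      using dvd_mult2[OF twentyfour_dvd[OF that]] by simp
    also have "- (c * (c\<^sup>2 - 1) * (2 * k * b + k\<^sup>2 * a)) = E' - 3 * c + 3 - ((E - 3 * c + 3) + k)"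
      unfolding E' by simp
    finally have "[E' - 3 * c + 3 = (E - 3 * c + 3) + k] (mod 24)"
      unfolding cong_iff_dvd_diff .
    hence "cis2 (of_int (E' - 3 * c + 3) / of_int 24) = cis2 (of_int ((E - 3 * c + 3) + k) / of_int 24)"
      by (intro cis2_cong) auto
    also have "\<dots> = cis2 (of_int (E - 3 * c + 3) / 24) * cis2 (of_int k / 24)"
      by (simp add: cis2_add [symmetric] add_divide_distrib)
    finally have "cis2 (of_int (E' - 3 * c + 3) / 24) = cis2 (of_int (E - 3 * c + 3) / 24) * cis2 (of_int k / 24)"
      by simp
    moreover have "jacobi (d + k * c) (nat c) = jacobi d (nat c)"
      using assms(3) by (intro jacobi_cong) (simp add: cong_iff_dvd_diff)
    ultimately show ?thesis
      using assms(1) that by (simp add: eta_char_def E_def)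
  qed
  show ?thesis
    using eta_mult_translate assms(1) 1 2 by (simp add: eta_char_def E'_def)
qed

text \<open>The exponents differ by 3cd because the determinant is 1. For odd \<open>c\<close> and
  \<open>d\<close>, passing from the symbol of \<open>-c\<close> modulo \<open>d\<close> to that of
  \<open>d\<close> modulo \<open>c\<close> is reciprocity, whose sign has to match the
  phase.\<close>

lemma eta_char_invert:
  assumes "eta_char b (-a) d (-c) \<kappa>" "a * d - b * c = 1" "c > 0" "d > 0" "odd c \<Longrightarrow> odd d"
  shows "eta_char a b c d (\<kappa> * cis2 (1/8))"
proof -
  define E where "E = eta_exponent a b c d"
  define E' where "E' = eta_exponent b (-a) d (-c)"
  have "E = E' + 2 * c * d + c * d * (a * d - b * c)"
    unfolding E_def E'_def eta_exponent_def by (simp add: algebra_simps power2_eq_square)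
  hence E: "E = E' + 3 * c * d"
    using assms(2) by simp
  have "cis2 (of_int E / of_int 3) = cis2 (of_int E' / of_int 3)"
    unfolding E by (intro cis2_cong) (auto simp: cong_iff_dvd_diff)
  hence 1: "cis2 (of_int E / 3) = (\<kappa> * cis2 (1/8)) ^ 8"
    using assms(1) by (simp add: eta_char_def E'_def power_mult_distrib cis2_power)
  have 2: "\<kappa> * cis2 (1/8) = of_int (jacobi d (nat c)) * cis2 (of_int (E - 3 * c + 3) / 24)" if "odd c"
  proof -
    define c' d' where "c' = nat c" and "d' = nat d"
    have cd: "c = int c'" "d = int d'" "odd c'" "odd d'"
      using assms(3-5) that by (auto simp: c'_def d'_def even_nat_iff)
    have cop: "coprime c' d'"
      using coprime_if_det[OF assms(2)] unfolding cd by (simp add: coprime_commute)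
    obtain x y where xy: "c' = 2 * x + 1" "d' = 2 * y + 1"
      using cd by (metis oddE)
    \<comment> \<open>From 3cd - 3c + 3d - 3 = 3(c + 1)(d - 1) = 12 z; a phase of z/2 is a sign, the
      same one as in reciprocity together with the symbol of -1.\<close>
    define z where "z = int (x + 1) * int y"
    define s :: int where "s = (if even z then 1 else -1)"
    have "E - 3 * c + 3 = (E' - 3 * d + 3) + 3 + 12 * z"
      unfolding E cd xy z_def by (simp add: algebra_simps)
    hence "of_int (E - 3 * c + 3) / 24 = of_int (E' - 3 * d + 3) / 24 + 1 / 8 + (of_int z / 2 :: complex)"
      by (simp only: of_int_add of_int_mult) simp
    hence e: "cis2 (of_int (E - 3 * c + 3) / 24) = cis2 (of_int (E' - 3 * d + 3) / 24) * cis2 (1/8) * of_int s"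
      by (simp only: cis2_add cis2_half_int) (simp add: s_def)
    have "jacobi (-1) d' * jacobi (int c') d' = jacobi (int d') c' * s"
    proof -
      have "jacobi (int c') d' * jacobi (int d') c' = (if c' mod 4 = 3 \<and> d' mod 4 = 3 then -1 else 1)"
        by (intro jacobi_reciprocity cd cop)
      moreover have "c' mod 4 = 3 \<longleftrightarrow> odd x" "d' mod 4 = 3 \<longleftrightarrow> odd y"
        unfolding xy by presburger+
      ultimately show ?thesis
        using jacobi_range[of "int c'" d'] jacobi_range[of "int d'" c'] jacobi_minus_1[OF cd(4)]
        by (auto simp: s_def z_def)
    qed
    hence j: "jacobi (-c) (nat d) = jacobi d (nat c) * s"
      using jacobi_mult_left[OF cd(4), of "-1" "int c'"] by (simp add: cd)
    have "\<kappa> = of_int (jacobi (-c) (nat d)) * cis2 (of_int (E' - 3 * d + 3) / 24)"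
      using assms(1) cd by (simp add: eta_char_def E'_def)
    thus ?thesis
      unfolding e j by (simp add: s_def)
  qed
  show ?thesis
    using eta_mult_invert[OF _ assms(3,4)] assms(1) 1 2 by (simp add: eta_char_def E_def)
qed

lemma eta_char_invert':
  assumes "eta_char (-b) a (-d) c \<kappa>" "a * d - b * c = 1" "c > 0" "d < 0" "odd c" "odd d"
  shows "eta_char a b c d (\<kappa> * cis2 (-1/8))"
proof -
  define E where "E = eta_exponent a b c d"
  define E' where "E' = eta_exponent (-b) a (-d) c"
  have "E = E' + 2 * c * d + c * d * (a * d - b * c)"
    unfolding E_def E'_def eta_exponent_def by (simp add: algebra_simps power2_eq_square)
  hence E: "E = E' + 3 * c * d"
    using assms(2) by simp
  have "cis2 (of_int E / of_int 3) = cis2 (of_int E' / of_int 3)"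
    unfolding E by (intro cis2_cong) (auto simp: cong_iff_dvd_diff)
  moreover have "cis2 (-1/8) ^ 8 = 1"
    using cis2_of_int[of "-1"] by (simp add: cis2_power)
  ultimately have 1: "cis2 (of_int E / 3) = (\<kappa> * cis2 (-1/8)) ^ 8"
    using assms(1) unfolding power_mult_distrib by (simp add: eta_char_def E'_def)
  define c' e where "c' = nat c" and "e = nat (-d)"
  have cd: "c = int c'" "d = - int e" "odd c'" "odd e"
    using assms(3-6) by (auto simp: c'_def e_def even_nat_iff)
  have cop: "coprime c' e"
    using coprime_if_det[OF assms(2)] unfolding cd by (simp add: coprime_commute)
  obtain x y where xy: "c' = 2 * x + 1" "e = 2 * y + 1"
    using cd by (metis oddE)
  \<comment> \<open>Here 3cd - 3c - 3d + 3 = 3(c - 1)(d - 1) = -12 z, since d = -(2y + 1).\<close>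
  define z where "z = int x * int (y + 1)"
  define s :: int where "s = (if even z then 1 else -1)"
  define w where "w = E' - 3 * (-d) + 3"
  have "E - 3 * c + 3 = w + (-3) + 12 * (- z)"
    unfolding E cd xy z_def w_def by (simp add: algebra_simps)
  hence "of_int (E - 3 * c + 3) / 24 = of_int w / 24 + (-1 / 8) + (of_int (-z) / 2 :: complex)"
    by (simp only: of_int_add of_int_mult) simp
  hence eq: "cis2 (of_int (E - 3 * c + 3) / 24) = cis2 (of_int w / 24) * cis2 (-1/8) * of_int s"
    by (simp only: cis2_add cis2_half_int) (simp add: s_def)
  have "jacobi (int c') e = jacobi (-1) c' * jacobi (int e) c' * s"
  proof -
    have "jacobi (int c') e * jacobi (int e) c' = (if c' mod 4 = 3 \<and> e mod 4 = 3 then -1 else 1)"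
      by (intro jacobi_reciprocity cd cop)
    moreover have "c' mod 4 = 3 \<longleftrightarrow> odd x" "e mod 4 = 3 \<longleftrightarrow> odd y"
      unfolding xy by presburger+
    ultimately show ?thesis
      using jacobi_range[of "int c'" e] jacobi_range[of "int e" c'] jacobi_minus_1[OF cd(3)]
      by (auto simp: s_def z_def)
  qed
  hence j: "jacobi c (nat (-d)) = jacobi d (nat c) * s"
    using jacobi_mult_left[OF cd(3), of "-1" "int e"] by (simp add: cd)
  have "\<kappa> = of_int (jacobi c (nat (-d))) * cis2 (of_int w / 24)"
    using assms(1) cd by (simp add: eta_char_def E'_def w_def)
  hence 2: "\<kappa> * cis2 (-1/8) = of_int (jacobi d (nat c)) * cis2 (of_int (E - 3 * c + 3) / 24)"
    unfolding eq j by (simp add: s_def)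
  show ?thesis
    using eta_mult_invert'[OF _ assms(3,4), of b a \<kappa>] assms(1) 1[symmetric] 2
    unfolding eta_char_def E_def by blast
qed

text \<open>Euclid's algorithm on the lower row: translations reduce \<open>d\<close> modulo
  \<open>c\<close>, and inversion makes the residue the new, smaller lower left entry.\<close>

theorem eta_char_exists:
  assumes "a * d - b * c = 1" "c > 0"
  shows "\<exists>\<kappa>. eta_char a b c d \<kappa>"
  using assms
proof (induction "nat c" arbitrary: a b c d rule: less_induct)
  case less
  have cop: "coprime c d"
    using coprime_if_det[OF less.prems(1)] by (simp add: coprime_commute)
  have IH: "\<exists>\<kappa>. eta_char a' b' c' d' \<kappa>" if "a' * d' - b' * c' = 1" "0 < c'" "c' < c" for a' b' c' d'
    using less.hyps[of c' a' d' b'] that by simp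
  have red: "\<exists>\<kappa>. eta_char a b c d \<kappa>" if "\<exists>\<kappa>. eta_char a (b + k * a) c (d + k * c) \<kappa>" for k
  proof -
    obtain \<kappa> where \<kappa>: "eta_char a (b + k * a) c (d + k * c) \<kappa>"
      using \<open>\<exists>\<kappa>. _\<close> by blast
    have "a * (d + k * c) - (b + k * a) * c = 1"
      using less.prems by (simp add: algebra_simps)
    from eta_char_translate[OF \<kappa> this less.prems(2), of "-k"] show ?thesis
      by auto
  qed
  have det: "a * (d + k * c) - (b + k * a) * c = 1" for k
    using less.prems by (simp add: algebra_simps)
  show ?case
  proof (cases "c = 1")
    case True
    have "b = a * d - 1"
      using less.prems True by simp
    moreover have "eta_exponent a (a * d - 1) 1 d = a + d"
      by (simp add: eta_exponent_def)
    ultimately have "eta_char a b c d (cis2 (of_int (a + d) / 24))"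
      using eta_mult_base[of a d] True cis2_power[of "of_int (a + d) / 24" 8]
      by (simp add: eta_char_def add_divide_distrib)
    thus ?thesis by blast
  next
    case False
    hence c: "c > 1" using less.prems by simp
    define m where "m = d mod c"
    have m: "0 < m" "m < c" "m = d + (- (d div c)) * c"
    proof -
      show "m = d + (- (d div c)) * c"
        by (simp add: m_def minus_div_mult_eq_mod [symmetric])
      have "m \<noteq> 0"
        using cop c by (auto simp: m_def mod_eq_0_iff_dvd)
      thus "0 < m" "m < c"
        using c pos_mod_sign[of c d] pos_mod_bound[of c d] unfolding m_def by linarith+
    qed
    \<comment> \<open>If \<open>c\<close> is odd, the next lower left entry has to be odd as well,
      or the Jacobi symbol is lost. One of the residues m and m - c is odd; the second is negative
      and calls for \<open>eta_char_invert'\<close>.\<close>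
    show ?thesis
    proof (cases "odd c \<longrightarrow> odd m")
      case True
      let ?k = "- (d div c)"
      obtain \<kappa> where "eta_char (b + ?k * a) (-a) (d + ?k * c) (-c) \<kappa>"
        using IH[of "b + ?k * a" "-c" "-a" "d + ?k * c"] m det[of ?k] by (auto simp: algebra_simps)
      hence "eta_char a (b + ?k * a) c (d + ?k * c) (\<kappa> * cis2 (1/8))"
        by (rule eta_char_invert) (use m det[of ?k] True c in auto)
      thus ?thesis by (intro red[of ?k]) blast
    next
      case False
      let ?k = "- (d div c) - 1"
      have e: "d + ?k * c = m - c"
        using m(3) by (simp add: algebra_simps)
      have 1: "d + ?k * c < 0" "- (d + ?k * c) < c" "odd (d + ?k * c)"
        unfolding e using m False by auto
      obtain \<kappa> where "eta_char (-(b + ?k * a)) a (-(d + ?k * c)) c \<kappa>"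
        using IH[of "-(b + ?k * a)" c a "-(d + ?k * c)"] 1 det[of ?k] by (auto simp: algebra_simps)
      hence "eta_char a (b + ?k * a) c (d + ?k * c) (\<kappa> * cis2 (-1/8))"
        by (rule eta_char_invert') (use 1 det[of ?k] False c in auto)
      thus ?thesis by (intro red[of ?k]) blast
    qed
  qed
qed

section \<open>Gauss sums\<close>

text \<open>Gaussian binomial coefficients, introduced by the q-Pascal rule because the usual
  quotient of products may become 0/0 at the roots of unity where they are evaluated.\<close>

fun qbinom :: "complex \<Rightarrow> nat \<Rightarrow> nat \<Rightarrow> complex" where
  "qbinom q n 0 = 1"
| "qbinom q 0 (Suc j) = 0"
| "qbinom q (Suc n) (Suc j) = qbinom q n j + q ^ Suc j * qbinom q n (Suc j)"

lemma qbinom_eq_0: "n < j \<Longrightarrow> qbinom q n j = 0"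
  by (induction q n j rule: qbinom.induct) auto

text \<open>The q-analogue of the absorption identity for binomial coefficients, in a form without
  division.\<close>

lemma qbinom_absorb: "(1 - q ^ Suc j) * qbinom q (Suc n) (Suc j) = (1 - q ^ Suc n) * qbinom q n j"
proof (induction n arbitrary: j)
  case 0
  show ?case by (cases j) auto
next
  case (Suc n)
  show ?case
  proof (cases j)
    case 0
    define Y where "Y = qbinom q (Suc n) 1"
    have "(1 - q) * Y = 1 - q * q ^ n"
      using Suc.IH[of 0] by (simp add: Y_def)
    have "(1 - q) * qbinom q (Suc (Suc n)) 1 = (1 - q) + q * ((1 - q) * Y)"
      by (simp add: Y_def algebra_simps)
    also have "\<dots> = 1 - q * (q * q ^ n)"
      unfolding \<open>(1 - q) * Y = 1 - q * q ^ n\<close> by (simp add: algebra_simps)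
    finally show ?thesis by (simp add: 0)
  next
    case j: (Suc i)
    define X Y U V where "X = qbinom q (Suc n) j" and "Y = qbinom q (Suc n) (Suc j)"
      and "U = qbinom q n i" and "V = qbinom q n j"
    have 1: "(1 - q ^ j) * X = (1 - q ^ Suc n) * U"
      using Suc.IH[of i] by (simp only: j X_def U_def)
    have 2: "(1 - q ^ Suc j) * Y = (1 - q ^ Suc n) * V"
      using Suc.IH[of j] by (simp only: Y_def V_def)
    have 3: "X = U + q ^ j * V"
      by (simp add: X_def U_def V_def j)
    have "(1 - q ^ Suc j) * (X + q ^ Suc j * Y) = (1 - q ^ Suc j) * X + q ^ Suc j * ((1 - q ^ Suc j) * Y)"
      by (simp only: distrib_left mult_ac)
    also have "\<dots> = (1 - q ^ Suc j) * X + q * ((1 - q ^ Suc n) * (q ^ j * V))"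
      unfolding 2 by (simp only: power_Suc mult_ac)
    also have "q ^ j * V = X - U"
      using 3 by simp
    also have "(1 - q ^ Suc n) * (X - U) = (1 - q ^ Suc n) * X - (1 - q ^ j) * X"
      unfolding 1 by (rule right_diff_distrib)
    also have "(1 - q ^ Suc j) * X + q * ((1 - q ^ Suc n) * X - (1 - q ^ j) * X) = (1 - q ^ Suc (Suc n)) * X"
      by (simp add: algebra_simps)
    finally have "(1 - q ^ Suc j) * (X + q ^ Suc j * Y) = (1 - q ^ Suc (Suc n)) * X" .
    thus ?thesis
      by (simp add: X_def Y_def)
  qed
qed

definition gauss_alt :: "complex \<Rightarrow> nat \<Rightarrow> complex" where
  "gauss_alt q m = (\<Sum>j\<le>m. (-1) ^ j * qbinom q m j)"

text \<open>Gauss's recursion. After one use of the Pascal rule the alternating sums of row m + 1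
  cancel except for factors \<open>1 - q ^ Suc j\<close>, and absorption moves these down to row
  m.\<close>

lemma gauss_alt_rec: "gauss_alt q (Suc (Suc m)) = (1 - q ^ Suc m) * gauss_alt q m"
proof -
  have "gauss_alt q (Suc (Suc m)) =
      1 + (\<Sum>j\<le>Suc m. (-1) ^ Suc j * (qbinom q (Suc m) j + q ^ Suc j * qbinom q (Suc m) (Suc j)))"
    unfolding gauss_alt_def sum.atMost_Suc_shift[of _ "Suc m"] by simp
  also have "\<dots> = 1 - (\<Sum>j\<le>Suc m. (-1) ^ j * qbinom q (Suc m) j) +
      (\<Sum>j\<le>Suc m. (-1) ^ Suc j * q ^ Suc j * qbinom q (Suc m) (Suc j))"
    by (simp only: distrib_left sum.distrib power_Suc mult_minus_left mult_1_left sum_negf) (simp add: mult_ac)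
  also have "(\<Sum>j\<le>Suc m. (-1) ^ j * qbinom q (Suc m) j) =
      1 + (\<Sum>j\<le>m. (-1) ^ Suc j * qbinom q (Suc m) (Suc j))"
    by (subst sum.atMost_Suc_shift) (simp only: power_0 qbinom.simps(1) mult_1_left)
  also have "(\<Sum>j\<le>Suc m. (-1) ^ Suc j * q ^ Suc j * qbinom q (Suc m) (Suc j)) =
      (\<Sum>j\<le>m. (-1) ^ Suc j * q ^ Suc j * qbinom q (Suc m) (Suc j))"
    by (subst sum.atMost_Suc) (simp only: qbinom_eq_0[of "Suc m" "Suc (Suc m)"] lessI mult_zero_right add_0_right)
  finally have "gauss_alt q (Suc (Suc m)) = 
      (\<Sum>j\<le>m. (-1) ^ Suc j * q ^ Suc j * qbinom q (Suc m) (Suc j)) - (\<Sum>j\<le>m. (-1) ^ Suc j * qbinom q (Suc m) (Suc j))"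
    by (simp only:)  simp
  also have "\<dots> = (\<Sum>j\<le>m. (-1) ^ j * ((1 - q ^ Suc j) * qbinom q (Suc m) (Suc j)))"
    unfolding sum_subtractf[symmetric] by (intro sum.cong refl) (simp only: power_Suc, simp add: algebra_simps)
  also have "\<dots> = (1 - q ^ Suc m) * gauss_alt q m"
    unfolding qbinom_absorb gauss_alt_def sum_distrib_left by (simp only: mult_ac)
  finally show ?thesis .
qed

lemma gauss_alt_even: "gauss_alt q (2 * m) = (\<Prod>i<m. 1 - q ^ (2 * i + 1))"
proof (induction m)
  case (Suc m)
  have "gauss_alt q (2 * Suc m) = (1 - q ^ Suc (2 * m)) * gauss_alt q (2 * m)"
    using gauss_alt_rec[of q "2 * m"] by simp
  thus ?case by (simp add: Suc.IH)
qed (simp add: gauss_alt_def)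

text \<open>By absorption the interior entries of row n + 1 vanish at such a root of unity. The
  Pascal rule then relates neighbouring entries of row n by a two-term recursion.\<close>

lemma qbinom_root_of_unity:
  assumes "q ^ Suc n = 1" "\<And>i. 0 < i \<Longrightarrow> i \<le> n \<Longrightarrow> q ^ i \<noteq> 1"
  shows "j \<le> n \<Longrightarrow> qbinom q n j * q ^ (\<Sum>i\<le>j. i) = (-1) ^ j"
proof (induction j)
  case (Suc j)
  have "(1 - q ^ Suc j) * qbinom q (Suc n) (Suc j) = 0"
    unfolding qbinom_absorb assms(1) by simp
  moreover have "q ^ Suc j \<noteq> 1"
    using Suc.prems by (intro assms(2)) auto
  ultimately have "qbinom q (Suc n) (Suc j) = 0"
    by (simp only: mult_eq_0_iff) simp
  hence "q ^ Suc j * qbinom q n (Suc j) = - qbinom q n j"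
    by (simp add: eq_neg_iff_add_eq_0 add.commute)
  moreover have "qbinom q n (Suc j) * q ^ (\<Sum>i\<le>Suc j. i) = (q ^ Suc j * qbinom q n (Suc j)) * q ^ (\<Sum>i\<le>j. i)"
    by (simp add: power_add mult_ac)
  ultimately show ?case
    using Suc by simp
qed simp

section \<open>The quadratic Gauss sum and its sign\<close>

abbreviation addchar :: "nat \<Rightarrow> int \<Rightarrow> complex" where
  "addchar n x \<equiv> cis2 (of_int x / of_nat n)"

definition gauss_sum :: "nat \<Rightarrow> complex" where
  "gauss_sum n = (\<Sum>k<n. cis2 (of_nat (k ^ 2) / of_nat n))"

definition gauss_eps :: "nat \<Rightarrow> complex" where
  "gauss_eps n = (if n mod 4 = 3 then \<i> else 1)"

lemma cis2_root_of_unity: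
  assumes "n > 0"
  shows "addchar n a = 1 \<longleftrightarrow> int n dvd a"
proof -
  have "(of_int a / of_nat n = (of_int k :: complex)) \<longleftrightarrow> a = int n * k" for k
  proof -
    have "(of_int a / of_nat n = (of_int k :: complex)) \<longleftrightarrow> (of_int a :: complex) = of_int (int n * k)"
      using assms by (simp add: field_simps)
    thus ?thesis by (simp only: of_int_eq_iff)
  qed
  thus ?thesis
    unfolding cis2_eq_1_iff by (auto simp: dvd_def)
qed

lemma cis2_cong_nat:
  assumes "[a = b] (mod int m)" "m > 0"
  shows "addchar m a = addchar m b"
  using cis2_cong[OF assms(1)] assms(2) by simp

lemma sum_cis2_roots:
  assumes "n > 0"
  shows "(\<Sum>k<n. cis2 (of_int a * of_nat k / of_nat n)) = (if int n dvd a then of_nat n else 0)"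
proof -
  define z where "z = addchar n a"
  have z: "cis2 (of_int a * of_nat k / of_nat n) = z ^ k" for k
    by (simp add: z_def cis2_power mult_ac)
  have "z ^ n = 1"
    using assms by (simp add: z_def cis2_power)
  moreover have "z = 1 \<longleftrightarrow> int n dvd a"
    unfolding z_def by (rule cis2_root_of_unity[OF assms])
  ultimately show ?thesis
    unfolding z using geometric_sum[of z n] by (cases "z = 1") auto
qed

lemma sum_periodic_affine:
  fixes F :: "int \<Rightarrow> 'a :: comm_monoid_add"
  assumes "n > 0" "coprime c (int n)" and per: "\<And>x y. [x = y] (mod int n) \<Longrightarrow> F x = F y"
  shows "(\<Sum>k<n. F (c * int k + a)) = (\<Sum>k<n. F (int k))"
proof -
  define g where "g = (\<lambda>k. nat ((c * int k + a) mod int n))"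
  have g: "int (g k) = (c * int k + a) mod int n" for k
    using assms(1) by (simp add: g_def)
  have "inj_on g {..<n}"
  proof (rule inj_onI)
    fix x y assume xy: "x \<in> {..<n}" "y \<in> {..<n}" "g x = g y"
    hence "[c * int x + a = c * int y + a] (mod int n)"
      using g[of x] g[of y] by (simp add: cong_def)
    hence "[int x = int y] (mod int n)"
      using assms(2) by (simp add: cong_add_rcancel cong_mult_lcancel)
    thus "x = y"
      using xy by (simp add: cong_int_iff cong_def)
  qed
  moreover have "g ` {..<n} \<subseteq> {..<n}"
    using assms(1) by (auto simp: g_def nat_less_iff)
  ultimately have "bij_betw g {..<n} {..<n}"
    by (simp add: bij_betw_def endo_inj_surj)
  hence "(\<Sum>k<n. F (int (g k))) = (\<Sum>k<n. F (int k))"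
    by (rule sum.reindex_bij_betw)
  moreover have "F (int (g k)) = F (c * int k + a)" for k
    by (rule per) (simp add: g cong_def)
  ultimately show ?thesis by simp
qed

lemma norm_gauss_sum:
  assumes "odd n"
  shows "norm (gauss_sum n) = sqrt (real n)"
proof -
  have n: "n > 0" using assms odd_pos by simp
  define e where "e = (\<lambda>a. addchar n a)"
  have e_add: "e (a + b) = e a * e b" for a b
    by (simp add: e_def add_divide_distrib cis2_add)
  have e_cong: "e a = e b" if "[a = b] (mod int n)" for a b
    unfolding e_def by (rule cis2_cong_nat[OF that n])
  have e_cnj: "cnj (e a) = e (-a)" for a
    by (simp add: e_def cis2_def exp_cnj)
  have G: "gauss_sum n = (\<Sum>k<n. e ((int k)\<^sup>2))"
    by (simp add: gauss_sum_def e_def)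
  have "gauss_sum n * cnj (gauss_sum n) = (\<Sum>y<n. (\<Sum>x<n. e ((int x)\<^sup>2 - (int y)\<^sup>2)))"
    unfolding G cnj_sum sum_product by (subst sum.swap) (simp add: e_cnj e_add [symmetric])
  \<comment> \<open>Replacing x by x + y leaves the exponent x * x + 2xy, which is linear in y;
    summing over y isolates x = 0.\<close>
  also have "\<dots> = (\<Sum>y<n. (\<Sum>x<n. e ((1 * int x + int y)\<^sup>2 - (int y)\<^sup>2)))"
    by (intro sum.cong refl sum_periodic_affine[symmetric] e_cong cong_diff cong_pow n) auto
  also have "\<dots> = (\<Sum>x<n. e ((int x)\<^sup>2) * (\<Sum>y<n. cis2 (of_int (2 * int x) * of_nat y / of_nat n)))"
    unfolding sum_distrib_left
    by (subst sum.swap) (simp add: e_add [symmetric] e_def cis2_add [symmetric] add_divide_distrib [symmetric] power2_eq_square algebra_simps)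
  also have "\<dots> = (\<Sum>x<n. if x = 0 then of_nat n else 0)"
  proof (intro sum.cong refl)
    fix x assume x: "x \<in> {..<n}"
    have "int n dvd 2 * int x \<longleftrightarrow> int n dvd int x"
      using assms by (intro coprime_dvd_mult_right_iff) (simp add: coprime_commute)
    also have "\<dots> \<longleftrightarrow> x = 0"
      using x by (auto dest: dvd_imp_le)
    finally show "e ((int x)\<^sup>2) * (\<Sum>y<n. cis2 (of_int (2 * int x) * of_nat y / of_nat n)) = (if x = 0 then of_nat n else 0)"
      unfolding sum_cis2_roots[OF n] by (simp add: e_def)
  qed
  also have "\<dots> = of_nat n"
    using n by simp
  finally have "complex_of_real ((norm (gauss_sum n))\<^sup>2) = of_real (real n)"
    by (simp only: complex_norm_square of_real_of_nat_eq)
  hence "(norm (gauss_sum n))\<^sup>2 = real n"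
    by (simp only: of_real_eq_iff)
  thus ?thesis
    by (metis norm_ge_zero real_sqrt_unique)
qed

text \<open>
  Gauss's determination of the sign: at the root of unity \<open>q = cis2 (-2/n)\<close> the terms
  \<open>(-1) ^ j * qbinom q (n - 1) j\<close> are those of the Gauss sum, up to completing the square.
\<close>
lemma gauss_sum_eq_prod:
  assumes "n = 2 * m + 1"
  shows "gauss_sum n = (2 * \<i>) ^ m * of_real (\<Prod>i<m. sin (2 * pi * real (2 * i + 1) / real n))"
proof -
  define e where "e = (\<lambda>a. addchar n a)"
  have n: "n > 0" "odd n" using assms by auto
  have e_add: "e (a + b) = e a * e b" for a b
    by (simp add: e_def add_divide_distrib cis2_add)
  have e_pow: "e a ^ k = e (a * int k)" for a k
    by (simp add: e_def cis2_power mult_ac)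
  have e_cong: "e a = e b" if "[a = b] (mod int n)" for a b
    unfolding e_def by (rule cis2_cong_nat[OF that n(1)])
  define q where "q = e (-2)"
  have q1: "q ^ Suc (2 * m) = 1"
  proof -
    have "q ^ Suc (2 * m) = e (- 2 * int n)"
      unfolding q_def e_pow assms by simp
    also have "\<dots> = e 0"
      by (rule e_cong) (simp add: cong_iff_dvd_diff)
    finally show ?thesis by (simp add: e_def)
  qed
  have q2: "q ^ i \<noteq> 1" if "0 < i" "i \<le> 2 * m" for i
  proof
    assume "q ^ i = 1"
    hence "e (- 2 * int i) = 1"
      by (simp only: q_def e_pow)
    hence "addchar n (- 2 * int i) = 1"
      by (simp only: e_def)
    hence "int n dvd - 2 * int i"
      by (subst (asm) cis2_root_of_unity[OF n(1)])
    hence "int n dvd 2 * int i" by simp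
    hence "int n dvd int i"
      using n(2) by (subst (asm) coprime_dvd_mult_right_iff) (simp_all add: coprime_commute)
    hence "n dvd i" by (simp only: int_dvd_int_iff)
    thus False using that assms by (auto dest: dvd_imp_le)
  qed
  have tri: "2 * (\<Sum>i\<le>j. i) = j * (j + 1)" for j :: nat
    by (induction j) auto
  have qb: "(-1) ^ j * qbinom q (2 * m) j = e (int j * (int j + 1))" if "j \<le> 2 * m" for j
  proof -
    have "q ^ (\<Sum>i\<le>j. i) = e (- (2 * int (\<Sum>i\<le>j. i)))"
      by (simp add: q_def e_pow)
    also have "2 * int (\<Sum>i\<le>j. i) = int j * (int j + 1)"
      using tri[of j] by (metis of_nat_1 of_nat_add of_nat_mult of_nat_numeral)
    finally have "q ^ (\<Sum>i\<le>j. i) * e (int j * (int j + 1)) = 1"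
      by (simp add: e_add [symmetric]) (simp add: e_def)
    moreover have "qbinom q (2 * m) j * q ^ (\<Sum>i\<le>j. i) = (-1) ^ j"
      using qbinom_root_of_unity[OF q1 q2 that] .
    moreover have "(-1) ^ j * (-1) ^ j = (1 :: complex)"
      by (simp add: power_add [symmetric])
    ultimately show ?thesis
      by (metis (no_types, lifting) mult.assoc mult.commute mult_1)
  qed
  \<comment> \<open>An inverse of 2 modulo \<open>n\<close>: since 2h is 1 modulo n, k(k + 1) is (k
    + h) squared minus h squared.\<close>
  define h where "h = int m + 1"
  have hh: "int n = 2 * h - 1"
    by (simp add: h_def assms)
  have "gauss_sum n = (\<Sum>k<n. e ((int k)\<^sup>2))"
    by (simp add: gauss_sum_def e_def)
  also have "\<dots> = (\<Sum>k<n. e ((1 * int k + h)\<^sup>2))"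
    by (intro sum_periodic_affine[symmetric] e_cong cong_pow n) auto
  also have "\<dots> = (\<Sum>k<n. e (h\<^sup>2) * e (int k * (int k + 1)))"
  proof (intro sum.cong refl)
    fix k
    have "(1 * int k + h)\<^sup>2 - (h\<^sup>2 + int k * (int k + 1)) = int n * int k"
      unfolding hh by (simp add: power2_eq_square algebra_simps)
    hence "[(1 * int k + h)\<^sup>2 = h\<^sup>2 + int k * (int k + 1)] (mod int n)"
      by (simp add: cong_iff_dvd_diff)
    thus "e ((1 * int k + h)\<^sup>2) = e (h\<^sup>2) * e (int k * (int k + 1))"
      by (simp add: e_cong e_add [symmetric])
  qed
  also have "\<dots> = e (h\<^sup>2) * gauss_alt q (2 * m)"
  proof -
    have "{..<n} = {..2 * m}" using assms by auto
    thus ?thesis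
      by (simp add: gauss_alt_def qb sum_distrib_left)
  qed
  also have "gauss_alt q (2 * m) = (\<Prod>i<m. e (- int (2 * i + 1)) * (2 * \<i> * of_real (sin (2 * pi * real (2 * i + 1) / real n))))"
    unfolding gauss_alt_even
  proof (intro prod.cong refl)
    fix i
    define t where "t = 2 * pi * real (2 * i + 1) / real n"
    have 1: "e (- int (2 * i + 1)) = exp (- (\<i> * of_real t))"
    proof -
      have "addchar n (- int k) = exp (- (\<i> * of_real (2 * pi * real k / real n)))" for k
        by (simp add: cis2_def mult_ac)
      thus ?thesis
        unfolding e_def t_def .
    qed
    have "- 2 * int (2 * i + 1) = - int (2 * i + 1) + - int (2 * i + 1)"
      by simp
    hence "q ^ (2 * i + 1) = e (- int (2 * i + 1) + - int (2 * i + 1))"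
      by (simp only: q_def e_pow)
    also have "\<dots> = e (- int (2 * i + 1)) * e (- int (2 * i + 1))"
      by (rule e_add)
    finally have "1 - q ^ (2 * i + 1) = exp (- (\<i> * of_real t)) * (exp (\<i> * of_real t) - exp (- (\<i> * of_real t)))"
      unfolding 1 by (simp add: right_diff_distrib exp_add [symmetric])
    also have "exp (\<i> * of_real t) - exp (- (\<i> * of_real t)) = 2 * \<i> * of_real (sin t)"
      by (simp add: exp_eq_polar complex_eq_iff Re_exp Im_exp)
    finally show "1 - q ^ (2 * i + 1) = e (- int (2 * i + 1)) * (2 * \<i> * of_real (sin (2 * pi * real (2 * i + 1) / real n)))"
      unfolding 1 t_def .
  qed
  also have "\<dots> = (\<Prod>i<m. e (- int (2 * i + 1))) * ((2 * \<i>) ^ m * of_real (\<Prod>i<m. sin (2 * pi * real (2 * i + 1) / real n)))"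
    by (simp add: prod.distrib)
  \<comment> \<open>The first m odd numbers add up to m squared, and (m + 1) squared minus m squared
    is \<open>n\<close>, so this phase cancels \<open>e (h\<^sup>2)\<close>.\<close>
  also have "(\<Prod>i<m. e (- int (2 * i + 1))) = e (- (int m)\<^sup>2)"
  proof (induction m)
    case (Suc m)
    show ?case
      unfolding prod.lessThan_Suc Suc e_add [symmetric] by (simp add: power2_eq_square algebra_simps)
  qed (simp add: e_def)
  also have "e (h\<^sup>2) * (e (- (int m)\<^sup>2) * X) = X" for X
  proof -
    have "e (h\<^sup>2) * e (- (int m)\<^sup>2) = e (int n)"
      unfolding e_add [symmetric] by (simp add: h_def assms power2_eq_square algebra_simps)
    also have "\<dots> = 1"
      using n by (simp add: e_def)
    finally show ?thesis by (simp add: mult.assoc [symmetric])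
  qed
  finally show ?thesis .
qed

text \<open>
  The sine factors with \<open>2 (2 i + 1) > n\<close> are the negative ones.
\<close>
theorem gauss_sum_odd:
  assumes "odd n"
  shows "gauss_sum n = gauss_eps n * of_real (sqrt (real n))"
proof -
  obtain m where m: "n = 2 * m + 1" using assms by (elim oddE)
  have n: "n > 0" using m by simp
  define S where "S = (\<lambda>i. sin (2 * pi * real (2 * i + 1) / real n))"
  \<comment> \<open>The number of indices i < m with 2(2i + 1) at most n, that is, of the
    non-negative sines; the other \<open>m div 2\<close> give the sign.\<close>
  define c where "c = (m + 1) div 2"
  have S: "S i = (if i < c then 1 else -1) * \<bar>S i\<bar>" if "i < m" for i
  proof (cases "i < c")
    case True
    hence "2 * (2 * i + 1) \<le> n"
      using that m unfolding c_def by presburger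
    hence "2 * real (2 * i + 1) \<le> real n"
      by (metis of_nat_le_iff of_nat_mult of_nat_numeral)
    hence "pi * (2 * real (2 * i + 1)) \<le> pi * real n"
      by (intro mult_left_mono) auto
    hence "2 * pi * real (2 * i + 1) / real n \<le> pi"
      using n by (simp add: field_simps)
    hence "S i \<ge> 0"
      unfolding S_def by (intro sin_ge_zero) auto
    thus ?thesis using True by simp
  next
    case False
    hence "n \<le> 2 * (2 * i + 1)" "2 * i + 1 \<le> n"
      using that m unfolding c_def by presburger+
    hence "real n \<le> 2 * real (2 * i + 1)" "real (2 * i + 1) \<le> real n"
      by (metis of_nat_le_iff of_nat_mult of_nat_numeral) (simp only: of_nat_le_iff \<open>2 * i + 1 \<le> n\<close>)
    hence "pi * real n \<le> pi * (2 * real (2 * i + 1))" "pi * real (2 * i + 1) \<le> pi * real n"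
      by (intro mult_left_mono; simp)+
    hence "pi \<le> 2 * pi * real (2 * i + 1) / real n" "2 * pi * real (2 * i + 1) / real n \<le> 2 * pi"
      using n by (simp_all add: field_simps)
    hence "0 \<le> sin (2 * pi * real (2 * i + 1) / real n - pi)"
      by (intro sin_ge_zero) auto
    hence "S i \<le> 0"
      by (simp add: S_def sin_diff)
    thus ?thesis using False by simp
  qed
  define P where "P = (\<Prod>i<m. \<bar>S i\<bar>)"
  have "(\<Prod>i<m. S i) = (\<Prod>i<m. (if i < c then 1 else -1) * \<bar>S i\<bar>)"
    using S by (intro prod.cong) auto
  also have "\<dots> = (\<Prod>i<m. if i < c then 1 else -1) * P"
    by (simp add: prod.distrib P_def)
  also have "(\<Prod>i<m. if i < c then 1 else -1 :: real) = (-1) ^ (m div 2)"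
  proof -
    have "(\<Prod>i<m. if i < c then 1 else -1 :: real) = (-1) ^ card ({..<m} \<inter> - {i. i < c})"
      by (subst prod.If_cases) auto
    also have "{..<m} \<inter> - {i. i < c} = {c..<m}" by auto
    also have "card {c..<m} = m div 2"
      unfolding c_def by simp
    finally show ?thesis .
  qed
  finally have "gauss_sum n = (2 * \<i>) ^ m * of_real ((-1) ^ (m div 2) * P)"
    using gauss_sum_eq_prod[OF m] by (simp add: S_def)
  also have "\<dots> = (\<i> ^ m * (-1) ^ (m div 2)) * of_real (2 ^ m * P)"
    by (simp add: power_mult_distrib)
  also have "\<i> ^ m * (-1) ^ (m div 2) = gauss_eps n"
  proof -
    obtain k where "m = 2 * k \<or> m = 2 * k + 1"
      by (metis oddE evenE)
    moreover have "\<i> ^ (2 * k) * (-1) ^ k = 1"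
      by (simp add: power_mult power_mult_distrib [symmetric])
    moreover have "(2 * (2 * k) + 1) mod 4 \<noteq> 3" "(2 * (2 * k + 1) + 1) mod 4 = 3"
      by presburger+
    ultimately show ?thesis
      unfolding gauss_eps_def m by (auto simp: mult.assoc)
  qed
  finally have G: "gauss_sum n = gauss_eps n * of_real (2 ^ m * P)" .
  \<comment> \<open>The product of the absolute sines is never computed: its value is forced by
    \<open>norm_gauss_sum\<close>.\<close>
  have "norm (gauss_eps n) = 1"
    by (simp add: gauss_eps_def)
  moreover have "P \<ge> 0"
    by (simp add: P_def prod_nonneg)
  ultimately have "norm (gauss_sum n) = 2 ^ m * P"
    unfolding G norm_mult by (simp add: norm_mult norm_power)
  thus ?thesis
    using G norm_gauss_sum[OF assms] by metis
qed

text \<open>Residues modulo mn are written as nb + mc, because (nb + mc)/(mn) = b/m + c/n splits the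
  additive character. The price is the multipliers \<open>n\<close> and \<open>m\<close> inside
  \<open>f\<close> and \<open>h\<close>, which become Jacobi symbols later.\<close>

lemma sum_cis2_crt:
  fixes f h :: "int \<Rightarrow> complex"
  assumes mn: "m > 0" "n > 0" "coprime m n"
    and f: "\<And>x y. [x = y] (mod int m) \<Longrightarrow> f x = f y"
    and h: "\<And>x y. [x = y] (mod int n) \<Longrightarrow> h x = h y"
  shows "(\<Sum>b<m * n. f (int b) * h (int b) * addchar (m * n) (y * int b)) =
         (\<Sum>b<m. f (int n * int b) * addchar m (y * int b)) *
         (\<Sum>c<n. h (int m * int c) * addchar n (y * int c))"
proof -
  define F where "F = (\<lambda>x. f x * h x * addchar (m * n) (y * x))"
  have F_cong: "F x = F x'" if "[x = x'] (mod int (m * n))" for x x'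
  proof -
    have "[x = x'] (mod int m)" "[x = x'] (mod int n)"
      using that by (auto intro: cong_dvd_modulus)
    moreover have "addchar (m * n) (y * x) = addchar (m * n) (y * x')"
      using mn that by (intro cis2_cong_nat cong_mult cong_refl) auto
    ultimately show ?thesis
      using f h unfolding F_def by metis
  qed
  define g where "g = (\<lambda>(b, c). (n * b + m * c) mod (m * n))"
  have "inj_on g ({..<m} \<times> {..<n})"
  proof (rule inj_onI, clarsimp simp: g_def)
    fix b c b' c' assume bc: "b < m" "c < n" "b' < m" "c' < n"
      "(n * b + m * c) mod (m * n) = (n * b' + m * c') mod (m * n)"
    hence eq: "[n * b + m * c = n * b' + m * c'] (mod (m * n))"
      by (simp add: cong_def)
    have "[n * b + m * c = n * b' + m * c'] (mod m)" "[n * b + m * c = n * b' + m * c'] (mod n)"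
      using eq by (auto intro: cong_dvd_modulus_nat)
    hence "[n * b = n * b'] (mod m)" "[m * c = m * c'] (mod n)"
      by (simp_all add: cong_def)
    hence "[b = b'] (mod m)" "[c = c'] (mod n)"
      using mn(3) by (simp_all add: cong_mult_lcancel_nat coprime_commute)
    thus "b = b' \<and> c = c'"
      using bc by (simp add: cong_def)
  qed
  moreover have "g ` ({..<m} \<times> {..<n}) \<subseteq> {..<m * n}"
    using mn by (auto simp: g_def)
  moreover have "card ({..<m} \<times> {..<n}) = card {..<m * n}"
    by (simp add: card_cartesian_product)
  ultimately have bij: "bij_betw g ({..<m} \<times> {..<n}) {..<m * n}"
    by (metis bij_betw_def card_image card_subset_eq finite_lessThan)
  have "(\<Sum>b<m * n. F (int b)) = (\<Sum>(b, c)\<in>{..<m} \<times> {..<n}. F (int (g (b, c))))"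
    using sum.reindex_bij_betw[OF bij, of "\<lambda>b. F (int b)"] by (simp add: case_prod_unfold)
  also have "\<dots> = (\<Sum>(b, c)\<in>{..<m} \<times> {..<n}.
      (f (int n * int b) * addchar m (y * int b)) * (h (int m * int c) * addchar n (y * int c)))"
  proof (intro sum.cong refl, clarify)
    fix b c
    have "F (int (g (b, c))) = F (int n * int b + int m * int c)"
      unfolding g_def by (intro F_cong) (simp add: cong_def zmod_int)
    also have "f (int n * int b + int m * int c) = f (int n * int b)" "h (int n * int b + int m * int c) = h (int m * int c)"
      by (auto intro!: f h simp: cong_iff_dvd_diff)
    hence "F (int n * int b + int m * int c) = f (int n * int b) * h (int m * int c) *
        addchar (m * n) (y * (int n * int b + int m * int c))"
      by (simp add: F_def)
    also have "(of_int (y * (int n * int b + int m * int c)) / of_nat (m * n) :: complex) =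
        of_int (y * int b) / of_nat m + of_int (y * int c) / of_nat n"
      using mn by (simp add: field_simps)
    finally show "F (int (g (b, c))) = (f (int n * int b) * addchar m (y * int b)) * (h (int m * int c) * addchar n (y * int c))"
      by (simp add: cis2_add)
  qed
  also have "\<dots> = (\<Sum>b<m. f (int n * int b) * addchar m (y * int b)) *
         (\<Sum>c<n. h (int m * int c) * addchar n (y * int c))"
    by (simp add: sum_product sum.cartesian_product)
  finally show ?thesis by (simp add: F_def)
qed

lemma card_square_roots:
  assumes p: "prime p" "odd p" and b: "b < p"
  shows "int (card {k\<in>{..<p}. [k ^ 2 = b] (mod p)}) = 1 + Legendre (int b) (int p)"
proof -
  have p0: "p > 0" "p > 2" using p prime_gt_0_nat odd_prime_gt_2 by auto
  have dvd: "p dvd k ^ 2 \<longleftrightarrow> p dvd k" for k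
    using p(1) by (simp add: prime_dvd_power_iff)
  consider "b = 0" | "b \<noteq> 0" "\<not> QuadRes (int p) (int b)" | "b \<noteq> 0" "QuadRes (int p) (int b)" by blast
  thus ?thesis
  proof cases
    case 1
    have "{k\<in>{..<p}. [k ^ 2 = b] (mod p)} = {0}"
      using p0 dvd 1 by (auto simp: cong_0_iff dest: dvd_imp_le)
    thus ?thesis using 1 by (simp add: Legendre_def)
  next
    case 2
    have nz: "\<not> [int b = 0] (mod int p)"
      using 2 b by (auto simp: cong_0_iff dest: dvd_imp_le)
    have "\<not> [k ^ 2 = b] (mod p)" for k
      using 2 unfolding QuadRes_def by (metis cong_int_iff of_nat_power)
    hence "{k\<in>{..<p}. [k ^ 2 = b] (mod p)} = {}" by blast
    thus ?thesis using 2 nz by (simp add: Legendre_def)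
  next
    case 3
    have nz: "\<not> [int b = 0] (mod int p)"
      using 3 b by (auto simp: cong_0_iff dest: dvd_imp_le)
    obtain y where y: "[y ^ 2 = int b] (mod int p)"
      using 3 by (auto simp: QuadRes_def)
    define k0 where "k0 = nat (y mod int p)"
    have k0: "k0 < p" "int k0 = y mod int p"
      using p0 by (auto simp: k0_def nat_less_iff)
    have "[int k0 ^ 2 = y ^ 2] (mod int p)"
      unfolding k0 by (intro cong_pow) (simp add: cong_def)
    hence "[int (k0 ^ 2) = int b] (mod int p)"
      using y cong_trans by auto
    hence sq: "[k0 ^ 2 = b] (mod p)"
      by (simp only: cong_int_iff)
    have k0_nz: "k0 \<noteq> 0"
    proof
      assume "k0 = 0"
      hence "[0 = b] (mod p)" using sq by simp
      thus False using 3(1) b by (simp add: cong_def)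
    qed
    have "[k ^ 2 = b] (mod p) \<longleftrightarrow> k = k0 \<or> k = p - k0" if "k < p" for k
    proof -
      have "[k ^ 2 = b] (mod p) \<longleftrightarrow> [k ^ 2 = k0 ^ 2] (mod p)"
        using sq by (metis cong_sym cong_trans)
      also have "\<dots> \<longleftrightarrow> int p dvd (int k - int k0) * (int k + int k0)"
        unfolding cong_int_iff[symmetric] by (simp add: cong_iff_dvd_diff power2_eq_square algebra_simps)
      also have "\<dots> \<longleftrightarrow> int p dvd int k - int k0 \<or> int p dvd int k + int k0"
        using p(1) by (simp add: prime_dvd_mult_iff)
      also have "int p dvd int k - int k0 \<longleftrightarrow> k = k0"
        using that k0(1) by (auto simp: cong_iff_dvd_diff[symmetric] cong_int_iff cong_def)
      also have "int p dvd int k + int k0 \<longleftrightarrow> k = p - k0"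
      proof
        assume "int p dvd int k + int k0"
        hence "p dvd k + k0" by (metis int_dvd_int_iff of_nat_add)
        then obtain j where j: "k + k0 = p * j" by auto
        have "0 < p * j" "p * j < p * 2" using j k0_nz that k0 by linarith+
        hence "j = 1" by (simp add: p0)
        thus "k = p - k0" using j by simp
      next
        assume "k = p - k0"
        thus "int p dvd int k + int k0" using k0 by simp
      qed
      finally show ?thesis .
    qed
    hence "{k\<in>{..<p}. [k ^ 2 = b] (mod p)} = {k0, p - k0}"
      using k0 k0_nz p0 by auto
    moreover have "k0 \<noteq> p - k0"
      using p(2) k0(1) by presburger
    ultimately show ?thesis using 3 nz by (simp add: Legendre_def)
  qed
qed

text \<open>A residue b has 1 + (b/p) square roots, so a quadratic exponential sum is a linear one
  plus a character sum. This settles y = 1; other units y follow by rescaling b, and for p dividing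
  y both sides vanish.\<close>

lemma character_gauss_sum_prime:
  assumes p: "prime p" "odd p"
  shows "(\<Sum>b<p. of_int (jacobi (int b) p) * addchar p (y * int b)) =
           of_int (jacobi y p) * gauss_sum p"
proof -
  have p0: "p > 0" "p > 1" using p prime_gt_0_nat prime_gt_1_nat by auto
  define S where "S = (\<lambda>y. \<Sum>b<p. of_int (jacobi (int b) p) * addchar p (y * int b))"
  have full: "(\<Sum>k<p. addchar p (y * (int k)\<^sup>2)) = (\<Sum>b<p. cis2 (of_int y * of_nat b / of_nat p)) + S y" for y
  proof -
    define \<phi> where "\<phi> = (\<lambda>k. k ^ 2 mod p)"
    have "[(int k)\<^sup>2 = int (\<phi> k)] (mod int p)" for k
      by (simp add: \<phi>_def cong_def zmod_int)
    hence "(\<Sum>k<p. addchar p (y * (int k)\<^sup>2)) = (\<Sum>k<p. addchar p (y * int (\<phi> k)))"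
      by (intro sum.cong[OF refl] cis2_cong_nat cong_mult[OF cong_refl] p0) auto
    also have "\<dots> = (\<Sum>b<p. \<Sum>k\<in>{k\<in>{..<p}. \<phi> k = b}. addchar p (y * int (\<phi> k)))"
      by (rule sum.group [symmetric]) (use p0 in \<open>auto simp: \<phi>_def\<close>)
    also have "\<dots> = (\<Sum>b<p. (1 + of_int (jacobi (int b) p)) * addchar p (y * int b))"
    proof (intro sum.cong refl)
      fix b assume b: "b \<in> {..<p}"
      have "{k\<in>{..<p}. \<phi> k = b} = {k\<in>{..<p}. [k ^ 2 = b] (mod p)}"
        using b by (auto simp: \<phi>_def cong_def)
      hence "int (card {k\<in>{..<p}. \<phi> k = b}) = 1 + jacobi (int b) p"
        using card_square_roots[OF p, of b] b by (simp add: jacobi_prime p)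
      hence "of_int (int (card {k\<in>{..<p}. \<phi> k = b})) = (of_int (1 + jacobi (int b) p) :: complex)"
        by (rule arg_cong)
      hence "of_nat (card {k\<in>{..<p}. \<phi> k = b}) = (1 + of_int (jacobi (int b) p) :: complex)"
        by (simp only: of_int_of_nat_eq of_int_add of_int_1)
      thus "(\<Sum>k\<in>{k\<in>{..<p}. \<phi> k = b}. addchar p (y * int (\<phi> k))) =
          (1 + of_int (jacobi (int b) p)) * addchar p (y * int b)"
        by simp
    qed
    finally show ?thesis
      by (simp add: S_def distrib_right sum.distrib)
  qed
  have "\<not> int p dvd 1"
    using p0(2) by (simp add: zdvd1_eq)
  hence S1: "S 1 = gauss_sum p"
    using full[of 1] sum_cis2_roots[OF p0(1), of 1] by (simp add: gauss_sum_def)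
  show ?thesis
  proof (cases "int p dvd y")
    case True
    have one: "addchar p (y * x) = 1" for x
      using cis2_root_of_unity[OF p0(1), of "y * x"] True by simp
    have "(\<Sum>k<p. addchar p (y * (int k)\<^sup>2)) = of_nat p"
      by (simp only: one) simp
    hence "S y = 0"
      using full[of y] sum_cis2_roots[OF p0(1), of y] True by simp
    moreover have "jacobi y p = 0"
      using True p by (simp add: jacobi_prime Legendre_eq_0_iff)
    ultimately show ?thesis by (simp add: S_def)
  next
    case False
    hence cop: "coprime y (int p)"
      using p(1) by (metis coprime_commute prime_imp_coprime prime_nat_int_transfer)
    have sq: "jacobi y p * jacobi y p = 1"
      by (intro jacobi_square p0 cop)
    have "of_int (jacobi y p) * gauss_sum p = (\<Sum>b<p. of_int (jacobi y p) * (of_int (jacobi (int b) p) * addchar p (int b)))"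
      by (simp add: S1[symmetric] S_def sum_distrib_left)
    also have "\<dots> = (\<Sum>b<p. of_int (jacobi y p) * (of_int (jacobi (y * int b + 0) p) * addchar p (y * int b + 0)))"
      by (rule sum_periodic_affine[symmetric]) (use p0 cop in \<open>auto simp: jacobi_cong[of _ _ p] cis2_cong_nat[of _ _ p]\<close>)
    also have "\<dots> = (\<Sum>b<p. of_int (jacobi y p * jacobi y p) * (of_int (jacobi (int b) p) * addchar p (y * int b)))"
      using p by (intro sum.cong refl) (simp add: jacobi_mult_left)
    finally show ?thesis by (simp add: sq)
  qed
qed

text \<open>The reciprocity sign is exactly the failure of \<open>gauss_eps\<close> to be
  multiplicative: two factors \<open>\<i>\<close> arise when both moduli are 3 modulo 4.\<close>

lemma gauss_eps_mult:
  assumes "odd m" "odd n" "coprime m n"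
  shows "of_int (jacobi (int m) n) * of_int (jacobi (int n) m) * gauss_eps m * gauss_eps n = gauss_eps (m * n)"
  unfolding of_int_mult[symmetric] jacobi_reciprocity[OF assms] gauss_eps_def mod4_mult_eq_3[OF assms(1,2)] by auto

lemma squarefree_prime_multD:
  fixes p n :: nat
  assumes "prime p" "squarefree (p * n)"
  shows "coprime p n" "squarefree n"
proof -
  have "\<not> p dvd n"
  proof
    assume "p dvd n"
    hence "p ^ 2 dvd p * n" by (simp add: power2_eq_square)
    with assms(2) have "is_unit p" unfolding squarefree_def by blast
    with assms(1) show False by simp
  qed
  thus "coprime p n"
    using assms(1) by (simp add: prime_imp_coprime)
  show "squarefree n"
    using assms(2) by (rule squarefree_mono[rotated]) simp
qed

theorem character_gauss_sum:
  assumes "odd n" "squarefree n"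
  shows "(\<Sum>b<n. of_int (jacobi (int b) n) * addchar n (y * int b)) =
           of_int (jacobi y n) * gauss_eps n * of_real (sqrt (real n))"
  using assms
proof (induction n arbitrary: y rule: odd_nat_induct)
  case one
  show ?case by (simp add: gauss_eps_def)
next
  case (factor p n)
  have pn: "p > 0" "n > 0" "odd (p * n)"
    using factor by (auto simp: prime_gt_0_nat odd_pos)
  note cop = squarefree_prime_multD(1)[OF factor(1) factor.prems]
    and sqf = squarefree_prime_multD(2)[OF factor(1) factor.prems]
  have "(\<Sum>b<p*n. of_int (jacobi (int b) (p * n)) * addchar (p * n) (y * int b)) =
     (\<Sum>b<p*n. of_int (jacobi (int b) p) * of_int (jacobi (int b) n) * addchar (p * n) (y * int b))"
    using pn by (simp add: jacobi_mult_right)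
  also have "\<dots> = (\<Sum>b<p. of_int (jacobi (int n * int b) p) * addchar p (y * int b)) *
        (\<Sum>b<n. of_int (jacobi (int p * int b) n) * addchar n (y * int b))"
    by (rule sum_cis2_crt) (use pn cop in \<open>auto simp: jacobi_cong[of _ _ p] jacobi_cong[of _ _ n]\<close>)
  also have "(\<Sum>b<p. of_int (jacobi (int n * int b) p) * addchar p (y * int b)) =
      of_int (jacobi (int n) p) * (of_int (jacobi y p) * gauss_sum p)"
    unfolding character_gauss_sum_prime[OF factor(1,2), of y, symmetric] sum_distrib_left
      jacobi_mult_left[OF factor(2)] by (simp only: of_int_mult mult_ac)
  also have "(\<Sum>b<n. of_int (jacobi (int p * int b) n) * addchar n (y * int b)) =
      of_int (jacobi (int p) n) * (of_int (jacobi y n) * gauss_eps n * of_real (sqrt (real n)))"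
    unfolding factor.IH[OF sqf, symmetric] sum_distrib_left jacobi_mult_left[OF factor(3)]
    by (simp only: of_int_mult mult_ac)
  also have "gauss_sum p = gauss_eps p * of_real (sqrt (real p))"
    by (rule gauss_sum_odd) fact
  also have "of_int (jacobi (int n) p) * (of_int (jacobi y p) * (gauss_eps p * of_real (sqrt (real p)))) *
      (of_int (jacobi (int p) n) * (of_int (jacobi y n) * gauss_eps n * of_real (sqrt (real n)))) =
      of_int (jacobi y (p * n)) * (of_int (jacobi (int p) n) * of_int (jacobi (int n) p) * gauss_eps p * gauss_eps n) * of_real (sqrt (real (p * n)))"
    using pn by (simp add: jacobi_mult_right real_sqrt_mult)
  also have "of_int (jacobi (int p) n) * of_int (jacobi (int n) p) * gauss_eps p * gauss_eps n = gauss_eps (p * n)"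
    by (intro gauss_eps_mult factor cop)
  finally show ?case .
qed

text \<open>Multiplicative by the Chinese remainder theorem. At a prime p the sum over units is p -
  1 if p divides y and -1 otherwise, which the squared symbol expresses in one formula.\<close>

lemma ramanujan_sum:
  assumes "odd n" "squarefree n"
  shows "(\<Sum>b<n. of_bool (coprime (int b) (int n)) * addchar n (y * int b)) =
           of_int (\<Prod>p\<in>prime_factors n. int p - 1 - int p * (jacobi y p)\<^sup>2)"
  using assms
proof (induction n arbitrary: y rule: odd_nat_induct)
  case one
  show ?case by simp
next
  case (factor p n)
  have pn: "p > 0" "n > 0" "odd (p * n)"
    using factor by (auto simp: prime_gt_0_nat odd_pos)
  note cop = squarefree_prime_multD(1)[OF factor(1) factor.prems]
    and sqf = squarefree_prime_multD(2)[OF factor(1) factor.prems]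
  have ndvd: "\<not> p dvd n"
    using cop factor(1) by (metis coprime_absorb_left not_prime_unit)
  have per: "coprime x (int k) \<longleftrightarrow> coprime z (int k)" if "[x = z] (mod int k)" for x z k
    using that by (metis cong_imp_coprime cong_sym)
  have prime_sum: "(\<Sum>b<p. of_bool (coprime (int b) (int p)) * addchar p (y * int b)) = of_int (int p - 1 - int p * (jacobi y p)\<^sup>2)"
  proof -
    have "(\<Sum>b<p. of_bool (coprime (int b) (int p)) * addchar p (y * int b)) =
      (\<Sum>b<p. (if b = 0 then 0 else addchar p (y * int b)))"
    proof (intro sum.cong refl)
      fix b assume "b \<in> {..<p}"
      hence "coprime b p \<longleftrightarrow> b \<noteq> 0"
        using factor(1) by (metis coprime_0_left_iff coprime_commute dvd_imp_le lessThan_iff linorder_not_le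
           not_gr_zero not_prime_unit prime_imp_coprime)
      thus "of_bool (coprime (int b) (int p)) * addchar p (y * int b) = (if b = 0 then 0 else addchar p (y * int b))"
        by simp
    qed
    also have "\<dots> = (\<Sum>b\<in>{..<p}-{0}. addchar p (y * int b))"
      by (intro sum.mono_neutral_cong_right) auto
    also have "\<dots> = (\<Sum>b<p. cis2 (of_int y * of_nat b / of_nat p)) - 1"
      using pn by (subst sum_diff) auto
    also have "\<dots> = of_int (int p - 1 - int p * (jacobi y p)\<^sup>2)"
      using sum_cis2_roots[OF pn(1), of y] Legendre_range[of y "int p"] Legendre_eq_0_iff[of y "int p"] factor(1)
      by (auto simp: jacobi_prime)
    finally show ?thesis .
  qed
  have "(\<Sum>b<p*n. of_bool (coprime (int b) (int (p * n))) * addchar (p * n) (y * int b)) =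
     (\<Sum>b<p*n. of_bool (coprime (int b) (int p)) * of_bool (coprime (int b) (int n)) * addchar (p * n) (y * int b))"
    by (intro sum.cong refl) (auto simp: of_bool_def)
  also have "\<dots> = (\<Sum>b<p. of_bool (coprime (int n * int b) (int p)) * addchar p (y * int b)) *
        (\<Sum>b<n. of_bool (coprime (int p * int b) (int n)) * addchar n (y * int b))"
    by (rule sum_cis2_crt[where f = "\<lambda>x. of_bool (coprime x (int p))" and h = "\<lambda>x. of_bool (coprime x (int n))"])
       (use pn cop per[of _ _ p] per[of _ _ n] in auto)
  also have "(\<Sum>b<p. of_bool (coprime (int n * int b) (int p)) * addchar p (y * int b)) =
      of_int (int p - 1 - int p * (jacobi y p)\<^sup>2)"
    using cop prime_sum by (simp add: coprime_commute)
  also have "(\<Sum>b<n. of_bool (coprime (int p * int b) (int n)) * addchar n (y * int b)) =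
      of_int (\<Prod>p\<in>prime_factors n. int p - 1 - int p * (jacobi y p)\<^sup>2)"
    using cop factor.IH[OF sqf, of y] by simp
  also have "of_int (int p - 1 - int p * (jacobi y p)\<^sup>2) * of_int (\<Prod>p\<in>prime_factors n. int p - 1 - int p * (jacobi y p)\<^sup>2) =
      (of_int (\<Prod>p\<in>insert p (prime_factors n). int p - 1 - int p * (jacobi y p)\<^sup>2) :: complex)"
    using ndvd by (subst prod.insert) (auto dest: dvd_imp_le)
  also have "insert p (prime_factors n) = prime_factors (p * n)"
    using pn factor(1) by (simp add: prime_factors_product prime_prime_factors)
  finally show ?case .
qed

text \<open>Splitting into d/k blocks of length k leaves a geometric sum that vanishes unless d/k
  divides u. This is where the divisibility condition under the sum in \<open>R_odd\<close> comes
  from.\<close>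

lemma sum_cis2_periodic:
  fixes f :: "int \<Rightarrow> complex"
  assumes d: "d > 0" "k dvd d" and per: "\<And>x y. [x = y] (mod int k) \<Longrightarrow> f x = f y"
  shows "(\<Sum>b<d. f (int b) * addchar d (u * int b)) =
     (if int d dvd u * int k then of_nat (d div k) *
        (\<Sum>b<k. f (int b) * addchar k ((u * int k div int d) * int b)) else 0)"
proof -
  obtain e where e: "d = k * e" using d by auto
  have ke: "k > 0" "e > 0" using d e by auto
  have "(\<Sum>b<d. f (int b) * addchar d (u * int b)) =
      (\<Sum>j<e. \<Sum>b\<in>{j*k..<j*k+k}. f (int b) * addchar d (u * int b))"
    unfolding e mult.commute[of k e] by (rule sum.nat_group[symmetric])
  also have "\<dots> = (\<Sum>j<e. \<Sum>b<k. f (int b) * addchar d (u * int b) * cis2 (of_int u * of_nat j / of_nat e))"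
  proof (rule sum.cong[OF refl])
    fix j
    have "(\<Sum>b\<in>{j*k..<j*k+k}. f (int b) * addchar d (u * int b)) =
       (\<Sum>b<k. f (int (b + j * k)) * addchar d (u * int (b + j * k)))"
      by (intro sum.reindex_bij_witness[of _ "\<lambda>b. b + j * k" "\<lambda>b. b - j * k"]) auto
    also have "\<dots> = (\<Sum>b<k. f (int b) * addchar d (u * int b) * cis2 (of_int u * of_nat j / of_nat e))"
    proof (intro sum.cong refl)
      fix b
      have "f (int (b + j * k)) = f (int b)"
        by (intro per) (simp add: cong_iff_dvd_diff)
      moreover have "(of_int (u * int (b + j * k)) / of_nat d :: complex) = of_int (u * int b) / of_nat d + of_int u * of_nat j / of_nat e"
        using ke by (simp add: e field_simps)
      ultimately show "f (int (b + j * k)) * addchar d (u * int (b + j * k)) =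
          f (int b) * addchar d (u * int b) * cis2 (of_int u * of_nat j / of_nat e)"
        by (simp only: cis2_add mult.assoc)
    qed
    finally show "(\<Sum>b\<in>{j*k..<j*k+k}. f (int b) * addchar d (u * int b)) =
      (\<Sum>b<k. f (int b) * addchar d (u * int b) * cis2 (of_int u * of_nat j / of_nat e))" .
  qed
  also have "\<dots> = (\<Sum>j<e. cis2 (of_int u * of_nat j / of_nat e)) * (\<Sum>b<k. f (int b) * addchar d (u * int b))"
    unfolding sum_product by (simp only: mult_ac)
  also have "\<dots> = (if int e dvd u then of_nat e * (\<Sum>b<k. f (int b) * addchar d (u * int b)) else 0)"
    by (simp add: sum_cis2_roots ke)
  finally have main: "(\<Sum>b<d. f (int b) * addchar d (u * int b)) =
    (if int e dvd u then of_nat e * (\<Sum>b<k. f (int b) * addchar d (u * int b)) else 0)" .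
  have iff: "int d dvd u * int k \<longleftrightarrow> int e dvd u"
    using ke by (simp add: e mult.commute)
  show ?thesis
  proof (cases "int e dvd u")
    case True
    then obtain v where v: "u = int e * v" by auto
    have uv: "u * int k div int d = v"
      using ke by (simp add: v e)
    have arg: "(of_int (u * x) / of_nat d :: complex) = of_int (v * x) / of_nat k" for x
      using ke by (simp add: v e field_simps)
    have "d div k = e" using ke by (simp add: e)
    have "(\<Sum>b<d. f (int b) * addchar d (u * int b)) =
        of_nat e * (\<Sum>b<k. f (int b) * addchar k (v * int b))"
      by (subst main) (simp only: True if_True arg)
    thus ?thesis
      by (simp only: iff True if_True uv \<open>d div k = e\<close>)
  next
    case False
    thus ?thesis
      by (subst main) (simp only: iff if_False)
  qed
qed

section \<open>The primitive Hecke operator on powers of \<open>\<eta>\<close>\<close>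

lemma jacobi_is_square:
  assumes "is_square n" "n > 0" "coprime x (int n)"
  shows "jacobi x n = 1"
proof -
  obtain k where k: "n = k * k"
    using assms(1) by (auto elim: is_nth_powerE simp: power2_eq_square)
  have "k > 0" using k assms(2) by (cases k) auto
  moreover have "coprime x (int k)"
    using assms(3) by (simp add: k)
  ultimately show ?thesis
    unfolding k by (simp add: jacobi_mult_right jacobi_square)
qed

lemma jacobi_eq_if_square:
  assumes "is_square (m * n)" "m > 0" "n > 0" "coprime x (int m)" "coprime x (int n)"
  shows "jacobi x m = jacobi x n"
proof -
  have "jacobi x m * jacobi x n = 1"
    using jacobi_is_square[OF assms(1), of x] assms by (simp add: jacobi_mult_right)
  thus ?thesis
    using jacobi_range[of x m] jacobi_range[of x n] by auto
qed

lemma multiplicity_gcd_nat: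
  fixes m n p :: nat
  assumes "m > 0" "n > 0" "prime p"
  shows "multiplicity p (gcd m n) = min (multiplicity p m) (multiplicity p n)"
proof -
  have "count (prime_factorization (gcd m n)) p = min (count (prime_factorization m) p) (count (prime_factorization n) p)"
    using assms by (simp add: prime_factorization_gcd)
  thus ?thesis using assms by (simp add: count_prime_factorization_prime)
qed

text \<open>At every prime one of \<open>a\<close>, \<open>h\<close> has exponent 0, so the
  exponents of the other and of \<open>c\<close> have equal parity, shared by their minimum. It
  allows symbols modulo the gcds to be exchanged for symbols modulo \<open>a\<close>,
  \<open>h\<close> and \<open>c\<close>.\<close>

lemma is_square_gcd:
  fixes a h c :: nat
  assumes sq: "is_square (a * h * c)" and cop: "coprime a h" and pos: "a > 0" "h > 0" "c > 0"
  shows "is_square (a * gcd a c)" "is_square (h * gcd h c)" "is_square (c * (gcd a c * gcd h c))"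
proof -
  have ev: "even (multiplicity p a + multiplicity p h + multiplicity p c)" if "prime p" for p
  proof -
    have "even (multiplicity p (a * h * c))"
      using sq that is_nth_power_conv_multiplicity_nat[of 2] by simp
    thus ?thesis
      using that pos by (simp add: prime_elem_multiplicity_mult_distrib)
  qed
  have z: "multiplicity p a = 0 \<or> multiplicity p h = 0" if "prime p" for p
    using cop that by (metis coprime_common_divisor not_dvd_imp_multiplicity_0 not_prime_unit)
  note simps = prime_elem_multiplicity_mult_distrib multiplicity_gcd_nat
  have "even (multiplicity p (a * gcd a c))" "even (multiplicity p (h * gcd h c))"
    "even (multiplicity p (c * (gcd a c * gcd h c)))" if "prime p" for p
    using ev[OF that] z[OF that] that pos by (auto simp: simps min_def)
  thus "is_square (a * gcd a c)" "is_square (h * gcd h c)" "is_square (c * (gcd a c * gcd h c))"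
    by (simp_all add: is_nth_power_conv_multiplicity_nat)
qed

lemma coprime_not_both_even: "coprime (m::nat) n \<Longrightarrow> even m \<Longrightarrow> even n \<Longrightarrow> False"
  using coprime_common_divisor[of m n 2] by simp

text \<open>Every unit modulo a divisor of 24 is its own inverse; checked separately on the part
  dividing 8 and the part dividing 3.\<close>

lemma square_mod_24:
  fixes d N :: nat
  assumes "coprime d N" "N dvd 24"
  shows "int N dvd (int d)\<^sup>2 - 1"
proof -
  have "N dvd 8 * 3" using assms(2) by simp
  then obtain a b where ab: "N = a * b" "a dvd 8" "b dvd 3"
    using division_decomp by blast
  have a: "int a dvd (int d)\<^sup>2 - 1"
  proof (cases "even a")
    case True
    hence "odd d" using assms(1) ab(1) coprime_not_both_even[of d N] by auto
    then obtain k where k: "d = 2 * k + 1" by (elim oddE)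
    have "even (k * (k + 1))" by simp
    then obtain j where j: "k * (k + 1) = 2 * j" by (elim evenE)
    have "(int d)\<^sup>2 - 1 = 4 * int (k * (k + 1))"
      by (simp add: k power2_eq_square algebra_simps)
    hence "8 dvd (int d)\<^sup>2 - 1" unfolding j by simp
    thus ?thesis using ab(2) by (metis dvd_trans int_dvd_int_iff of_nat_numeral)
  next
    case False
    hence "coprime a (2 ^ 3)" unfolding coprime_power_right_iff by simp
    moreover have "a dvd 2 ^ 3" using ab(2) by simp
    ultimately have "is_unit a" using coprime_absorb_left by blast
    thus ?thesis by simp
  qed
  have b: "int b dvd (int d)\<^sup>2 - 1"
  proof (cases "b = 1")
    case False
    moreover have "prime (3::nat)" by simp
    ultimately have "b = 3" using ab(3) prime_nat_iff[of 3] by blast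
    hence "\<not> 3 dvd d" using assms(1) ab(1) by auto
    hence "3 dvd int d - 1 \<or> 3 dvd int d + 1" by presburger
    moreover have "(int d)\<^sup>2 - 1 = (int d - 1) * (int d + 1)"
      by (simp add: power2_eq_square algebra_simps)
    ultimately show ?thesis using \<open>b = 3\<close> by auto
  qed simp
  have "coprime (2 ^ 3) (3::nat)" unfolding coprime_power_left_iff by simp
  hence "coprime (8::nat) 3" by simp
  hence "coprime (int a) (int b)"
    using coprime_divisors[OF ab(2,3)] by simp
  thus ?thesis
    using a b by (simp add: ab(1) divides_mult)
qed

locale eta_hecke =
  fixes r l :: nat
  assumes r: "r \<le> 24" and l: "l > 0" and rl: "24 dvd r * (l - 1)" and sq: "odd r \<Longrightarrow> is_square l"
begin

text \<open>The smallest translation leaving \<open>\<eta> ^ r\<close> invariant.\<close>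
definition N :: nat where "N = 24 div gcd 24 r"

lemma N_dvd: "N dvd 24" and N_pos: "N > 0"
proof -
  have "24 = N * gcd 24 r" by (simp add: N_def)
  thus "N dvd 24" by (metis dvd_triv_left)
  show "N > 0"
    by (rule ccontr) (use \<open>24 = N * gcd 24 r\<close> in simp)
qed

lemma r_N: "24 dvd r * N"
proof -
  have "24 = N * gcd 24 r" by (simp add: N_def)
  moreover have "gcd 24 r dvd r" by simp
  ultimately show ?thesis by (metis mult.commute mult_dvd_mono dvd_refl)
qed

lemma dvd_r_mult_iff: "24 dvd r * k \<longleftrightarrow> N dvd k"
proof
  define g where "g = gcd 24 r"
  have g: "24 = N * g" "g > 0" by (auto simp: N_def g_def)
  obtain s where s: "r = g * s" by (metis dvdE gcd_dvd2 g_def)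
  have "coprime (24 div g) (r div g)"
    unfolding g_def by (rule div_gcd_coprime) simp
  moreover have "r div g = s" using s g(2) by (metis nonzero_mult_div_cancel_left less_irrefl)
  ultimately have cop: "coprime N s"
    by (simp add: N_def g_def)
  assume "24 dvd r * k"
  moreover have "r * k = g * (s * k)" by (subst s) (simp only: mult_ac)
  ultimately have "g * N dvd g * (s * k)" using g(1) by (metis mult.commute)
  hence "N dvd s * k" using g(2) by simp
  thus "N dvd k" using cop by (simp add: coprime_dvd_mult_right_iff)
next
  assume "N dvd k"
  then obtain j where "k = N * j" ..
  thus "24 dvd r * k" using r_N by (metis dvd_mult2 mult.assoc)
qed

lemma N_dvd_l: "N dvd l - 1"
  using rl dvd_r_mult_iff by blast

lemma coprime_N: "d dvd l \<Longrightarrow> coprime d N"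
proof -
  assume "d dvd l"
  have "coprime N l"
  proof (rule coprimeI)
    fix x assume "x dvd N" "x dvd l"
    have "x dvd l - 1" by (rule dvd_trans[OF \<open>x dvd N\<close> N_dvd_l])
    hence "x dvd l - (l - 1)" using \<open>x dvd l\<close> dvd_diff_nat by blast
    moreover have "l - (l - 1) = 1" using l by (cases l) auto
    ultimately show "is_unit x" by (simp only:)
  qed
  thus ?thesis using \<open>d dvd l\<close> by (metis coprime_commute coprime_divisors dvd_refl)
qed

lemma odd_r_l: "odd r \<Longrightarrow> d dvd l \<Longrightarrow> odd d"
proof
  assume "odd r" "d dvd l" "even d"
  have "8 dvd r * N" using r_N by (rule dvd_trans[rotated]) simp
  moreover have "coprime 8 r" using \<open>odd r\<close> coprime_power_left_iff[of 2 3 r] by simp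
  ultimately have "8 dvd N" by (simp add: coprime_dvd_mult_right_iff)
  hence "even N" by (rule dvd_trans[rotated]) simp
  thus False using coprime_N[OF \<open>d dvd l\<close>] \<open>even d\<close> coprime_not_both_even by blast
qed

text \<open>An even number prime to \<open>N\<close> forces \<open>N\<close> to be odd, and
  \<open>24 dvd r * N\<close> then puts the factor 8 into \<open>r\<close>. So for even
  \<open>c\<close> the eighth power of the multiplier in \<open>eta_char\<close> is enough.\<close>

lemma even_c_r: "even c \<Longrightarrow> coprime c N \<Longrightarrow> 8 dvd r"
proof -
  assume "even c" "coprime c N"
  hence "odd N" using coprime_not_both_even by blast
  hence "coprime 8 N" using coprime_power_left_iff[of 2 3 N] by simp
  moreover have "8 dvd N * r"
    using dvd_trans[OF _ r_N, of 8] by (simp add: mult.commute)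
  ultimately show ?thesis by (simp add: coprime_dvd_mult_right_iff)
qed

text \<open>The \<open>r\<close>-th power of the multiplier for lower row (c, \<delta>) when
  \<open>N\<close> divides both diagonal entries, see \<open>eta_char_power\<close>.\<close>

definition mult_wt :: "int \<Rightarrow> nat \<Rightarrow> complex" where
  "mult_wt \<delta> c = (if even r then (-1) ^ (r * (c - 1) div 4)
     else of_int (jacobi \<delta> c) * cis2 (- of_nat (r * (c - 1)) / 8))"

text \<open>\<open>N\<close> divides every term of the exponent E through \<open>a\<close> or
  \<open>d\<close>, and \<open>24 dvd r * N\<close> makes the phase rE/24 an integer. For odd
  \<open>c\<close> only the contribution of -3c + 3, an eighth root of unity, and the symbol are
  left.\<close>

lemma eta_char_power:
  assumes ch: "eta_char a b c d \<kappa>" and det: "a * d - b * c = 1" and c: "c > 0"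
    and N: "int N dvd a" "int N dvd d"
  shows "\<kappa> ^ r = mult_wt d (nat c)"
proof -
  define E where "E = eta_exponent a b c d"
  have "int N dvd E"
    unfolding E_def eta_exponent_def using N by (intro dvd_diff dvd_mult2 dvd_add dvd_mult) auto
  then obtain e where e: "E = int N * e" ..
  obtain \<rho> where \<rho>: "r * N = 24 * \<rho>" using r_N by blast
  have "int r * E = 24 * (int \<rho> * e)"
    unfolding e using \<rho> by (metis mult.assoc of_nat_mult of_nat_numeral)
  hence "of_int (int r * E) / 24 = (of_int (int \<rho> * e) :: complex)"
    by (simp only: of_int_mult) simp
  hence rE: "cis2 (of_int (int r * E) / 24) = 1"
    by (simp only: cis2_of_int)
  have cop_cd: "coprime d c"
    by (rule coprime_if_det[OF det])
  define c' where "c' = nat c"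
  have c': "c = int c'" "c' > 0" using c by (auto simp: c'_def)
  have cop_N: "coprime c' N"
  proof (rule coprimeI)
    fix x assume x: "x dvd c'" "x dvd N"
    hence "int x dvd c" "int x dvd a" using N c' by (auto intro: dvd_trans)
    hence "int x dvd a * d - b * c" by auto
    thus "is_unit x" unfolding det by simp
  qed
  show ?thesis
  proof (cases "odd c")
    case True
    hence odd: "odd c'" using c' by simp
    define J where "J = jacobi d c'"
    have J: "J * J = 1"
      unfolding J_def using cop_cd c' by (intro jacobi_square) auto
    have "\<kappa> = of_int J * cis2 (of_int (E - 3 * c + 3) / 24)"
      using ch True by (simp add: eta_char_def E_def J_def c'_def)
    hence "\<kappa> ^ r = of_int J ^ r * cis2 (of_nat r * (of_int (E - 3 * c + 3) / 24))"
      by (simp add: power_mult_distrib cis2_power)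
    also have "of_nat r * (of_int (E - 3 * c + 3) / 24) = of_int (int r * E) / 24 + (- of_nat (r * (c' - 1)) / 8 :: complex)"
      using c' by (simp add: field_simps of_nat_diff)
    also have "cis2 \<dots> = cis2 (- of_nat (r * (c' - 1)) / 8)"
      unfolding cis2_add rE by simp
    finally have \<kappa>: "\<kappa> ^ r = of_int J ^ r * cis2 (- of_nat (r * (c' - 1)) / 8)" .
    show ?thesis
    proof (cases "even r")
      case er: True
      then obtain s where s: "r = 2 * s" by (elim evenE)
      from odd obtain m where m: "c' = 2 * m + 1" by (elim oddE)
      have "of_int J ^ r = (1 :: complex)"
        unfolding s power_mult power2_eq_square of_int_mult[symmetric] J by simp
      moreover have "(- of_nat (r * (c' - 1)) / 8 :: complex) = of_int (- int (s * m)) / 2"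
        by (simp add: s m)
      moreover have "cis2 (of_int (- int (s * m)) / 2) = (-1) ^ (s * m)"
        using cis2_half_int[of "- int (s * m)"] by (cases "even (s * m)") simp_all
      moreover have "r * (c' - 1) div 4 = s * m"
        by (simp add: s m)
      ultimately show ?thesis
        using er unfolding \<kappa> mult_wt_def c'_def[symmetric] by (simp only: if_True mult_1_left)
    next
      case False
      then obtain s where s: "r = 2 * s + 1" by (elim oddE)
      have "of_int J ^ r = (of_int J :: complex)"
        unfolding s power_add power_mult power2_eq_square of_int_mult[symmetric] J by simp
      thus ?thesis
        using False unfolding \<kappa> mult_wt_def c'_def[symmetric] J_def by simp
    qed
  next
    case False
    hence "8 dvd r" using even_c_r[of c'] cop_N c' by simp
    then obtain s where s: "r = 8 * s" ..
    have "\<kappa> ^ r = cis2 (of_nat s * (of_int E / 3))"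
      using ch unfolding s power_mult by (simp add: eta_char_def E_def cis2_power)
    also have "of_nat s * (of_int E / 3) = (of_int (int r * E) / 24 :: complex)"
      by (simp add: s)
    also note rE
    finally have "\<kappa> ^ r = 1" .
    moreover have "r * (c' - 1) div 4 = 2 * (s * (c' - 1))"
      by (simp add: s)
    moreover have "even r" using s by simp
    ultimately show ?thesis
      unfolding mult_wt_def c'_def[symmetric] by (simp only: if_True power_mult) simp
  qed
qed

end

lemma mod8_odd_square: "is_square (n::nat) \<Longrightarrow> odd n \<Longrightarrow> n mod 8 = 1"
proof -
  assume "is_square n" "odd n"
  then obtain k where k: "n = k ^ 2" by (elim is_nth_powerE)
  with \<open>odd n\<close> obtain j where j: "k = 2 * j + 1" by (metis even_power oddE pos2)
  have "even (j * (j + 1))" by simp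
  then obtain i where i: "j * (j + 1) = 2 * i" by (elim evenE)
  have "n = 4 * (j * (j + 1)) + 1" by (simp add: k j power2_eq_square algebra_simps)
  thus ?thesis unfolding i by presburger
qed

context eta_hecke
begin

text \<open>
  \<open>diag_wt d * shift_wt (gcd a d) j\<close> is the weight of the matrix with rows \<open>(a, N j)\<close>, \<open>(0, d)\<close>.
  It is forced by \<open>diag_wt 1 = 1\<close> and the relation \<open>wt_relation\<close> below.
\<close>
definition diag_wt :: "nat \<Rightarrow> complex" where
  "diag_wt d = (if even r then (-1) ^ (r * (d - 1) div 4)
     else of_int (jacobi (-1) d) * cis2 (- of_nat (r * (d - 1)) / 8))"

definition shift_wt :: "nat \<Rightarrow> int \<Rightarrow> complex" where
  "shift_wt g x = (if even r then 1 else of_int (jacobi (int N * x) g))"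

lemma wt_relation_even:
  assumes ev: "even r" and ahc: "a * h * c = l"
  shows "diag_wt (h * c) * mult_wt \<delta> c = diag_wt (a * c)"
proof -
  have pos: "a > 0" "h > 0" "c > 0" using ahc l by (auto intro!: gr0I)
  have dvds: "a dvd l" "h dvd l" "c dvd l" "h * c dvd l" "a * c dvd l"
    unfolding ahc[symmetric] by (auto simp: mult_ac)
  define n1 n2 n3 where "n1 = h * c - 1" and "n2 = c - 1" and "n3 = a * c - 1"
  have n: "h * c = n1 + 1" "c = n2 + 1" "a * c = n3 + 1"
    using pos by (simp_all add: n1_def n2_def n3_def)
  obtain s where s: "r = 2 * s" using ev by (elim evenE)
  show ?thesis
  proof (cases "8 dvd r")
    case True
    then obtain t where t: "r = 8 * t" ..
    have "(-1::complex) ^ (r * m div 4) = 1" for m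
    proof -
      have "r * m div 4 = 2 * (t * m)" by (simp add: t)
      thus ?thesis by (simp add: power_mult)
    qed
    thus ?thesis using ev by (simp add: diag_wt_def mult_wt_def)
  next
    case False
    have odd: "odd a" "odd h" "odd c"
      using even_c_r[of a] even_c_r[of h] even_c_r[of c] coprime_N dvds False by blast+
    then obtain A H C where AHC: "a = 2 * A + 1" "h = 2 * H + 1" "c = 2 * C + 1"
      by (metis oddE)
    have e: "r * n1 div 4 = s * (2 * H * C + H + C)" "r * n2 div 4 = s * C" "r * n3 div 4 = s * (2 * A * C + A + C)"
      by (simp_all add: s n1_def n2_def n3_def AHC algebra_simps)
    \<comment> \<open>The signs agree as soon as s(A + H + C) is even. For odd s the hypothesis on
      r(l - 1) gives \<open>4 dvd l - 1\<close>, which amounts to A + H + C being even.\<close>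
    have "even (s * (2 * H * C + H + C) + s * C + s * (2 * A * C + A + C))"
    proof (cases "even s")
      case False
      have "4 dvd l - 1"
      proof -
        have "8 * 3 dvd 2 * s * (l - 1)" using rl s by simp
        hence "8 dvd 2 * s * (l - 1)" by (rule dvd_mult_left)
        hence "4 dvd s * (l - 1)" by (simp add: mult.assoc)
        moreover have "coprime (2 ^ 2) s" unfolding coprime_power_left_iff using False by simp
        hence "coprime 4 s" by simp
        ultimately show ?thesis by (simp add: coprime_dvd_mult_right_iff)
      qed
      moreover have "l - 1 = 8 * (A * H * C) + 4 * (A * H + A * C + H * C) + 2 * (A + H + C)"
        unfolding ahc[symmetric] AHC by (simp add: algebra_simps)
      ultimately have "even (A + H + C)" by presburger
      thus ?thesis by auto
    qed auto
    moreover have "diag_wt (h * c) * mult_wt \<delta> c = (-1) ^ (s * (2 * H * C + H + C) + s * C)"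
         "diag_wt (a * c) = (-1) ^ (s * (2 * A * C + A + C))"
      using ev e by (simp_all add: diag_wt_def mult_wt_def n1_def n2_def n3_def power_add)
    ultimately show ?thesis
      by (simp only: minus_one_power_iff) auto
  qed
qed

text \<open>For odd \<open>r\<close>: as \<open>l\<close> is a square, symbols modulo the gcds can
  be traded for symbols modulo \<open>a\<close>, \<open>h\<close>, \<open>c\<close>. The congruence
  makes Nx and -Nz inverse to each other, so their symbols agree. What remains is reciprocity for
  \<open>a\<close> and \<open>h\<close> against a comparison of eighth roots of unity.\<close>

lemma wt_relation:
  assumes ahc: "a * h * c = l" and cop: "coprime a h" "coprime x c" "coprime z c"
    and xz: "[int N * int x * (int N * int z) = -1] (mod int c)"
  shows "diag_wt (h * c) * shift_wt (gcd a (h * c)) (int (h * x)) * mult_wt (- (int N * int z)) c =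
           diag_wt (a * c) * shift_wt (gcd h (a * c)) (int (a * z))"
proof (cases "even r")
  case True
  thus ?thesis using wt_relation_even[OF True ahc] by (simp add: shift_wt_def)
next
  case False
  have pos: "a > 0" "h > 0" "c > 0" using ahc l by (auto intro!: gr0I)
  have dvds: "a dvd l" "h dvd l" "c dvd l"
    unfolding ahc[symmetric] by (auto simp: mult_ac)
  have odd: "odd a" "odd h" "odd c" using dvds odd_r_l[OF False] by blast+
  have sql: "is_square (a * h * c)" using sq[OF False] ahc by simp
  define g g' where "g = gcd a c" and "g' = gcd h c"
  have g_eq: "gcd a (h * c) = g" "gcd h (a * c) = g'"
    using gcd_mult_left_left_cancel[of a h c] gcd_mult_left_left_cancel[of h a c] cop(1)
    by (simp_all add: g_def g'_def coprime_commute gcd.commute)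
  have gdvd: "g dvd a" "g dvd c" "g' dvd h" "g' dvd c" "g > 0" "g' > 0"
    using pos by (auto simp: g_def g'_def)
  have oddg: "odd g" "odd g'"
    using gdvd odd by (auto dest: dvd_trans)
  have squares: "is_square (a * g)" "is_square (h * g')" "is_square (c * (g * g'))"
    unfolding g_def g'_def using is_square_gcd[OF sql cop(1) pos] by auto
  have copN: "coprime (int N) (int k)" if "k dvd l" for k
    using coprime_N[OF that] by (simp add: coprime_commute)
  define J where "J = jacobi (- (int N * int z))"
  have copNz: "coprime (- (int N * int z)) (int c)"
    using cop(3) copN[OF dvds(3)] by simp
  have copNz': "coprime (- (int N * int z)) (int g)" "coprime (- (int N * int z)) (int g')"
    by (rule coprime_divisors[OF dvd_refl _ copNz]; use gdvd in simp)+
  have Nx: "jacobi (int N * int x) g = J g"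
  proof -
    have "[int N * int x * (int N * int z) = -1] (mod int g)"
      using xz gdvd(2) by (meson cong_dvd_modulus int_dvd_int_iff)
    hence "[- (int N * int x * (int N * int z)) = - (-1)] (mod int g)"
      by (subst cong_minus_minus_iff)
    hence "[int N * int x * - (int N * int z) = 1] (mod int g)"
      by simp
    hence "jacobi (int N * int x) g * J g = 1"
      unfolding J_def using jacobi_cong oddg by (metis jacobi_1_left jacobi_mult_left)
    thus ?thesis
      using jacobi_range[of "int N * int x" g] jacobi_range[of "- (int N * int z)" g] by (auto simp: J_def)
  qed
  have Jprod: "J c * J g * J g' = 1"
    unfolding J_def using squares(3) copNz copNz' pos gdvd
    by (simp add: jacobi_mult_right[symmetric] jacobi_is_square mult.assoc)
  have Jsq: "J g' * J g' = 1"
    unfolding J_def using copNz' gdvd by (intro jacobi_square)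
  have hg: "jacobi (int h) g = jacobi (int h) a"
  proof (rule jacobi_eq_if_square)
    show "coprime (int h) (int a)" using cop(1) by (simp add: coprime_commute)
    thus "coprime (int h) (int g)" by (rule coprime_divisors[OF dvd_refl, rotated]) (use gdvd in simp)
  qed (use squares(1) pos gdvd in \<open>simp_all add: mult.commute\<close>)
  have ag: "jacobi (- int a) g' = jacobi (-1) h * jacobi (int a) h"
  proof -
    have "jacobi (- int a) g' = jacobi (- int a) h"
    proof (rule jacobi_eq_if_square)
      show "coprime (- int a) (int h)" using cop(1) by simp
      thus "coprime (- int a) (int g')" by (rule coprime_divisors[OF dvd_refl, rotated]) (use gdvd in simp)
    qed (use squares(2) pos gdvd in \<open>simp_all add: mult.commute\<close>)
    thus ?thesis using jacobi_mult_left[OF odd(2), of "-1" "int a"] by simp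
  qed
  obtain A H C where AHC: "a = 2 * A + 1" "h = 2 * H + 1" "c = 2 * C + 1"
    using odd by (metis oddE)
  have recip: "jacobi (int h) a * jacobi (int a) h = (if odd A \<and> odd H then -1 else 1)"
  proof -
    have "a mod 4 = 3 \<longleftrightarrow> odd A" "h mod 4 = 3 \<longleftrightarrow> odd H" unfolding AHC by presburger+
    thus ?thesis
      using jacobi_reciprocity[OF odd(2,1)] cop(1) by (auto simp: coprime_commute)
  qed
  have m1: "jacobi (-1) a = (if odd A then -1 else 1)" 
  proof -
    have "a mod 4 = 3 \<longleftrightarrow> odd A" unfolding AHC by presburger
    thus ?thesis using jacobi_minus_1[OF odd(1)] by simp
  qed
  \<comment> \<open>Since l is 1 modulo 8 and squares of odd numbers are too, c is congruent to ah
    modulo 8. The three exponents then differ by r(a - 1)(h + 1) = 4rA(H + 1) modulo 8, which is a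
    sign.\<close>
  have ph: "cis2 (- of_nat (r * (h * c - 1)) / 8) * cis2 (- of_nat (r * (c - 1)) / 8) =
     cis2 (- of_nat (r * (a * c - 1)) / 8) * (if odd (A * (H + 1)) then -1 else 1)"
  proof -
    have "l mod 8 = 1"
      using mod8_odd_square sq[OF False] odd_r_l[OF False] by simp
    hence "(a * h * c) mod 8 = 1" using ahc by simp
    hence ahc8: "a * h * c = 1 + 8 * (a * h * c div 8)" by presburger
    have sq8: "\<exists>i. int n * int n = 1 + 8 * i" if "odd n" for n :: nat
    proof -
      have "is_square (n * n)" by (simp add: is_nth_power_def power2_eq_square) blast
      hence "(n * n) mod 8 = 1" using that by (intro mod8_odd_square) auto
      hence "n * n = 1 + 8 * (n * n div 8)" by presburger
      hence "int (n * n) = 1 + 8 * int (n * n div 8)" by presburger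
      thus ?thesis by auto
    qed
    obtain i j k where ijk: "int a * int a = 1 + 8 * i" "int h * int h = 1 + 8 * j"
        "int (a * h) * int (a * h) = 1 + 8 * k"
      using sq8[OF odd(1)] sq8[OF odd(2)] sq8[of "a * h"] odd by auto
    from ahc8 obtain m where m: "int a * int h * int c = 1 + 8 * m"
      by (metis of_nat_1 of_nat_add of_nat_mult of_nat_numeral)
    have "int c * (1 + 8 * k) = int a * int h * (int a * int h * int c)"
      using ijk(3) by (metis mult.assoc mult.commute of_nat_mult)
    hence c_eq: "int c = int a * int h + 8 * (int a * int h * m - int c * k)"
      unfolding m by (simp add: algebra_simps)
    define w where "w = int a * int h * m - int c * k"
    have c_eq': "int c = int a * int h + 8 * w"
      unfolding w_def by (rule c_eq)
    have "int h * int c + int c - int a * int c - int a * int h - int a + int h =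
        (int h - int a + 1) * int c - int a * int h - int a + int h"
      by (simp add: algebra_simps)
    also have "\<dots> = (int h - int a + 1) * (int a * int h + 8 * w) - int a * int h - int a + int h"
      by (simp only: c_eq')
    also have "\<dots> = int a * (int h * int h) - int h * (int a * int a) - int a + int h + 8 * ((int h - int a + 1) * w)"
      by (simp add: algebra_simps)
    also have "\<dots> = 8 * (int a * j - int h * i + (int h - int a + 1) * w)"
      unfolding ijk by (simp add: algebra_simps)
    finally have w8: "8 dvd int h * int c + int c - int a * int c - int a * int h - int a + int h" by simp
    have AH: "4 * int (A * (H + 1)) = (int a - 1) * (int h + 1)"
      by (simp add: AHC algebra_simps)
    define X Y where "X = - int (r * (a * c - 1))" and "Y = - int r * int (A * (H + 1))"
    have e: "[- int (r * (h * c - 1)) - int (r * (c - 1)) = X + 4 * Y] (mod 8)"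
    proof -
      have "- int (r * (h * c - 1)) - int (r * (c - 1)) - (X + 4 * Y) =
         - int r * (int h * int c + int c - int a * int c - 1 - 4 * int (A * (H + 1)))"
        using pos by (simp add: X_def Y_def of_nat_diff algebra_simps)
      also have "\<dots> = - int r * (int h * int c + int c - int a * int c - int a * int h - int a + int h)"
        unfolding AH by (simp add: algebra_simps)
      finally show ?thesis
        unfolding cong_iff_dvd_diff using w8 by simp
    qed
    have "cis2 (of_int (- int (r * (h * c - 1)) - int (r * (c - 1))) / of_int 8) = cis2 (of_int (X + 4 * Y) / of_int 8)"
      by (intro cis2_cong e) simp
    also have "\<dots> = cis2 (of_int X / 8 + of_int Y / 2)"
      by (simp add: add_divide_distrib)
    also have "\<dots> = cis2 (- of_nat (r * (a * c - 1)) / 8) * (if odd (A * (H + 1)) then -1 else 1)"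
      unfolding cis2_add cis2_half_int using False by (simp add: X_def Y_def)
    also have "cis2 (of_int (- int (r * (h * c - 1)) - int (r * (c - 1))) / of_int 8) =
      cis2 (- of_nat (r * (h * c - 1)) / 8) * cis2 (- of_nat (r * (c - 1)) / 8)"
      by (simp add: cis2_add[symmetric] diff_divide_distrib)
    finally show ?thesis .
  qed
  have key: "jacobi (-1) (h * c) * jacobi (int h) g * (if odd (A * (H + 1)) then -1 else 1) =
     jacobi (-1) (a * c) * jacobi (- int a) g'"
    unfolding hg ag using recip m1 odd pos jacobi_range[of "int h" a] jacobi_range[of "int a" h] jacobi_range[of "-1" h]
      jacobi_square[of h "-1"]
    by (auto simp: jacobi_mult_right split: if_splits)
  define P1 P2 P3 where "P1 = cis2 (- of_nat (r * (h * c - 1)) / 8)" and "P2 = cis2 (- of_nat (r * (c - 1)) / 8)"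
    and "P3 = cis2 (- of_nat (r * (a * c - 1)) / 8)"
  define s :: int where "s = (if odd (A * (H + 1)) then -1 else 1)"
  have "jacobi (int N * int (h * x)) g = jacobi (int h) g * jacobi (int N * int x) g"
    using jacobi_mult_left[OF oddg(1), of "int h" "int N * int x"] by (simp add: mult_ac)
  hence e1: "jacobi (int N * int (h * x)) g = jacobi (int h) g * J g"
    by (simp only: Nx)
  have e2: "jacobi (int N * int (a * z)) g' = jacobi (- int a) g' * J g'"
    using jacobi_mult_left[OF oddg(2), of "- int a" "- (int N * int z)"] by (simp add: J_def mult_ac)
  have JJ: "J c * J g = J g'"
    using Jprod Jsq by (metis mult.assoc mult.commute mult_1)
  have "diag_wt (h * c) * shift_wt (gcd a (h * c)) (int (h * x)) * mult_wt (- (int N * int z)) c =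
      of_int (jacobi (-1) (h * c) * jacobi (int h) g * (J c * J g)) * (P1 * P2)"
    unfolding g_eq diag_wt_def shift_wt_def mult_wt_def if_not_P[OF False] P1_def P2_def e1 J_def[symmetric]
    by simp
  also have "P1 * P2 = P3 * of_int s"
    using ph by (simp add: P1_def P2_def P3_def s_def)
  also have "of_int (jacobi (-1) (h * c) * jacobi (int h) g * (J c * J g)) * (P3 * of_int s) =
     of_int ((jacobi (-1) (h * c) * jacobi (int h) g * s) * (J c * J g)) * P3"
    by (simp add: mult_ac)
  also have "jacobi (-1) (h * c) * jacobi (int h) g * s = jacobi (-1) (a * c) * jacobi (- int a) g'"
    using key by (simp add: s_def)
  also have "of_int ((jacobi (-1) (a * c) * jacobi (- int a) g') * (J c * J g)) * P3 =
    diag_wt (a * c) * shift_wt (gcd h (a * c)) (int (a * z))"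
    unfolding g_eq diag_wt_def shift_wt_def if_not_P[OF False] P3_def e2 JJ by simp
  finally show ?thesis .
qed

text \<open>
  \<open>(a, h, c, x)\<close> stands for the primitive upper triangular matrix with rows \<open>(a, N h x)\<close> and
  \<open>(0, h c)\<close>. Here \<open>h = gcd (h x) (h c)\<close>; with this choice \<open>\<tau> \<mapsto> -1/\<tau>\<close> just exchanges \<open>a\<close> and \<open>h\<close>
  and replaces \<open>x\<close> by an inverse of \<open>- N\<^sup>2 x\<close> modulo \<open>c\<close>.
\<close>
definition mats :: "(nat \<times> nat \<times> nat \<times> nat) set" where
  "mats = {(a, h, c, x). a * h * c = l \<and> coprime a h \<and> x < c \<and> coprime x c}"

text \<open>The power of sqrt a is the normalisation of weight r/2; inversion contributes sqrt (h/a)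
  and turns it into the one belonging to the image matrix.\<close>

definition mat_term :: "complex \<Rightarrow> nat \<times> nat \<times> nat \<times> nat \<Rightarrow> complex" where
  "mat_term \<tau> = (\<lambda>(a, h, c, x). of_real (sqrt (real a)) ^ r *
     (diag_wt (h * c) * shift_wt (gcd a (h * c)) (int (h * x))) *
     dedekind_eta ((of_nat a * \<tau> + of_nat (N * h * x)) / of_nat (h * c)) ^ r)"

definition hecke_eta :: "complex \<Rightarrow> complex" where
  "hecke_eta \<tau> = sum (mat_term \<tau>) mats"

definition dual :: "nat \<Rightarrow> nat \<Rightarrow> nat" where
  "dual c x = (SOME z. z < c \<and> [int N * int x * (int N * int z) = -1] (mod int c))"

lemma
  assumes "c dvd l" "coprime x c"
  shows dual_less: "dual c x < c"
    and dual_cong: "[int N * int x * (int N * int (dual c x)) = -1] (mod int c)"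
proof -
  have c: "c > 0" using assms(1) l by (auto intro!: gr0I)
  have "coprime (int N * int x * int N) (int c)"
    using assms(2) coprime_N[OF assms(1)] by (simp add: coprime_commute)
  then obtain y where y: "[int N * int x * int N * y = 1] (mod int c)"
    using cong_solve_coprime_int by blast
  define z where "z = nat ((- y) mod int c)"
  have z: "z < c" "int z = (- y) mod int c"
    using c by (auto simp: z_def nat_less_iff)
  have "[int N * int x * int N * int z = int N * int x * int N * (- y)] (mod int c)"
    unfolding z by (intro cong_mult[OF cong_refl]) (simp add: cong_def)
  also have "int N * int x * int N * (- y) = - (int N * int x * int N * y)"
    by simp
  also have "[\<dots> = - 1] (mod int c)"
    using y by (subst cong_minus_minus_iff)
  finally have "z < c \<and> [int N * int x * (int N * int z) = -1] (mod int c)"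
    using z(1) by (simp add: mult.assoc)
  hence "dual c x < c \<and> [int N * int x * (int N * int (dual c x)) = -1] (mod int c)"
    unfolding dual_def by (rule someI)
  thus "dual c x < c" "[int N * int x * (int N * int (dual c x)) = -1] (mod int c)" by auto
qed

lemma coprime_if_cong_minus_1:
  assumes "[u * int z = -1] (mod int c)"
  shows "coprime z c"
proof (rule coprimeI)
  fix p assume p: "p dvd z" "p dvd c"
  have "int p dvd u * int z - (-1)"
    using assms p(2) by (meson cong_iff_dvd_diff dvd_trans int_dvd_int_iff)
  moreover have "int p dvd u * int z" using p(1) by simp
  ultimately have "int p dvd (u * int z - (-1)) - u * int z" by (rule dvd_diff)
  thus "is_unit p" by simp
qed

lemma coprime_dual:
  assumes "c dvd l" "coprime x c"
  shows "coprime (dual c x) c"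
  using dual_cong[OF assms] by (intro coprime_if_cong_minus_1[of "int N * int x * int N"]) (simp add: mult.assoc)

lemma dual_dual:
  assumes "c dvd l" "coprime x c" "x < c"
  shows "dual c (dual c x) = x"
proof -
  define z where "z = dual c x"
  have z: "coprime z c" unfolding z_def by (rule coprime_dual[OF assms(1,2)])
  have "[int N * int z * (int N * int x) = -1] (mod int c)"
    using dual_cong[OF assms(1,2)] unfolding z_def by (simp only: mult_ac)
  hence "[int N * int z * (int N * int (dual c z)) = int N * int z * (int N * int x)] (mod int c)"
    using dual_cong[OF assms(1) z] by (metis cong_sym cong_trans)
  hence "[(int N * int z * int N) * int (dual c z) = (int N * int z * int N) * int x] (mod int c)"
    by (simp only: mult_ac)
  moreover have "coprime (int N * int z * int N) (int c)"
    using z coprime_N[OF assms(1)] by (simp add: coprime_commute)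
  ultimately have "[int (dual c z) = int x] (mod int c)"
    by (simp only: cong_mult_lcancel)
  hence "[dual c z = x] (mod c)" by (simp only: cong_int_iff)
  hence "dual c z mod c = x mod c" by (simp only: cong_def)
  thus ?thesis
    using assms(3) dual_less[OF assms(1) z] unfolding z_def by simp
qed

lemma csqrt_of_real_mult:
  assumes "x > 0" "Re z > 0"
  shows "csqrt (of_real x * z) = of_real (sqrt x) * csqrt z"
proof (rule square_eq_Re_pos)
  have "Re (csqrt z) > 0"
    using csqrt_Re_gt[OF assms(2)] by linarith
  thus "Re (of_real (sqrt x) * csqrt z) > 0" using assms(1) by simp
  have "\<bar>Im (csqrt (of_real x * z))\<bar> < Re (csqrt (of_real x * z))"
    using assms by (intro csqrt_Re_gt) simp
  thus "Re (csqrt (of_real x * z)) > 0" by linarith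
  show "(csqrt (of_real x * z))\<^sup>2 = (of_real (sqrt x) * csqrt z)\<^sup>2"
    using assms by (simp add: power_mult_distrib of_real_power[symmetric] del: of_real_power)
qed

text \<open>The matrix with rows (a, Nhx), (0, hc), followed on the right by \<tau> \<mapsto>
  -1/\<tau>, equals a modular matrix times the one with rows (h, Naz), (0, ac). The multiplier of
  the modular matrix is absorbed by \<open>wt_relation\<close>.\<close>

lemma mat_term_inversion:
  assumes m: "(a, h, c, x) \<in> mats" and \<tau>: "Im \<tau> > 0"
  shows "mat_term (-1/\<tau>) (a, h, c, x) = csqrt (-\<i> * \<tau>) ^ r * mat_term \<tau> (h, a, c, dual c x)"
proof -
  define z where "z = dual c x"
  have ahc: "a * h * c = l" and cop: "coprime a h" "coprime x c" and x: "x < c"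
    using m by (auto simp: mats_def)
  have c: "c dvd l" using ahc by auto
  have pos: "a > 0" "h > 0" "c > 0" using ahc l by (auto intro!: gr0I)
  have copz: "coprime z c" unfolding z_def by (rule coprime_dual[OF c cop(2)])
  have xz: "[int N * int x * (int N * int z) = -1] (mod int c)"
    unfolding z_def by (rule dual_cong[OF c cop(2)])
  hence "int c dvd int N * int x * (int N * int z) - (-1)" by (simp only: cong_iff_dvd_diff)
  then obtain k where k: "int N * int x * (int N * int z) - (-1) = int c * k" ..
  \<comment> \<open>The congruence for z provides the entry \<beta> that makes the determinant 1;
    both diagonal entries are multiples of \<open>N\<close>, as \<open>eta_char_power\<close>
    requires.\<close>
  define \<alpha> \<beta> \<delta> where "\<alpha> = int N * int x" and "\<beta> = - k" and "\<delta> = - (int N * int z)"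
  have det: "\<alpha> * \<delta> - \<beta> * int c = 1"
    using k by (simp add: \<alpha>_def \<beta>_def \<delta>_def algebra_simps)
  obtain \<kappa> where \<kappa>: "eta_char \<alpha> \<beta> (int c) \<delta> \<kappa>"
    using eta_char_exists[OF det] pos by auto
  have \<kappa>r: "\<kappa> ^ r = mult_wt \<delta> c"
    using eta_char_power[OF \<kappa> det] pos by (simp add: \<alpha>_def \<delta>_def)
  define w where "w = (of_nat h * \<tau> + of_nat (N * a * z)) / of_nat (a * c)"
  have nz: "\<tau> \<noteq> 0" using \<tau> by auto
  have imw: "Im w > 0"
  proof -
    have "w = of_real (real h / real (a * c)) * \<tau> + of_real (real (N * a * z) / real (a * c))"
      by (simp add: w_def add_divide_distrib)
    hence "Im w = real h / real (a * c) * Im \<tau>" by (simp only: Im_complex_of_real) simp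
    thus ?thesis using pos \<tau> by simp
  qed
  have den: "of_int (int c) * w + of_int \<delta> = of_real (real h / real a) * \<tau>"
    using pos by (simp add: w_def \<delta>_def field_simps)
  have num: "of_int \<alpha> * w + of_int \<beta> = (of_int \<alpha> * (of_real (real h / real a) * \<tau>) - 1) / of_nat c"
  proof -
    have "of_nat c * (of_int \<alpha> * w + of_int \<beta>) = of_int \<alpha> * (of_int (int c) * w + of_int \<delta>) - of_int (\<alpha> * \<delta> - \<beta> * int c)"
      by (simp add: algebra_simps)
    also have "\<dots> = of_int \<alpha> * (of_real (real h / real a) * \<tau>) - 1"
      unfolding den det by simp
    finally show ?thesis using pos by (simp add: field_simps)
  qed
  have arg: "(of_nat a * (-1/\<tau>) + of_nat (N * h * x)) / of_nat (h * c) =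
      (of_int \<alpha> * w + of_int \<beta>) / (of_int (int c) * w + of_int \<delta>)"
    unfolding num den using pos nz by (simp add: \<alpha>_def field_simps)
  have "eta_mult \<alpha> \<beta> (int c) \<delta> \<kappa>" using \<kappa> by (simp only: eta_char_def)
  hence e: "dedekind_eta ((of_int \<alpha> * w + of_int \<beta>) / (of_int (int c) * w + of_int \<delta>)) =
      \<kappa> * csqrt (-\<i> * (of_int (int c) * w + of_int \<delta>)) * dedekind_eta w"
    unfolding eta_mult_def using imw by blast
  have "dedekind_eta ((of_nat a * (-1/\<tau>) + of_nat (N * h * x)) / of_nat (h * c)) =
      \<kappa> * csqrt (-\<i> * (of_real (real h / real a) * \<tau>)) * dedekind_eta w"
    unfolding arg e unfolding den ..
  also have "csqrt (-\<i> * (of_real (real h / real a) * \<tau>)) = of_real (sqrt (real h / real a)) * csqrt (-\<i> * \<tau>)"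
    using csqrt_of_real_mult[of "real h / real a" "-\<i> * \<tau>"] pos \<tau> by (simp add: mult_ac)
  finally have eta: "dedekind_eta ((of_nat a * (-1/\<tau>) + of_nat (N * h * x)) / of_nat (h * c)) =
      \<kappa> * (of_real (sqrt (real h / real a)) * csqrt (-\<i> * \<tau>)) * dedekind_eta w" .
  have sqrt: "of_real (sqrt (real a)) * of_real (sqrt (real h / real a)) = (of_real (sqrt (real h)) :: complex)"
    using pos by (simp add: of_real_mult[symmetric] real_sqrt_mult[symmetric] del: of_real_mult)
  have "mat_term (-1/\<tau>) (a, h, c, x) =
     (of_real (sqrt (real a)) * of_real (sqrt (real h / real a))) ^ r *
     (diag_wt (h * c) * shift_wt (gcd a (h * c)) (int (h * x)) * \<kappa> ^ r) * csqrt (-\<i> * \<tau>) ^ r * dedekind_eta w ^ r"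
    unfolding mat_term_def prod.case eta by (simp only: power_mult_distrib mult_ac)
  also have "diag_wt (h * c) * shift_wt (gcd a (h * c)) (int (h * x)) * \<kappa> ^ r =
      diag_wt (a * c) * shift_wt (gcd h (a * c)) (int (a * z))"
    unfolding \<kappa>r \<delta>_def by (rule wt_relation[OF ahc cop copz xz])
  finally show ?thesis
    unfolding sqrt mat_term_def prod.case z_def[symmetric] w_def by (simp only: mult_ac)
qed

theorem hecke_eta_inversion:
  assumes "Im \<tau> > 0"
  shows "hecke_eta (-1/\<tau>) = csqrt (-\<i> * \<tau>) ^ r * hecke_eta \<tau>"
proof -
  define \<phi> where "\<phi> = (\<lambda>(a, h, c, x). (h, a, c, dual c x) :: nat \<times> nat \<times> nat \<times> nat)"
  have \<phi>: "\<phi> m \<in> mats" "\<phi> (\<phi> m) = m" if "m \<in> mats" for m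
  proof -
    obtain a h c x where m: "m = (a, h, c, x)" by (cases m) auto
    have mm: "a * h * c = l" "coprime a h" "x < c" "coprime x c" "h * a * c = l" "coprime h a"
      using that by (auto simp: m mats_def coprime_commute mult_ac)
    hence "c dvd l" by auto
    with mm show "\<phi> m \<in> mats" "\<phi> (\<phi> m) = m"
      by (simp_all add: m \<phi>_def mats_def dual_less coprime_dual dual_dual)
  qed
  have "hecke_eta (-1/\<tau>) = (\<Sum>m\<in>mats. csqrt (-\<i> * \<tau>) ^ r * mat_term \<tau> (\<phi> m))"
    unfolding hecke_eta_def
  proof (intro sum.cong refl)
    fix m assume "m \<in> mats"
    thus "mat_term (-1/\<tau>) m = csqrt (-\<i> * \<tau>) ^ r * mat_term \<tau> (\<phi> m)"
      using mat_term_inversion[OF _ assms] by (cases m) (simp add: \<phi>_def)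
  qed
  also have "\<dots> = csqrt (-\<i> * \<tau>) ^ r * (\<Sum>m\<in>mats. mat_term \<tau> (\<phi> m))"
    by (rule sum_distrib_left[symmetric])
  also have "(\<Sum>m\<in>mats. mat_term \<tau> (\<phi> m)) = hecke_eta \<tau>"
    unfolding hecke_eta_def
    by (rule sum.reindex_bij_witness[of _ \<phi> \<phi>]) (auto simp: \<phi>)
  finally show ?thesis .
qed

end

section \<open>Fourier expansion\<close>

lemma has_sum_sum:
  fixes f :: "'a \<Rightarrow> 'b \<Rightarrow> complex"
  assumes "\<And>i. i \<in> I \<Longrightarrow> (f i has_sum S i) A"
  shows "((\<lambda>x. \<Sum>i\<in>I. f i x) has_sum (\<Sum>i\<in>I. S i)) A"
  using assms by (induction I rule: infinite_finite_induct) (auto intro: has_sum_add)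

text \<open>Equality is asked only on the punctured disc because \<open>cis2 \<tau>\<close> never
  takes the value 0. Continuity of the difference at the origin closes the gap.\<close>

lemma powser_unique:
  fixes a b :: "nat \<Rightarrow> complex"
  assumes "\<And>z. z \<noteq> 0 \<Longrightarrow> norm z < 1 \<Longrightarrow> (\<lambda>n. a n * z ^ n) sums f z"
    and "\<And>z. z \<noteq> 0 \<Longrightarrow> norm z < 1 \<Longrightarrow> (\<lambda>n. b n * z ^ n) sums f z"
  shows "a = b"
proof -
  define A :: "complex fps" where "A = Abs_fps (\<lambda>n. a n - b n)"
  have sums0: "(\<lambda>n. fps_nth A n * z ^ n) sums 0" if z: "z \<noteq> 0" "norm z < 1" for z
    using sums_diff[OF assms(1)[OF z] assms(2)[OF z]] by (simp add: A_def algebra_simps)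
  have "fps_conv_radius A \<ge> ereal (norm (1/2 :: complex))"
    unfolding fps_conv_radius_def
    by (rule conv_radius_geI) (use sums0[of "1/2"] in \<open>auto simp: sums_iff\<close>)
  hence rad: "fps_conv_radius A > 0"
    by (rule less_le_trans[rotated]) auto
  have ev: "eventually (\<lambda>z. eval_fps A z = 0) (at 0)"
  proof -
    have "eventually (\<lambda>z::complex. z \<in> ball 0 1 - {0}) (at 0)"
      by (rule eventually_at_in_open) auto
    thus ?thesis
      by eventually_elim (use sums0 in \<open>auto simp: eval_fps_def sums_iff\<close>)
  qed
  have "isCont (eval_fps A) 0"
    using rad by (intro continuous_eval_fps) (simp_all add: zero_ereal_def)
  hence "(eval_fps A \<longlongrightarrow> eval_fps A 0) (at 0)"
    by (simp add: isCont_def)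
  moreover have "(eval_fps A \<longlongrightarrow> 0) (at 0)"
    using ev by (rule tendsto_eventually)
  ultimately have "eval_fps A 0 = 0"
    by (rule LIM_unique)
  with ev have "eventually (\<lambda>z. eval_fps A z = 0) (nhds 0)"
    by (simp add: eventually_nhds_conv_at)
  hence "eval_fps A has_fps_expansion 0"
    by (simp add: has_fps_expansion_0_iff)
  moreover have "eval_fps A has_fps_expansion A"
    using rad by (simp add: has_fps_expansion_def)
  ultimately have "fps_nth A n = 0" for n
    using fps_nth_fps_expansion[of "eval_fps A" A] fps_nth_fps_expansion[of "eval_fps A" 0] by simp
  thus ?thesis
    by (auto simp: A_def fun_eq_iff)
qed

lemma eta_power_coeff_sums:
  assumes z: "norm z < 1"
  shows "(\<lambda>n. of_int (eta_power_coeff r n) * z ^ n) sums (euler_prod z ^ r)"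
proof -
  define c where "c = (\<lambda>n. (deriv ^^ n) (\<lambda>z. euler_prod z ^ r) 0 / fact n)"
  have c: "(\<lambda>n. c n * z ^ n) sums (euler_prod z ^ r)" if "norm z < 1" for z
    using holomorphic_power_series[of "\<lambda>z. euler_prod z ^ r" 0 1 z] that
    by (auto simp: c_def intro!: holomorphic_intros holomorphic_euler_prod)
  have "is_eta_power_expansion r (eta_power_coeff r)"
    using eta_power_coeff_eq_iff by blast
  hence "(\<lambda>n. of_int (eta_power_coeff r n) * z ^ n) sums (euler_prod z ^ r)"
    if z: "z \<noteq> 0" "norm z < 1" for z
  proof -
    obtain \<tau> where \<tau>: "Im \<tau> > 0" "qpow 1 \<tau> = z"
      using qpow_1_surj[OF z] .
    thus ?thesis
      using \<open>is_eta_power_expansion _ _\<close>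
      by (auto simp: is_eta_power_expansion_def dedekind_eta_power sums_iff qpow_nonzero)
  qed
  hence "(\<lambda>n. of_int (eta_power_coeff r n)) = c"
    by (rule powser_unique) (use c in auto)
  thus ?thesis using c[OF z] by (simp add: fun_eq_iff)
qed

lemma eta_power_coeff_0: "eta_power_coeff r 0 = 1"
proof -
  have "euler_prod 0 = 1"
    by (simp add: euler_prod_def)
  hence "(\<lambda>n. of_int (eta_power_coeff r n) * (0::complex) ^ n) sums 1"
    using eta_power_coeff_sums[of 0 r] by simp
  hence "of_int (eta_power_coeff r 0) = (1 :: complex)"
    by (simp add: sums_iff)
  thus ?thesis by (simp only: of_int_eq_1_iff)
qed

text \<open>Unconditional convergence is recorded because the terms are re-indexed later, in
  \<open>coeff_at_has_sum\<close>.\<close>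

lemma dedekind_eta_power_has_sum:
  assumes "Im \<tau> > 0"
  shows "((\<lambda>k. of_int (eta_power_coeff r k) * cis2 (of_nat (24 * k + r) * \<tau> / 24)) has_sum dedekind_eta \<tau> ^ r) UNIV"
proof -
  define q where "q = cis2 \<tau>"
  have q: "norm q < 1" using assms by (simp add: q_def norm_cis2_less_1)
  \<comment> \<open>Convergence at a point of modulus strictly between |q| and 1 yields absolute
    convergence at \<open>q\<close>.\<close>
  define x where "x = (norm q + 1) / 2"
  have "norm q < norm (of_real x :: complex)" "norm (of_real x :: complex) < 1"
    using q norm_ge_zero[of q] unfolding norm_of_real x_def by (simp_all add: field_simps)
  hence "summable (\<lambda>n. norm (of_int (eta_power_coeff r n) * q ^ n))"
    using powser_insidea[OF sums_summable[OF eta_power_coeff_sums[of "of_real x" r]], of q] by blast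
  hence "((\<lambda>n. of_int (eta_power_coeff r n) * q ^ n) has_sum (euler_prod q ^ r)) UNIV"
    using eta_power_coeff_sums[OF q, of r] by (rule norm_summable_imp_has_sum)
  hence "((\<lambda>n. cis2 (of_nat r * \<tau> / 24) * (of_int (eta_power_coeff r n) * q ^ n)) has_sum
      (cis2 (of_nat r * \<tau> / 24) * euler_prod q ^ r)) UNIV"
    by (rule has_sum_cmult_right)
  also have "cis2 (of_nat r * \<tau> / 24) * euler_prod q ^ r = dedekind_eta \<tau> ^ r"
    by (simp add: dedekind_eta_altdef q_def power_mult_distrib cis2_power)
  also have "(\<lambda>n. cis2 (of_nat r * \<tau> / 24) * (of_int (eta_power_coeff r n) * q ^ n)) =
      (\<lambda>k. of_int (eta_power_coeff r k) * cis2 (of_nat (24 * k + r) * \<tau> / 24))"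
  proof
    fix k
    have "of_nat (24 * k + r) * \<tau> / 24 = of_nat r * \<tau> / 24 + of_nat k * \<tau>"
      by (simp add: field_simps)
    thus "cis2 (of_nat r * \<tau> / 24) * (of_int (eta_power_coeff r k) * q ^ k) =
        of_int (eta_power_coeff r k) * cis2 (of_nat (24 * k + r) * \<tau> / 24)"
      by (simp only: cis2_add) (simp add: q_def cis2_power)
  qed
  finally show ?thesis .
qed

context eta_hecke
begin

text \<open>As \<open>N\<close> is prime to \<open>l\<close>, the matrix with rows (a, Nj), (0, d)
  is primitive just if j is prime to gcd(a, d).\<close>

definition shifts :: "nat \<Rightarrow> nat set" where
  "shifts a = {j. j < l div a \<and> coprime j (gcd a (l div a))}"

lemma finite_shifts: "finite (shifts a)"
  by (rule finite_subset[of _ "{..<l div a}"]) (auto simp: shifts_def)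

text \<open>The description by (a, h, c, x) suits inversion, that by (a, j) the Fourier expansion.
  They correspond through j = hx with h = gcd(j, d).\<close>

lemma hecke_eta_eq:
  "hecke_eta \<tau> = (\<Sum>a | a dvd l. of_real (sqrt (real a)) ^ r * (\<Sum>j\<in>shifts a.
     diag_wt (l div a) * shift_wt (gcd a (l div a)) (int j) *
     dedekind_eta ((of_nat a * \<tau> + of_nat (N * j)) / of_nat (l div a)) ^ r))"
proof -
  define T where "T = (\<lambda>a j. of_real (sqrt (real a)) ^ r * (diag_wt (l div a) * shift_wt (gcd a (l div a)) (int j) *
     dedekind_eta ((of_nat a * \<tau> + of_nat (N * j)) / of_nat (l div a)) ^ r))"
  define f where "f = ((\<lambda>(a, h, c, x). (a, h * x)) :: nat \<times> nat \<times> nat \<times> nat \<Rightarrow> nat \<times> nat)"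
  define f' where "f' = (\<lambda>(a, j). let d = l div a; h = gcd j d in (a, h, d div h, j div h) :: nat \<times> nat \<times> nat \<times> nat)"
  have "hecke_eta \<tau> = (\<Sum>(a, j)\<in>Sigma {a. a dvd l} shifts. T a j)"
    unfolding hecke_eta_def
  proof (rule sum.reindex_bij_witness[of _ f' f])
    fix m assume m: "m \<in> mats"
    obtain a h c x where mm: "m = (a, h, c, x)" by (cases m) auto
    have ahc: "a * h * c = l" and cop: "coprime a h" "coprime x c" and x: "x < c"
      using m by (auto simp: mats_def mm)
    have pos: "a > 0" "h > 0" "c > 0" using ahc l by (auto intro!: gr0I)
    have d: "l div a = h * c" using ahc pos by (metis mult.assoc nonzero_mult_div_cancel_left less_irrefl)
    have "gcd (h * x) (h * c) = h"
      using cop(2) by (simp add: gcd_mult_distrib_nat[symmetric])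
    thus "f' (f m) = m"
      using pos by (simp add: f_def f'_def mm d Let_def)
    have "coprime (h * x) (gcd a (h * c))"
    proof (rule coprimeI)
      fix p assume p: "p dvd h * x" "p dvd gcd a (h * c)"
      hence pa: "p dvd a" "p dvd h * c" by auto
      have "coprime p h" using coprime_divisors[OF pa(1) dvd_refl cop(1)] .
      hence "p dvd x" "p dvd c" using p(1) pa(2) by (simp_all add: coprime_dvd_mult_right_iff)
      thus "is_unit p" using cop(2) by (meson coprime_common_divisor)
    qed
    thus "f m \<in> Sigma {a. a dvd l} shifts"
      using pos x ahc by (auto simp: f_def mm shifts_def d)
    show "(case f m of (a, j) \<Rightarrow> T a j) = mat_term \<tau> m"
      by (simp add: f_def mm T_def mat_term_def d mult_ac)
  next
    fix v assume v: "v \<in> Sigma {a. a dvd l} shifts"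
    obtain a j where vv: "v = (a, j)" by (cases v)
    define d h where "d = l div a" and "h = gcd j d"
    have a: "a dvd l" and j: "j < d" "coprime j (gcd a d)"
      using v by (auto simp: vv shifts_def d_def)
    have ad: "a * d = l" using a by (simp add: d_def)
    have h: "h > 0" "h dvd j" "h dvd d" using j by (auto simp: h_def)
    obtain c where c: "d = h * c" using h(3) ..
    obtain x where x: "j = h * x" using h(2) ..
    note cx = c x
    have gcd_h: "gcd (h * x) (h * c) = h"
      unfolding cx[symmetric] unfolding h_def ..
    hence "h * gcd x c = h" by (simp only: gcd_mult_distrib_nat)
    hence "gcd x c = 1" using h(1) by simp
    hence "coprime x c" by (simp only: coprime_iff_gcd_eq_1)
    moreover have "coprime a h"
    proof (rule coprimeI)
      fix p assume "p dvd a" "p dvd h"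
      hence "p dvd j" "p dvd gcd a d" using h by (auto intro: dvd_trans)
      thus "is_unit p" using j(2) by (meson coprime_common_divisor)
    qed
    moreover have "x < c" using j(1) h(1) by (simp add: cx)
    moreover have f': "f' v = (a, h, c, x)"
      using h(1) cx gcd_h by (simp add: f'_def vv d_def[symmetric] h_def[symmetric] Let_def)
    ultimately show "f' v \<in> mats" using ad cx by (simp add: mats_def mult_ac)
    show "f (f' v) = v" unfolding f' by (simp add: f_def vv cx)
  qed
  also have "\<dots> = (\<Sum>a | a dvd l. \<Sum>j\<in>shifts a. T a j)"
    using l by (intro sum.Sigma[symmetric]) (auto simp: finite_shifts)
  finally show ?thesis
    by (simp add: T_def sum_distrib_left)
qed

definition shift_sum :: "nat \<Rightarrow> nat \<Rightarrow> complex" where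
  "shift_sum a k = diag_wt (l div a) * (\<Sum>j\<in>shifts a. shift_wt (gcd a (l div a)) (int j) *
     cis2 (of_nat (24 * k + r) * of_nat (N * j) / (24 * of_nat (l div a))))"

lemma shift_sum_has_sum:
  assumes a: "a dvd l" and \<tau>: "Im \<tau> > 0"
  shows "((\<lambda>k. of_int (eta_power_coeff r k) * shift_sum a k * cis2 (of_nat (24 * k + r) * of_nat a * \<tau> / (24 * of_nat (l div a))))
     has_sum (\<Sum>j\<in>shifts a. diag_wt (l div a) * shift_wt (gcd a (l div a)) (int j) *
     dedekind_eta ((of_nat a * \<tau> + of_nat (N * j)) / of_nat (l div a)) ^ r)) UNIV"
proof -
  define d where "d = l div a"
  have pos: "a > 0" "d > 0" using a l by (auto simp: d_def dvd_div_eq_0_iff intro!: gr0I)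
  have "((\<lambda>k. \<Sum>j\<in>shifts a. diag_wt d * shift_wt (gcd a d) (int j) *
      (of_int (eta_power_coeff r k) * cis2 (of_nat (24 * k + r) * ((of_nat a * \<tau> + of_nat (N * j)) / of_nat d) / 24)))
      has_sum (\<Sum>j\<in>shifts a. diag_wt d * shift_wt (gcd a d) (int j) *
        dedekind_eta ((of_nat a * \<tau> + of_nat (N * j)) / of_nat d) ^ r)) UNIV"
  proof (intro has_sum_sum has_sum_cmult_right dedekind_eta_power_has_sum)
    fix j
    have "(of_nat a * \<tau> + of_nat (N * j)) / of_nat d = of_real (real a / real d) * \<tau> + of_real (real (N * j) / real d)"
      by (simp add: add_divide_distrib)
    hence "Im ((of_nat a * \<tau> + of_nat (N * j)) / of_nat d) = real a / real d * Im \<tau>"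
      by (simp only: plus_complex.sel Im_complex_of_real times_complex.sel Re_complex_of_real mult_zero_left add_0_right)
    thus "Im ((of_nat a * \<tau> + of_nat (N * j)) / of_nat d) > 0"
      using pos \<tau> by simp
  qed
  also have "(\<lambda>k. \<Sum>j\<in>shifts a. diag_wt d * shift_wt (gcd a d) (int j) *
      (of_int (eta_power_coeff r k) * cis2 (of_nat (24 * k + r) * ((of_nat a * \<tau> + of_nat (N * j)) / of_nat d) / 24))) =
    (\<lambda>k. of_int (eta_power_coeff r k) * shift_sum a k * cis2 (of_nat (24 * k + r) * of_nat a * \<tau> / (24 * of_nat d)))"
  proof
    fix k
    have "of_nat (24 * k + r) * ((of_nat a * \<tau> + of_nat (N * j)) / of_nat d) / 24 =
       of_nat (24 * k + r) * of_nat a * \<tau> / (24 * of_nat d) + of_nat (24 * k + r) * of_nat (N * j) / (24 * of_nat d)" for j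
      using pos by (simp add: field_simps)
    thus "(\<Sum>j\<in>shifts a. diag_wt d * shift_wt (gcd a d) (int j) *
      (of_int (eta_power_coeff r k) * cis2 (of_nat (24 * k + r) * ((of_nat a * \<tau> + of_nat (N * j)) / of_nat d) / 24))) =
      of_int (eta_power_coeff r k) * shift_sum a k * cis2 (of_nat (24 * k + r) * of_nat a * \<tau> / (24 * of_nat d))"
      unfolding shift_sum_def d_def[symmetric] sum_distrib_left sum_distrib_right
      by (simp only: cis2_add mult_ac)
  qed
  finally show ?thesis unfolding d_def .
qed

end

section \<open>Moebius sums and radicals\<close>

lemma prime_factorization_prod_primes:
  fixes S :: "nat set"
  assumes "finite S" "\<And>p. p \<in> S \<Longrightarrow> prime p"
  shows "prime_factorization (\<Prod>S) = mset_set S"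
  using assms
proof (induction S rule: finite_induct)
  case (insert p S)
  moreover have "0 \<notin> S" "p \<noteq> 0" using insert.prems[of 0] insert.prems[of p] by auto
  ultimately have "prime_factorization (p * \<Prod>S) = prime_factorization p + prime_factorization (\<Prod>S)"
    by (intro prime_factorization_mult) auto
  thus ?case using insert by (simp add: prime_factorization_prime)
qed auto

lemma
  fixes S :: "nat set"
  assumes S: "finite S" "\<And>p. p \<in> S \<Longrightarrow> prime p"
  shows prod_primes_nonzero: "\<Prod>S \<noteq> 0"
    and prime_factors_prod_primes: "prime_factors (\<Prod>S) = S"
    and squarefree_prod_primes: "squarefree (\<Prod>S)"
proof -
  show nz: "\<Prod>S \<noteq> 0" using S(1) S(2)[of 0] by auto
  show "prime_factors (\<Prod>S) = S"
    using S by (simp add: prime_factorization_prod_primes)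
  have "multiplicity p (\<Prod>S) \<le> 1" if "prime p" for p
  proof -
    have "multiplicity p (\<Prod>S) = count (mset_set S) p"
      using that S by (simp add: prime_factorization_prod_primes[symmetric] count_prime_factorization_prime)
    also have "\<dots> \<le> 1" using S by (simp add: count_mset_set')
    finally show ?thesis .
  qed
  thus "squarefree (\<Prod>S)"
    unfolding squarefree_factorial_semiring''[OF nz] by simp
qed

lemma squarefree_eq_prod_primes:
  fixes t :: nat
  assumes "squarefree t"
  shows "\<Prod>(prime_factors t) = t"
proof -
  have t: "t \<noteq> 0" using assms by (metis not_squarefree_0)
  have "t = (\<Prod>p\<in>prime_factors t. p ^ multiplicity p t)"
    using prime_factorization_nat t by simp
  also have "\<dots> = (\<Prod>p\<in>prime_factors t. p)"
  proof (intro prod.cong refl)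
    fix p assume p: "p \<in> prime_factors t"
    hence "multiplicity p t > 0" "multiplicity p t \<le> 1"
      using assms t by (auto simp: squarefree_factorial_semiring'' prime_factors_multiplicity)
    thus "p ^ multiplicity p t = p" by (simp add: le_Suc_eq)
  qed
  finally show ?thesis by simp
qed

lemma prod_prime_factors_dvd:
  fixes n :: nat
  assumes "n > 0"
  shows "\<Prod>(prime_factors n) dvd n"
proof -
  have P: "finite (prime_factors n)" "\<And>p. p \<in> prime_factors n \<Longrightarrow> prime p" by auto
  have "mset_set (prime_factors n) \<subseteq># prime_factorization n" by (rule mset_set_set_mset_msubset)
  hence "prime_factorization (\<Prod>(prime_factors n)) \<subseteq># prime_factorization n"
    using P by (subst prime_factorization_prod_primes) auto
  thus ?thesis using assms prod_primes_nonzero[OF P]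
    by (subst (asm) prime_factorization_subset_iff_dvd) auto
qed

text \<open>Squarefree divisors correspond to sets of prime factors, so the sum is an expanded power
  of (-1) + 1.\<close>

lemma sum_moebius_mu:
  assumes "n > 0"
  shows "(\<Sum>t | t dvd n. moebius_mu t) = of_bool (n = 1)"
proof -
  define P where "P = prime_factors n"
  have P: "finite P" "\<And>p. p \<in> P \<Longrightarrow> prime p" by (auto simp: P_def)
  have "(\<Sum>t | t dvd n. moebius_mu t) = (\<Sum>t | t dvd n \<and> squarefree t. (-1) ^ card (prime_factors t))"
    using assms by (intro sum.mono_neutral_cong_right) (auto simp: moebius_mu_def)
  also have "\<dots> = (\<Sum>S\<in>Pow P. (-1) ^ card S)"
  proof (rule sum.reindex_bij_witness[of _ "\<lambda>S. \<Prod>S" prime_factors])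
    fix t assume t: "t \<in> {t. t dvd n \<and> squarefree t}"
    thus "\<Prod>(prime_factors t) = t" by (simp add: squarefree_eq_prod_primes)
    show "prime_factors t \<in> Pow P"
      using t assms dvd_prime_factors[of n t] unfolding P_def by blast
  next
    fix S assume "S \<in> Pow P"
    hence S: "S \<subseteq> P" "finite S" "\<And>p. p \<in> S \<Longrightarrow> prime p" using P finite_subset by auto
    show "prime_factors (\<Prod>S) = S" by (rule prime_factors_prod_primes[OF S(2,3)])
    have "\<Prod>S dvd \<Prod>P" using S(1) P by (intro prod_dvd_prod_subset)
    also have "\<Prod>P dvd n"
      unfolding P_def by (rule prod_prime_factors_dvd[OF assms])
    finally show "\<Prod>S \<in> {t. t dvd n \<and> squarefree t}"
      using squarefree_prod_primes[OF S(2,3)] by simp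
  qed auto
  also have "\<dots> = (\<Prod>p\<in>P. (-1) + 1)"
    using P(1) by (subst prod_add) simp_all
  also have "\<dots> = of_bool (P = {})" using P(1) by (cases "P = {}") auto
  also have "P = {} \<longleftrightarrow> n = 1"
    using assms by (auto simp: P_def prime_factorization_empty_iff)
  finally show ?thesis .
qed

text \<open>The coprimality condition is resolved by Moebius inversion, and each sum over multiples
  of t is geometric. This yields the inner sum of \<open>R_even\<close>.\<close>

lemma sum_coprime_cis2:
  assumes d: "d > 0" "g dvd d"
  shows "(\<Sum>j<d. of_bool (coprime j g) * addchar d (u * int j)) =
     of_real (\<Sum>t | 0 < t \<and> t dvd g \<and> int d dvd u * int t. of_int (moebius_mu t) * (real d / real t))"
proof -
  have g: "g > 0" using d by (auto intro!: gr0I)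
  have "(\<Sum>j<d. of_bool (coprime j g) * addchar d (u * int j)) =
     (\<Sum>j<d. (\<Sum>t | t dvd g. of_int (moebius_mu t) * of_bool (t dvd j) * addchar d (u * int j)))"
  proof (intro sum.cong refl)
    fix j
    have "of_bool (coprime j g) = (\<Sum>t | t dvd gcd j g. moebius_mu t)"
      unfolding coprime_iff_gcd_eq_1 using g by (subst sum_moebius_mu) simp_all
    also have "\<dots> = (\<Sum>t | t dvd g. moebius_mu t * of_bool (t dvd j))"
      using g by (intro sum.mono_neutral_cong_left) auto
    finally have "(of_int (of_bool (coprime j g)) :: complex) = of_int (\<Sum>t | t dvd g. moebius_mu t * of_bool (t dvd j))"
      by (rule arg_cong)
    hence eq: "of_bool (coprime j g) = (\<Sum>t | t dvd g. of_int (moebius_mu t) * (of_bool (t dvd j) :: complex))"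
      by (simp only: of_int_of_bool of_int_sum of_int_mult)
    thus "of_bool (coprime j g) * addchar d (u * int j) =
       (\<Sum>t | t dvd g. of_int (moebius_mu t) * of_bool (t dvd j) * addchar d (u * int j))"
      unfolding eq by (simp only: sum_distrib_right)
  qed
  also have "\<dots> = (\<Sum>t | t dvd g. of_int (moebius_mu t) * (\<Sum>j<d. of_bool (t dvd j) * addchar d (u * int j)))"
    unfolding sum_distrib_left by (subst sum.swap) (simp only: mult.assoc)
  also have "\<dots> = (\<Sum>t | t dvd g. if int d dvd u * int t then of_int (moebius_mu t) * (of_nat d / of_nat t) else 0)"
  proof (rule sum.cong[OF refl])
    fix t assume "t \<in> {t. t dvd g}"
    hence "t dvd d" using d by auto
    then obtain e where e: "d = t * e" ..
    have te: "t > 0" "e > 0" using d e by auto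
    have "(\<Sum>j<d. of_bool (t dvd j) * addchar d (u * int j)) =
          (\<Sum>j\<in>{j\<in>{..<d}. t dvd j}. addchar d (u * int j))"
      by (intro sum.mono_neutral_cong_right) auto
    also have "\<dots> = (\<Sum>j<e. cis2 (of_int u * of_nat j / of_nat e))"
    proof (rule sum.reindex_bij_witness[of _ "\<lambda>j. t * j" "\<lambda>j. j div t"])
      fix j assume "j \<in> {j\<in>{..<d}. t dvd j}"
      then obtain i where i: "j = t * i" "j < d" by auto
      show "t * (j div t) = j" using i te by simp
      show "j div t \<in> {..<e}" using i te by (simp add: e)
      show "cis2 (of_int u * of_nat (j div t) / of_nat e) = addchar d (u * int j)"
        using i te by (simp add: e field_simps)
    qed (use te in \<open>auto simp: e\<close>)
    also have "\<dots> = (if int e dvd u then of_nat e else 0)"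
      by (rule sum_cis2_roots[OF te(2)])
    also have "int e dvd u \<longleftrightarrow> int d dvd u * int t"
      using te by (simp add: e mult.commute)
    also have "of_nat e = (of_nat d / of_nat t :: complex)"
      using te by (simp add: e)
    finally have "(\<Sum>j<d. of_bool (t dvd j) * addchar d (u * int j)) =
      (if int d dvd u * int t then of_nat d / of_nat t else 0)" .
    thus "of_int (moebius_mu t) * (\<Sum>j<d. of_bool (t dvd j) * addchar d (u * int j)) =
       (if int d dvd u * int t then of_int (moebius_mu t) * (of_nat d / of_nat t) else 0)"
      by (simp only:) simp
  qed
  also have "\<dots> = (\<Sum>t | 0 < t \<and> t dvd g \<and> int d dvd u * int t. of_int (moebius_mu t) * (of_nat d / of_nat t))"
    using g by (intro sum.mono_neutral_cong_right) (auto intro!: gr0I)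
  finally show ?thesis by simp
qed

lemma
  shows prime_factors_rad_E: "prime_factors (rad_E m) = {p\<in>prime_factors m. even (multiplicity p m)}"
    and prime_factors_rad_O: "prime_factors (rad_O m) = {p\<in>prime_factors m. odd (multiplicity p m)}"
    and squarefree_rad_E: "squarefree (rad_E m)" and squarefree_rad_O: "squarefree (rad_O m)"
    and rad_E_pos: "rad_E m > 0" and rad_O_pos: "rad_O m > 0"
  unfolding rad_E_def rad_O_def
  by (rule prime_factors_prod_primes squarefree_prod_primes; auto; fail | rule gr0I, auto simp: not_prime_0; fail)+

lemma coprime_rad_E_O: "coprime (rad_E m) (rad_O m)"
proof (rule ccontr)
  assume "\<not> coprime (rad_E m) (rad_O m)"
  then obtain c where c: "c dvd rad_E m" "c dvd rad_O m" "c \<noteq> 1"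
    by (elim not_coprimeE) auto
  then obtain p where "prime p" "p dvd c"
    using prime_factor_nat by blast
  with c have p: "prime p" "p dvd rad_E m" "p dvd rad_O m"
    by (auto intro: dvd_trans)
  hence "p \<in> prime_factors (rad_E m)" "p \<in> prime_factors (rad_O m)"
    using rad_E_pos[of m] rad_O_pos[of m] by (auto simp: in_prime_factors_iff)
  thus False by (simp add: prime_factors_rad_E prime_factors_rad_O)
qed

lemma multiplicity_rad_O: 
  assumes "prime p" "m > 0"
  shows "multiplicity p (rad_O m) = (if odd (multiplicity p m) then 1 else 0)"
proof -
  have "multiplicity p (rad_O m) \<le> 1"
    using squarefree_rad_O[of m] assms rad_O_pos[of m] by (simp add: squarefree_factorial_semiring'')
  moreover have "multiplicity p (rad_O m) > 0 \<longleftrightarrow> odd (multiplicity p m)"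
  proof -
    have "multiplicity p (rad_O m) > 0 \<longleftrightarrow> p \<in> prime_factors (rad_O m)"
      using assms by (simp add: prime_factors_multiplicity)
    also have "\<dots> \<longleftrightarrow> multiplicity p m > 0 \<and> odd (multiplicity p m)"
      unfolding prime_factors_rad_O using assms by (simp add: prime_factors_multiplicity)
    finally show ?thesis using odd_pos by blast
  qed
  ultimately show ?thesis by (cases "odd (multiplicity p m)") auto
qed

lemma rad_dvd:
  assumes "m > 0"
  shows "rad m dvd m"
proof -
  have "rad m = \<Prod>(prime_factors m)"
    unfolding rad_def rad_E_def rad_O_def by (subst prod.union_disjoint[symmetric]) (auto intro: prod.cong)
  also have "\<dots> dvd m"
    by (rule prod_prime_factors_dvd[OF assms])
  finally show ?thesis .
qed

lemma jacobi_prod_primes: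
  assumes "finite S" "\<And>p. p \<in> S \<Longrightarrow> prime p"
  shows "jacobi x (\<Prod>S) = (\<Prod>p\<in>S. Legendre x (int p))"
proof -
  have "prime_factorization (\<Prod>S) = mset_set S"
    by (rule prime_factorization_prod_primes) (use assms in auto)
  thus ?thesis
    unfolding jacobi_def by (simp only: prod_unfold_prod_mset[symmetric])
qed

text \<open>Even powers of a Legendre symbol only detect divisibility, odd powers equal the symbol
  itself. The sum over shifts thereby splits into a Gauss sum modulo \<open>rad_O\<close> and a
  Ramanujan sum modulo \<open>rad_E\<close>.\<close>

lemma jacobi_rad:
  assumes "m > 0"
  shows "jacobi x m = jacobi x (rad_O m) * of_bool (coprime x (int (rad_E m)))"
proof -
  define E O' where "E = {p\<in>prime_factors m. even (multiplicity p m)}" and "O' = {p\<in>prime_factors m. odd (multiplicity p m)}"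
  have EO: "finite E" "finite O'" "E \<inter> O' = {}" "prime_factors m = E \<union> O'"
    by (auto simp: E_def O'_def)
  have "jacobi x m = (\<Prod>p\<in>prime_factors m. Legendre x (int p) ^ count (prime_factorization m) p)"
    unfolding jacobi_def by (simp add: image_prod_mset_multiplicity)
  also have "\<dots> = (\<Prod>p\<in>E. Legendre x (int p) ^ count (prime_factorization m) p) * (\<Prod>p\<in>O'. Legendre x (int p) ^ count (prime_factorization m) p)"
    unfolding EO(4) using EO by (intro prod.union_disjoint)
  also have "(\<Prod>p\<in>O'. Legendre x (int p) ^ count (prime_factorization m) p) = (\<Prod>p\<in>O'. Legendre x (int p))"
  proof (intro prod.cong refl)
    fix p assume "p \<in> O'"
    hence "odd (count (prime_factorization m) p)"
      by (auto simp: O'_def count_prime_factorization)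
    then obtain k where k: "count (prime_factorization m) p = 2 * k + 1" by (elim oddE)
    show "Legendre x (int p) ^ count (prime_factorization m) p = Legendre x (int p)"
      unfolding k using Legendre_range[of x "int p"] by auto
  qed
  also have "\<dots> = jacobi x (rad_O m)"
    unfolding rad_O_def O'_def by (rule jacobi_prod_primes[symmetric]) auto
  also have "(\<Prod>p\<in>E. Legendre x (int p) ^ count (prime_factorization m) p) = (\<Prod>p\<in>E. of_bool (\<not> int p dvd x))"
  proof (intro prod.cong refl)
    fix p assume "p \<in> E"
    hence "even (count (prime_factorization m) p)" "count (prime_factorization m) p > 0"
      by (auto simp: E_def count_prime_factorization prime_factors_multiplicity)
    thus "Legendre x (int p) ^ count (prime_factorization m) p = of_bool (\<not> int p dvd x)"
      using Legendre_range[of x "int p"] Legendre_eq_0_iff[of x "int p"] by auto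
  qed
  also have "\<dots> = of_bool (\<forall>p\<in>E. \<not> int p dvd x)"
    using EO(1) by (induction E rule: finite_induct) auto
  also have "(\<forall>p\<in>E. \<not> int p dvd x) \<longleftrightarrow> coprime x (int (rad_E m))"
  proof -
    have "coprime x (\<Prod>p\<in>A. int p) \<longleftrightarrow> (\<forall>p\<in>A. coprime x (int p))" if "finite A" for A
      using that by (induction A rule: finite_induct) auto
    hence "coprime x (int (rad_E m)) \<longleftrightarrow> (\<forall>p\<in>E. coprime x (int p))"
      unfolding rad_E_def E_def[symmetric] of_nat_prod using EO(1) by simp
    also have "\<dots> \<longleftrightarrow> (\<forall>p\<in>E. \<not> int p dvd x)"
    proof (intro ball_cong refl)
      fix p assume "p \<in> E"
      hence "prime (int p)" by (auto simp: E_def)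
      thus "coprime x (int p) \<longleftrightarrow> \<not> int p dvd x"
        by (metis coprime_commute prime_imp_coprime coprime_common_divisor dvd_refl not_prime_unit)
    qed
    finally show ?thesis ..
  qed
  finally show ?thesis by (simp add: mult.commute)
qed

lemma odd_cong_mod4:
  fixes x y :: nat
  assumes "is_square (x * y)" "odd x" "odd y"
  shows "x mod 4 = y mod 4"
proof -
  have "(x * y) mod 8 = 1" using assms by (intro mod8_odd_square) auto
  hence "((x mod 4) * (y mod 4)) mod 4 = 1" unfolding mod_mult_eq by presburger
  moreover have "x mod 4 = 1 \<or> x mod 4 = 3" "y mod 4 = 1 \<or> y mod 4 = 3"
    using assms(2,3) by presburger+
  ultimately show ?thesis by auto
qed

lemma cis2_quarters:
  "cis2 (of_int m / 4) = (if m mod 4 = 0 then 1 else if m mod 4 = 1 then \<i> else if m mod 4 = 2 then -1 else -\<i>)"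
proof -
  have 34: "cis2 (3 / 4) = - \<i>"
    using cis2_add[of "1/2" "1/4"] by simp
  have "cis2 (of_int m / of_int 4) = cis2 (of_int (m mod 4) / of_int 4)"
    by (intro cis2_cong) (auto simp: cong_def)
  moreover have "m mod 4 = 0 \<or> m mod 4 = 1 \<or> m mod 4 = 2 \<or> m mod 4 = 3" by presburger
  ultimately show ?thesis using 34 by auto
qed

context eta_hecke
begin

text \<open>Both sides depend only on r modulo 4 and d modulo 8, which leaves eight cases. The
  factor \<open>gauss_eps d\<close> turns the eighth root of unity in \<open>diag_wt\<close> into
  the real character of \<open>R_odd\<close>.\<close>

lemma diag_wt_odd:
  assumes "odd r" "odd d"
  shows "diag_wt d * gauss_eps d = of_int (jacobi (2 * (-1) ^ ((r - 1) div 2)) d)"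
proof -
  obtain D where D: "d = 2 * D + 1" using assms(2) by (elim oddE)
  obtain s where s: "r = 2 * s + 1" using assms(1) by (elim oddE)
  have "jacobi ((-1) ^ s) d = (jacobi (-1) d) ^ s"
    by (induction s) (simp_all only: power_0 power_Suc jacobi_1_left[OF assms(2)] jacobi_mult_left[OF assms(2)])
  hence j: "jacobi (2 * (-1) ^ ((r - 1) div 2)) d = jacobi 2 d * jacobi (-1) d ^ s"
    using assms(2) by (simp add: s jacobi_mult_left)
  have "(- of_nat (r * (d - 1)) / 8 :: complex) = of_int (- int (r * D)) / 4"
    by (simp add: D)
  hence c: "cis2 (- of_nat (r * (d - 1)) / 8) = cis2 (of_int (- int (r * D)) / 4)" by (rule arg_cong)
  have "D mod 4 = 0 \<or> D mod 4 = 1 \<or> D mod 4 = 2 \<or> D mod 4 = 3" by presburger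
  have lhs: "diag_wt d * gauss_eps d = of_int (if d mod 4 = 3 then -1 else 1) * cis2 (of_int (- int (r * D)) / 4) * (if d mod 4 = 3 then \<i> else 1)"
    using assms unfolding diag_wt_def c jacobi_minus_1[OF assms(2)] gauss_eps_def by simp
  have rhs: "jacobi (2 * (-1) ^ ((r - 1) div 2)) d = (if d mod 8 = 1 \<or> d mod 8 = 7 then 1 else -1) * (if d mod 4 = 3 then -1 else 1) ^ s"
    unfolding j jacobi_2[OF assms(2)] jacobi_minus_1[OF assms(2)] ..
  have rD: "(- int (r * D)) mod 4 = (- (int (r mod 4) * int (D mod 4))) mod 4"
  proof -
    have m: "[int x = int (x mod 4)] (mod 4)" for x by (simp add: cong_def zmod_int)
    have "[int (r * D) = int (r mod 4) * int (D mod 4)] (mod 4)"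
      unfolding of_nat_mult by (intro cong_mult m)
    hence "[- int (r * D) = - (int (r mod 4) * int (D mod 4))] (mod 4)"
      by (simp only: cong_minus_minus_iff)
    thus ?thesis by (simp only: cong_def)
  qed
  have r4: "r mod 4 = (if even s then 1 else 3)" unfolding s by (cases "even s"; presburger)
  have d8: "d mod 8 = 2 * (D mod 4) + 1" unfolding D by presburger
  have d4: "d mod 4 = 2 * (D mod 2) + 1" unfolding D by presburger
  have D2: "D mod 2 = (D mod 4) mod 2" by (simp add: mod_mod_cancel)
  show ?thesis
    unfolding lhs rhs cis2_quarters rD r4 d8 d4 D2
    using \<open>D mod 4 = 0 \<or> _\<close> by (elim disjE; cases "even s"; simp)
qed

text \<open>The quotient is exact because d * d is 1 modulo \<open>N\<close>. This shift of k clears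
  the 24 from the exponents of the exponential sum: the part r * d * d contributes (rN/24)dj, an
  integer. If n belongs to k, the result is d(n - rl)/(24a).\<close>

definition idx :: "nat \<Rightarrow> nat \<Rightarrow> int" where
  "idx a k = int k - int (r * ((l div a)\<^sup>2 - 1) div 24)"

lemma idx_eq:
  assumes "a dvd l"
  shows "24 * idx a k = int (24 * k + r) - int r * (int (l div a))\<^sup>2"
proof -
  define d where "d = l div a"
  have d: "d dvd l" "d > 0" using assms l by (auto simp: d_def dvd_div_eq_0_iff intro!: gr0I)
  have "int N dvd (int d)\<^sup>2 - 1"
    by (rule square_mod_24[OF coprime_N[OF d(1)] N_dvd])
  also have "(int d)\<^sup>2 - 1 = int (d\<^sup>2 - 1)"
    using d(2) by (simp add: of_nat_diff)
  finally have "24 dvd r * (d\<^sup>2 - 1)"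
    by (simp only: int_dvd_int_iff dvd_r_mult_iff)
  then obtain v where v: "r * (d\<^sup>2 - 1) = 24 * v" ..
  have "int r * ((int d)\<^sup>2 - 1) = 24 * int v"
    using v \<open>(int d)\<^sup>2 - 1 = int (d\<^sup>2 - 1)\<close> by (metis of_nat_mult of_nat_numeral)
  moreover have "idx a k = int k - int v"
    unfolding idx_def d_def[symmetric] v by simp
  ultimately show ?thesis
    unfolding d_def[symmetric] by (simp add: algebra_simps)
qed

lemma cis2_idx:
  assumes "a dvd l"
  shows "cis2 (of_nat (24 * k + r) * of_nat (N * j) / (24 * of_nat (l div a))) =
         addchar (l div a) (idx a k * (int N * int j))"
proof -
  define d where "d = l div a"
  have d: "d > 0" using assms l by (auto simp: d_def dvd_div_eq_0_iff intro!: gr0I)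
  obtain \<rho> where \<rho>: "r * N = 24 * \<rho>" using r_N by blast
  have "of_nat (24 * k + r) = (of_int (24 * idx a k + int r * (int d)\<^sup>2) :: complex)"
    using idx_eq[OF assms, of k] unfolding d_def[symmetric] by simp
  hence "of_nat (24 * k + r) * of_nat (N * j) / (24 * of_nat d) =
     of_int (24 * idx a k + int r * (int d)\<^sup>2) * of_nat (N * j) / (24 * of_nat d :: complex)"
    by simp
  also have "\<dots> = of_int (idx a k * (int N * int j)) / of_nat d + of_nat (r * N) * of_nat d * of_nat j / (24 :: complex)"
    using d by (simp add: field_simps power2_eq_square)
  also have "\<dots> = of_int (idx a k * (int N * int j)) / of_nat d + of_nat (\<rho> * d * j)"
    unfolding \<rho> by simp
  finally show ?thesis
    unfolding d_def[symmetric] by (simp only: cis2_add cis2_of_nat mult_1_right)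
qed

text \<open>What stands beside \<open>eta_P\<close> and the power of \<open>a\<close> in the summand
  of \<open>R\<close> at \<open>a\<close>, in terms of the index u from the Fourier side. The
  quotient \<open>y\<close> corresponds to the \<open>u\<close> of \<open>R_odd\<close>.\<close>

definition arith_factor :: "nat \<Rightarrow> int \<Rightarrow> real" where
  "arith_factor a u = (let d = l div a; g = gcd a d in
     if even r then (-1) ^ (r * (d - 1) div 4) *
       (\<Sum>t | 0 < t \<and> t dvd g \<and> int d dvd u * int t. of_int (moebius_mu t) * (real d / real t))
     else if int d dvd u * int (rad g) then
       (let y = u * int (rad g) div int d in
       of_int (jacobi (2 * (-1) ^ ((r - 1) div 2)) d) * of_int (jacobi (int (rad_E g)) (rad_O g)) *
       (real d / sqrt (real (rad' g))) * of_int (jacobi y (rad_O g)) *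
       of_int (\<Prod>p\<in>prime_factors (rad_E g). int p - 1 - int p * (jacobi y p)\<^sup>2))
     else 0)"

text \<open>Multiplication by \<open>N\<close> permutes the residues modulo d and so leaves the sum.
  For even \<open>r\<close> the rest is \<open>sum_coprime_cis2\<close>. For odd \<open>r\<close>
  the weight has period \<open>rad g\<close>, and the shorter sum splits into a Gauss sum and a
  Ramanujan sum.\<close>

lemma shift_sum_eq:
  assumes a: "a dvd l"
  shows "shift_sum a k = of_real (arith_factor a (idx a k))"
proof -
  define d g u where "d = l div a" and "g = gcd a d" and "u = idx a k"
  have ad: "a * d = l" using a by (simp add: d_def)
  have pos: "a > 0" "d > 0" using ad l by (auto intro!: gr0I)
  have dl: "d dvd l" using ad by auto
  have g: "g dvd d" "g > 0" "g dvd a" using pos by (auto simp: g_def)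
  have copN: "coprime (int N) (int d)" using coprime_N[OF dl] by (simp add: coprime_commute)
  have copNg: "coprime N g" using coprime_N[of g] g dl by (meson coprime_commute dvd_trans)
  have S: "shift_sum a k = diag_wt d * (\<Sum>j<d. of_bool (coprime j g) * shift_wt g (int j) * addchar d (u * (int N * int j)))"
  proof -
    have "(\<Sum>j\<in>shifts a. shift_wt g (int j) * cis2 (of_nat (24 * k + r) * of_nat (N * j) / (24 * of_nat d))) =
       (\<Sum>j\<in>shifts a. shift_wt g (int j) * addchar d (u * (int N * int j)))"
      unfolding d_def u_def cis2_idx[OF a] ..
    also have "\<dots> = (\<Sum>j<d. of_bool (coprime j g) * shift_wt g (int j) * addchar d (u * (int N * int j)))"
      by (intro sum.mono_neutral_cong_left) (auto simp: shifts_def d_def g_def)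
    finally show ?thesis
      unfolding shift_sum_def d_def[symmetric] g_def[symmetric] by simp
  qed
  show ?thesis
  proof (cases "even r")
    case True
    have "(\<Sum>j<d. of_bool (coprime j g) * shift_wt g (int j) * addchar d (u * (int N * int j))) =
        (\<Sum>j<d. of_bool (coprime (int N * int j + 0) (int g)) * addchar d (u * (int N * int j + 0)))"
      using True copNg by (intro sum.cong refl) (simp add: shift_wt_def coprime_commute)
    also have "\<dots> = (\<Sum>j<d. of_bool (coprime (int j) (int g)) * addchar d (u * int j))"
    proof (rule sum_periodic_affine[OF pos(2) copN])
      fix x y assume xy: "[x = y] (mod int d)"
      hence "[x = y] (mod int g)" using g by (meson cong_dvd_modulus int_dvd_int_iff)
      hence "coprime x (int g) \<longleftrightarrow> coprime y (int g)" by (metis cong_imp_coprime cong_sym)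
      moreover have "addchar d (u * x) = addchar d (u * y)"
        using xy pos by (intro cis2_cong_nat cong_mult cong_refl) auto
      ultimately show "of_bool (coprime x (int g)) * addchar d (u * x) =
          of_bool (coprime y (int g)) * addchar d (u * y)" by simp
    qed
    also have "\<dots> = of_real (\<Sum>t | 0 < t \<and> t dvd g \<and> int d dvd u * int t. of_int (moebius_mu t) * (real d / real t))"
      using sum_coprime_cis2[OF pos(2) g(1), of u] by simp
    finally show ?thesis
      unfolding S u_def[symmetric] arith_factor_def Let_def d_def[symmetric] g_def[symmetric]
      using True by (simp add: diag_wt_def)
  next
    case False
    have odd: "odd d" "odd g" "odd a" using odd_r_l[OF False] dl g a by (auto dest: dvd_trans)
    define E B where "E = rad_E g" and "B = rad_O g"
    have EB: "E > 0" "B > 0" "coprime B E" "rad g = B * E"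
      using rad_E_pos rad_O_pos coprime_rad_E_O[of g] by (auto simp: E_def B_def rad_def coprime_commute)
    have rad: "B * E dvd g" using rad_dvd[OF g(2)] EB(4) by simp
    hence dvds: "B dvd g" "E dvd g" by (auto dest: dvd_mult_left dvd_mult_right)
    have oddEB: "odd E" "odd B" using dvds odd(2) by (auto dest: dvd_trans)
    define f where "f = (\<lambda>x. of_int (jacobi x B) * of_bool (coprime x (int E)) :: complex)"
    have per_cop: "coprime x (int E) \<longleftrightarrow> coprime y (int E)" if "[x = y] (mod int E)" for x y
      using that by (metis cong_imp_coprime cong_sym)
    have f: "of_int (jacobi x g) = f x" for x
      using jacobi_rad[OF g(2), of x] by (simp add: f_def E_def B_def)
    have f_per: "f x = f y" if "[x = y] (mod int (B * E))" for x y
    proof -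
      have "[x = y] (mod int B)" "[x = y] (mod int E)"
        using that by (auto intro: cong_dvd_modulus)
      hence "jacobi x B = jacobi y B" "coprime x (int E) \<longleftrightarrow> coprime y (int E)"
        by (simp_all only: jacobi_cong per_cop)
      thus ?thesis by (simp add: f_def)
    qed
    have "(\<Sum>j<d. of_bool (coprime j g) * shift_wt g (int j) * addchar d (u * (int N * int j))) =
        (\<Sum>j<d. f (int N * int j + 0) * addchar d (u * (int N * int j + 0)))"
    proof (intro sum.cong refl)
      fix j
      have "of_bool (coprime j g) * of_int (jacobi (int N * int j) g) = (of_int (jacobi (int N * int j) g) :: complex)"
        using jacobi_eq_0_iff[OF g(2), of "int N * int j"] copNg by auto
      thus "of_bool (coprime j g) * shift_wt g (int j) * addchar d (u * (int N * int j)) =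
        f (int N * int j + 0) * addchar d (u * (int N * int j + 0))"
        using False by (simp add: shift_wt_def f)
    qed
    also have "\<dots> = (\<Sum>j<d. f (int j) * addchar d (u * int j))"
    proof (rule sum_periodic_affine[OF pos(2) copN])
      fix x y assume xy: "[x = y] (mod int d)"
      have "int (B * E) dvd int d" using rad g(1) by (meson dvd_trans int_dvd_int_iff)
      hence "f x = f y" using xy by (intro f_per) (rule cong_dvd_modulus)
      moreover have "addchar d (u * x) = addchar d (u * y)"
        using xy pos by (intro cis2_cong_nat cong_mult cong_refl) auto
      ultimately show "f x * addchar d (u * x) = f y * addchar d (u * y)" by simp
    qed
    also have "\<dots> = (if int d dvd u * int (B * E) then of_nat (d div (B * E)) *
        (\<Sum>b<B * E. f (int b) * addchar (B * E) ((u * int (B * E) div int d) * int b)) else 0)"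
      using rad g(1) pos by (intro sum_cis2_periodic f_per) (auto intro: dvd_trans)
    finally have S': "shift_sum a k = diag_wt d * (if int d dvd u * int (B * E) then of_nat (d div (B * E)) *
        (\<Sum>b<B * E. f (int b) * addchar (B * E) ((u * int (B * E) div int d) * int b)) else 0)"
      unfolding S by (rule arg_cong)
    show ?thesis
    proof (cases "int d dvd u * int (B * E)")
      case False': False
      thus ?thesis
        unfolding S' arith_factor_def Let_def d_def[symmetric] g_def[symmetric] u_def[symmetric] EB(4)
        using False by simp
    next
      case True
      define y where "y = u * int (B * E) div int d"
      define Pr where "Pr = (\<Prod>p\<in>prime_factors E. int p - 1 - int p * (jacobi y p)\<^sup>2)"
      have "(\<Sum>b<B * E. f (int b) * addchar (B * E) (y * int b)) =
          (\<Sum>b<B. of_int (jacobi (int E * int b) B) * addchar B (y * int b)) *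
          (\<Sum>c<E. of_bool (coprime (int B * int c) (int E)) * addchar E (y * int c))"
        unfolding f_def
        by (rule sum_cis2_crt[where h = "\<lambda>x. of_bool (coprime x (int E))"])
           (use EB in \<open>auto simp: jacobi_cong[of _ _ B] per_cop\<close>)
      also have "(\<Sum>b<B. of_int (jacobi (int E * int b) B) * addchar B (y * int b)) =
          of_int (jacobi (int E) B) * (of_int (jacobi y B) * gauss_eps B * of_real (sqrt (real B)))"
        unfolding character_gauss_sum[OF oddEB(2) squarefree_rad_O[of g, folded B_def], of y, symmetric] sum_distrib_left
          jacobi_mult_left[OF oddEB(2)] by (simp only: of_int_mult mult_ac)
      also have "(\<Sum>c<E. of_bool (coprime (int B * int c) (int E)) * addchar E (y * int c)) = of_int Pr"
        using ramanujan_sum[OF oddEB(1) squarefree_rad_E[of g, folded E_def], of y] EB(3) by (simp add: Pr_def)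
      finally have "shift_sum a k = (diag_wt d * gauss_eps B) * of_nat (d div (B * E)) * of_int (jacobi (int E) B) *
          of_int (jacobi y B) * of_real (sqrt (real B)) * of_int Pr"
        unfolding S' y_def[symmetric] using True by (simp add: mult_ac)
      \<comment> \<open>Both Bg and dg are squares of odd numbers, so B, g and d agree modulo 4. For
        dg this uses that \<open>l = a * d\<close> is a square.\<close>
      also have "gauss_eps B = gauss_eps d"
      proof -
        have "is_square (B * g)"
          using EB(2) g(2) unfolding is_nth_power_conv_multiplicity_nat[OF pos2]
          by (auto simp: prime_elem_multiplicity_mult_distrib B_def multiplicity_rad_O)
        hence "B mod 4 = g mod 4" using odd_cong_mod4 oddEB odd by blast
        also have "is_square (a * 1 * d)" using sq[OF False] ad by simp
        from is_square_gcd(3)[OF this] pos have "is_square (d * g)" by (simp add: g_def)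
        hence "g mod 4 = d mod 4" using odd_cong_mod4[of d g] odd by simp
        finally show ?thesis by (simp add: gauss_eps_def)
      qed
      also have "diag_wt d * gauss_eps d = of_int (jacobi (2 * (-1) ^ ((r - 1) div 2)) d)"
        by (rule diag_wt_odd[OF False odd(1)])
      also have "complex_of_int (jacobi (2 * (-1) ^ ((r - 1) div 2)) d) * of_nat (d div (B * E)) * of_int (jacobi (int E) B) *
          of_int (jacobi y B) * of_real (sqrt (real B)) * of_int Pr =
        of_real (of_int (jacobi (2 * (-1) ^ ((r - 1) div 2)) d) * of_int (jacobi (int E) B) *
          (real (d div (B * E)) * sqrt (real B)) * of_int (jacobi y B) * of_int Pr)"
        by (simp only: of_real_mult of_real_of_int_eq of_real_of_nat_eq mult_ac)
      also have "real (d div (B * E)) * sqrt (real B) = real d / sqrt (real (rad' g))"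
      proof -
        have "B * E dvd d" using rad g(1) by (rule dvd_trans)
        hence 1: "real (d div (B * E)) = real d / (real B * real E)"
          by (simp add: real_of_nat_div)
        have 2: "sqrt (real (rad' g)) = real E * sqrt (real B)"
          by (simp add: rad'_def E_def B_def real_sqrt_mult)
        have 3: "x / (b * b * e) * b = x / (e * b)" if "b > 0" for x b e :: real
          using that by simp
        show ?thesis
          using 3[of "sqrt (real B)" "real d" "real E"] EB(2) unfolding 1 2 by simp
      qed
      finally show ?thesis
        unfolding arith_factor_def Let_def d_def[symmetric] g_def[symmetric] u_def[symmetric] EB(4) y_def[symmetric]
          E_def[symmetric] B_def[symmetric]
        using False True by (simp add: Pr_def)
    qed
  qed
qed

end

section \<open>Matching the Fourier coefficients with R(n; r, l)\<close>

lemma dvd_gcd_mult_iff: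
  fixes a m t :: int
  assumes "t > 0"
  shows "a dvd gcd a m * t \<longleftrightarrow> a dvd m * t"
proof
  assume "a dvd gcd a m * t"
  also have "gcd a m * t dvd m * t" by (intro mult_dvd_mono) auto
  finally show "a dvd m * t" .
next
  assume "a dvd m * t"
  hence "a dvd gcd (a * t) (m * t)" by simp
  also have "gcd (a * t) (m * t) = gcd a m * t"
    using gcd_mult_distrib_int[of t a m] assms by (simp add: mult.commute)
  finally show "a dvd gcd a m * t" .
qed

lemma sqrt_power_eq_powr: "x > 0 \<Longrightarrow> sqrt x ^ n = x powr (real n / 2)"
  by (simp add: powr_half_sqrt[symmetric] powr_realpow[symmetric] powr_powr)

context eta_hecke
begin

text \<open>For a divisor \<open>a\<close> of \<open>l\<close> at most one k occurs, by
  \<open>index_unique\<close>. Summing over this set replaces the case distinction in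
  \<open>eta_P\<close> between natural and other arguments.\<close>

definition coeff_at :: "nat \<Rightarrow> int \<Rightarrow> real" where
  "coeff_at a n = (\<Sum>k | int a * int (24 * k + r) = int (l div a) * n.
     of_int (eta_power_coeff r k) * arith_factor a (idx a k))"

lemma eta_P_eq:
  assumes a: "a dvd l"
  shows "eta_P r ((of_int n * of_nat l / (of_nat a)\<^sup>2 - of_nat r) / 24) =
     (\<Sum>k | int a * int (24 * k + r) = int (l div a) * n. eta_power_coeff r k)"
proof -
  define d x where "d = l div a" and "x = (of_int n * of_nat l / (of_nat a)\<^sup>2 - of_nat r) / (24 :: rat)"
  have ad: "a * d = l" using a by (simp add: d_def)
  have pos: "a > 0" "d > 0" using ad l by (auto intro!: gr0I)
  have x: "x = of_nat k \<longleftrightarrow> int a * int (24 * k + r) = int d * n" for k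
  proof -
    have "x = (of_int n * of_nat d / of_nat a - of_nat r) / 24"
      using pos by (simp add: x_def ad[symmetric] power2_eq_square)
    hence eq: "of_nat a * (24 * x + of_nat r) = of_int (int d * n)"
      using pos by (simp add: field_simps)
    have "x = of_nat k \<longleftrightarrow> of_nat a * (24 * x + of_nat r) = of_nat a * (24 * of_nat k + of_nat r)"
      using pos by simp
    hence "x = of_nat k \<longleftrightarrow> (of_int (int a * int (24 * k + r)) :: rat) = of_int (int d * n)"
      unfolding eq by auto
    thus ?thesis by (simp only: of_int_eq_iff)
  qed
  have sub: "{k. int a * int (24 * k + r) = int d * n} = {k. x = of_nat k}"
    using x by simp
  show ?thesis
  proof (cases "x \<in> \<nat>")
    case True
    then obtain k where k: "x = of_nat k" by (elim Nats_cases)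
    hence "{k. x = of_nat k} = {k}" by auto
    thus ?thesis unfolding d_def[symmetric] x_def[symmetric] sub
      using True k by (simp add: eta_P_def)
  next
    case False
    hence "{k. x = of_nat k} = {}" by auto
    thus ?thesis unfolding d_def[symmetric] x_def[symmetric] sub
      using False by (simp add: eta_P_def)
  qed
qed

lemma index_unique:
  assumes "a dvd l" "int a * int (24 * k + r) = int (l div a) * n" "int a * int (24 * k' + r) = int (l div a) * n"
  shows "k = k'"
proof -
  have "a > 0" using assms(1) l by (auto intro!: gr0I)
  moreover have "int a * int (24 * k + r) = int a * int (24 * k' + r)" using assms by simp
  ultimately show ?thesis by simp
qed

lemma R_eq: "R n r l = (\<Sum>a | a dvd l. sqrt (real a) ^ r * coeff_at a n)"
proof -
  \<comment> \<open>This identity is the dictionary between both sides: it turns the divisibility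
    conditions by 24a in \<open>R\<close> into those by d in \<open>arith_factor\<close>.\<close>
  have idx_n: "(n - int r * int l) * int (l div a) = 24 * int a * idx a k"
    if a: "a dvd l" and k: "int a * int (24 * k + r) = int (l div a) * n" for a k
  proof -
    have ad: "int l = int a * int (l div a)" using a by (metis dvd_mult_div_cancel of_nat_mult)
    have "(n - int r * int l) * int (l div a) = int (l div a) * n - int r * int a * (int (l div a))\<^sup>2"
      unfolding ad by (simp add: power2_eq_square algebra_simps)
    also have "\<dots> = int a * (24 * idx a k)"
      unfolding idx_eq[OF a] k[symmetric] by (simp add: algebra_simps)
    finally show ?thesis by simp
  qed
  have dvd_iff: "24 * int a dvd (n - int r * int l) * t \<longleftrightarrow> int (l div a) dvd idx a k * t"
    if a: "a dvd l" and k: "int a * int (24 * k + r) = int (l div a) * n" for a k t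
  proof -
    have pos: "a > 0" "l div a > 0" using a l by (auto simp: dvd_div_eq_0_iff intro!: gr0I)
    have "24 * int a dvd (n - int r * int l) * t \<longleftrightarrow> int (l div a) * (24 * int a) dvd int (l div a) * ((n - int r * int l) * t)"
      using pos by (subst dvd_mult_cancel_left) auto
    also have "int (l div a) * ((n - int r * int l) * t) = 24 * int a * (idx a k * t)"
      using idx_n[OF a k] by (metis mult.assoc mult.commute)
    also have "int (l div a) * (24 * int a) = 24 * int a * int (l div a)" by simp
    also have "24 * int a * int (l div a) dvd 24 * int a * (idx a k * t) \<longleftrightarrow> int (l div a) dvd idx a k * t"
      using pos by (subst dvd_mult_cancel_left) auto
    finally show ?thesis .
  qed
  have sing: "{k. int a * int (24 * k + r) = int (l div a) * n} = {k}"
    if "a dvd l" "int a * int (24 * k + r) = int (l div a) * n" for a k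
    using index_unique[OF that(1)] that(2) by blast
  show ?thesis
  proof (cases "even r")
    case True
    have "R n r l = (\<Sum>a | 0 < a \<and> a dvd l. sqrt (real a) ^ r * coeff_at a n)"
      unfolding R_def if_P[OF True] R_even_def Let_def
    proof (intro sum.cong refl)
      fix a assume "a \<in> {a. 0 < a \<and> a dvd l}"
      hence a: "a > 0" "a dvd l" by auto
      define d g where "d = l div a" and "g = gcd a d"
      define K where "K = {k. int a * int (24 * k + r) = int d * n}"
      define T where "T = {t. 0 < t \<and> t dvd g \<and> 24 * int a dvd gcd (24 * int a) (n - int r * int l) * int t}"
      have "real a powr (real r / 2) * (-1) ^ (r * (d - 1) div 4) * (\<Sum>t\<in>T. of_int (moebius_mu t) * (real d / real t) *
           of_int (\<Sum>k\<in>K. eta_power_coeff r k)) = sqrt (real a) ^ r * (\<Sum>k\<in>K. of_int (eta_power_coeff r k) * arith_factor a (idx a k))"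
      proof (cases "K = {}")
        case True
        show ?thesis unfolding True by simp
      next
        case False
        then obtain k where k: "int a * int (24 * k + r) = int d * n" by (auto simp: K_def)
        have K: "K = {k}" unfolding K_def using sing[OF a(2)] k by (simp add: d_def)
        have T: "T = {t. 0 < t \<and> t dvd g \<and> int d dvd idx a k * int t}"
        proof -
          have "24 * int a dvd gcd (24 * int a) (n - int r * int l) * int t \<longleftrightarrow> int d dvd idx a k * int t" if "t > 0" for t
            using dvd_iff[OF a(2) k[unfolded d_def], of "int t"] dvd_gcd_mult_iff[of "int t"] that
            unfolding d_def by simp
          thus ?thesis unfolding T_def by blast
        qed
        have "arith_factor a (idx a k) = (-1) ^ (r * (d - 1) div 4) * (\<Sum>t\<in>T. of_int (moebius_mu t) * (real d / real t))"
          unfolding T arith_factor_def Let_def d_def[symmetric] g_def[symmetric] if_P[OF \<open>even r\<close>] ..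
        moreover have "(\<Sum>t\<in>T. of_int (moebius_mu t) * (real d / real t) * of_int (\<Sum>k\<in>K. eta_power_coeff r k)) =
            (\<Sum>t\<in>T. of_int (moebius_mu t) * (real d / real t)) * of_int (eta_power_coeff r k)"
          unfolding K sum_distrib_right by simp
        ultimately show ?thesis
          unfolding K using a(1) by (simp only: sqrt_power_eq_powr of_nat_0_less_iff) simp
      qed
      thus "real a powr (real r / 2) * (-1) ^ (r * (l div a - 1) div 4) *
         (\<Sum>t | 0 < t \<and> t dvd gcd a (l div a) \<and> 24 * int a dvd gcd (24 * int a) (n - int r * int l) * int t.
           of_int (moebius_mu t) * (real (l div a) / real t) *
           of_int (eta_P r ((of_int n * of_nat l / (of_nat a)\<^sup>2 - of_nat r) / 24))) = sqrt (real a) ^ r * coeff_at a n"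
        unfolding eta_P_eq[OF a(2)] coeff_at_def T_def K_def d_def g_def .
    qed
    also have "{a. 0 < a \<and> a dvd l} = {a. a dvd l}" using l by (auto intro!: gr0I)
    finally show ?thesis .
  next
    case False
    define t where "t = (\<lambda>a. let d = l div a; g = gcd a d; u = int (rad g) * (n - int r * int l) div (24 * int a) in
        of_int (kronecker (2 * (-1) ^ ((r - 1) div 2)) (int d)) *
        of_int (kronecker (int (rad_E g)) (int (rad_O g))) *
        (real d * real a powr (real r / 2) / sqrt (real (rad' g))) *
        of_int (eta_P r ((of_int n * of_nat l / (of_nat a)\<^sup>2 - of_nat r) / 24)) *
        of_int (kronecker u (int (rad_O g))) *
        of_int (\<Prod>p | prime p \<and> p dvd rad_E g. int p - 1 - int p * (kronecker u (int p))\<^sup>2))"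
    have "R n r l = (\<Sum>a | 0 < a \<and> a dvd l \<and> 24 * int a dvd int (rad (gcd a (l div a))) * (n - int r * int l). t a)"
      unfolding R_def if_not_P[OF False] R_odd_def t_def ..
    also have "\<dots> = (\<Sum>a | a dvd l. if 24 * int a dvd int (rad (gcd a (l div a))) * (n - int r * int l) then t a else 0)"
      using l by (intro sum.mono_neutral_cong_left) (auto intro!: gr0I)
    also have "\<dots> = (\<Sum>a | a dvd l. sqrt (real a) ^ r * coeff_at a n)"
    proof (intro sum.cong refl)
      fix a assume "a \<in> {a. a dvd l}"
      hence a: "a > 0" "a dvd l" using l by (auto intro!: gr0I)
      define d g where "d = l div a" and "g = gcd a d"
      define K where "K = {k. int a * int (24 * k + r) = int d * n}"
      have g: "g > 0" "g dvd l" using a by (auto simp: g_def intro: dvd_trans)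
      have dl: "d dvd l" using a(2) by (auto simp: d_def)
      have pos: "d > 0" using dl l by (auto intro!: gr0I)
      have odd: "odd d" "odd g" using odd_r_l[OF False] dl g by auto
      have "rad_E g * rad_O g dvd g" using rad_dvd[OF g(1)] by (simp add: rad_def)
      hence "rad_E g dvd g" "rad_O g dvd g" by (auto dest: dvd_mult_left dvd_mult_right)
      hence oddEO: "odd (rad_E g)" "odd (rad_O g)" using odd(2) by (auto dest: dvd_trans)
      show "(if 24 * int a dvd int (rad (gcd a (l div a))) * (n - int r * int l) then t a else 0) = sqrt (real a) ^ r * coeff_at a n"
      proof (cases "K = {}")
        case True
        have "eta_P r ((of_int n * of_nat l / (of_nat a)\<^sup>2 - of_nat r) / 24) = 0" "coeff_at a n = 0"
          unfolding eta_P_eq[OF a(2)] coeff_at_def d_def[symmetric] K_def[symmetric] True by simp_all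
        thus ?thesis by (simp add: t_def Let_def)
      next
        case False': False
        then obtain k where k: "int a * int (24 * k + r) = int d * n" by (auto simp: K_def)
        have K: "K = {k}" unfolding K_def using sing[OF a(2)] k by (simp add: d_def)
        define u where "u = idx a k"
        have cond: "24 * int a dvd int (rad g) * (n - int r * int l) \<longleftrightarrow> int d dvd u * int (rad g)"
          using dvd_iff[OF a(2) k[unfolded d_def], of "int (rad g)"] by (simp add: mult.commute u_def d_def)
        have coeff: "coeff_at a n = of_int (eta_power_coeff r k) * arith_factor a u"
          unfolding coeff_at_def d_def[symmetric] K_def[symmetric] K u_def by simp
        show ?thesis
        proof (cases "int d dvd u * int (rad g)")
          case no: False
          have "arith_factor a u = 0"
            unfolding arith_factor_def Let_def d_def[symmetric] g_def[symmetric] using False no by simp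
          thus ?thesis using no cond unfolding coeff d_def g_def by simp
        next
          case True
          define y where "y = u * int (rad g) div int d"
          have "int (rad g) * (n - int r * int l) div (24 * int a) = y"
          proof -
            have y: "u * int (rad g) = int d * y" using True by (simp add: y_def)
            have "int d * (int (rad g) * (n - int r * int l)) = int (rad g) * (24 * int a * u)"
              using idx_n[OF a(2) k[unfolded d_def]] unfolding d_def[symmetric] u_def[symmetric] by (metis mult.assoc mult.commute)
            also have "\<dots> = int d * (24 * int a * y)"
              using y by (metis mult.assoc mult.commute)
            finally have "int (rad g) * (n - int r * int l) = 24 * int a * y" using pos by simp
            thus ?thesis using a(1) by simp
          qed
          moreover have "eta_P r ((of_int n * of_nat l / (of_nat a)\<^sup>2 - of_nat r) / 24) = eta_power_coeff r k"
            unfolding eta_P_eq[OF a(2)] d_def[symmetric] K_def[symmetric] K by simp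
          moreover have "(\<Prod>p | prime p \<and> p dvd rad_E g. int p - 1 - int p * (kronecker y (int p))\<^sup>2) =
             (\<Prod>p\<in>prime_factors (rad_E g). int p - 1 - int p * (jacobi y p)\<^sup>2)"
          proof (rule prod.cong)
            show "{p. prime p \<and> p dvd rad_E g} = prime_factors (rad_E g)"
              using rad_E_pos[of g] by (auto simp: in_prime_factors_iff)
            fix p assume "p \<in> prime_factors (rad_E g)"
            hence "odd p" using oddEO(1) by (auto dest: in_prime_factors_imp_dvd dvd_trans)
            thus "int p - 1 - int p * (kronecker y (int p))\<^sup>2 = int p - 1 - int p * (jacobi y p)\<^sup>2"
              by (simp add: kronecker_eq_jacobi)
          qed
          ultimately have ta: "t a = of_int (jacobi (2 * (-1) ^ ((r - 1) div 2)) d) * of_int (jacobi (int (rad_E g)) (rad_O g)) *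
            (real d * real a powr (real r / 2) / sqrt (real (rad' g))) * of_int (eta_power_coeff r k) *
            of_int (jacobi y (rad_O g)) * of_int (\<Prod>p\<in>prime_factors (rad_E g). int p - 1 - int p * (jacobi y p)\<^sup>2)"
            unfolding t_def Let_def d_def[symmetric] g_def[symmetric]
            by (simp only: kronecker_eq_jacobi[OF odd(1)] kronecker_eq_jacobi[OF oddEO(2)])
          have "arith_factor a u = of_int (jacobi (2 * (-1) ^ ((r - 1) div 2)) d) * of_int (jacobi (int (rad_E g)) (rad_O g)) *
            (real d / sqrt (real (rad' g))) * of_int (jacobi y (rad_O g)) *
            of_int (\<Prod>p\<in>prime_factors (rad_E g). int p - 1 - int p * (jacobi y p)\<^sup>2)"
            unfolding arith_factor_def Let_def d_def[symmetric] g_def[symmetric] if_not_P[OF False] if_P[OF True] y_def[symmetric] ..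
          thus ?thesis
            using True cond unfolding coeff d_def[symmetric] g_def[symmetric] ta sqrt_power_eq_powr[of "real a" r, simplified, OF a(1)]
            by (simp add: mult_ac)
        qed
      qed
    qed
    finally show ?thesis .
  qed
qed

text \<open>Each t, and likewise \<open>rad g\<close>, divides g and hence \<open>a\<close>. This
  common weaker condition makes it possible to locate the exponents without regard to the parity of
  \<open>r\<close>.\<close>

lemma arith_factor_nonzero:
  assumes "arith_factor a u \<noteq> 0" "a > 0"
  shows "int (l div a) dvd u * int a"
proof -
  define d g where "d = l div a" and "g = gcd a d"
  have g: "g > 0" "g dvd a" using assms by (auto simp: g_def)
  have "int d dvd u * int g"
  proof (cases "even r")
    case True
    have "\<exists>t. t dvd g \<and> int d dvd u * int t"
    proof (rule ccontr)
      assume "\<nexists>t. t dvd g \<and> int d dvd u * int t"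
      hence e: "{t. 0 < t \<and> t dvd g \<and> int d dvd u * int t} = {}" by auto
      have "arith_factor a u = 0"
        unfolding arith_factor_def Let_def d_def[symmetric] g_def[symmetric] if_P[OF True] e by simp
      thus False using assms(1) by simp
    qed
    then obtain t where "int t dvd int g" "int d dvd u * int t" by auto
    thus ?thesis by (meson dvd_refl dvd_trans mult_dvd_mono)
  next
    case False
    hence "int d dvd u * int (rad g)"
      using assms(1) unfolding arith_factor_def Let_def d_def[symmetric] g_def[symmetric] by (auto split: if_splits)
    moreover have "int (rad g) dvd int g" using rad_dvd[OF g(1)] by simp
    ultimately show ?thesis by (meson dvd_refl dvd_trans mult_dvd_mono)
  qed
  moreover have "int g dvd int a" using g by simp
  ultimately show ?thesis unfolding d_def by (meson dvd_refl dvd_trans mult_dvd_mono)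
qed

text \<open>On the support, \<open>24 dvd r * (l - 1)\<close> gives a(24k + r) = d(24i + r) with an
  integer i. As the left side is non-negative, \<open>r \<le> 24\<close> excludes negative
  i.\<close>

lemma index_exists:
  assumes a: "a dvd l" and nz: "arith_factor a (idx a k) \<noteq> 0"
  shows "\<exists>i. int a * int (24 * k + r) = int (l div a) * int (24 * i + r)"
proof -
  define d where "d = l div a"
  have ad: "int a * int d = int l" using a by (simp add: d_def flip: of_nat_mult)
  have pos: "a > 0" "d > 0" using a l by (auto simp: d_def dvd_div_eq_0_iff intro!: gr0I)
  obtain v where v: "idx a k * int a = int d * v"
    using arith_factor_nonzero[OF nz pos(1)] unfolding d_def by (elim dvdE)
  obtain w where w: "r * (l - 1) = 24 * w" using rl by blast
  have "int r * int l = int (r * (l - 1)) + int r" using l by (simp add: of_nat_diff algebra_simps)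
  hence rl': "int r * int l = 24 * int w + int r" unfolding w by simp
  have "int a * int (24 * k + r) = 24 * (idx a k * int a) + int r * (int a * int d) * int d"
  proof -
    have "int (24 * k + r) = 24 * idx a k + int r * (int d)\<^sup>2"
      using idx_eq[OF a, of k] unfolding d_def[symmetric] by simp
    thus ?thesis by (simp only:) (simp add: algebra_simps power2_eq_square)
  qed
  also have "\<dots> = int d * (24 * v + int r * int l)"
    unfolding v ad by (simp add: algebra_simps)
  finally have eq: "int a * int (24 * k + r) = int d * (24 * (v + int w) + int r)"
    unfolding rl' by (simp add: algebra_simps)
  have "v + int w \<ge> 0"
  proof (rule ccontr)
    assume neg: "\<not> v + int w \<ge> 0"
    define z where "z = v + int w"
    have "z \<le> -1" using neg by (simp add: z_def)
    moreover have "int r \<le> 24" using r by simp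
    ultimately have "24 * z + int r \<le> 0" by linarith
    hence "24 * (v + int w) + int r \<le> 0" by (simp only: z_def)
    moreover have "int d * (24 * (v + int w) + int r) \<ge> 0" unfolding eq[symmetric] by simp
    \<comment> \<open>The borderline 24i + r = 0 would make a(24k + r) vanish, hence r = 0 and then
      i = 0.\<close>
    ultimately have 0: "24 * (v + int w) + int r = 0" using pos(2) by (simp add: zero_le_mult_iff)
    hence "int a * int (24 * k + r) = 0" using eq by simp
    hence "r = 0" "k = 0" using pos(1) by auto
    thus False using 0 neg by simp
  qed
  hence "int (24 * nat (v + int w) + r) = 24 * (v + int w) + int r" by simp
  thus ?thesis using eq unfolding d_def by metis
qed

lemma R_eq_0:
  assumes "\<nexists>i::nat. n = int (24 * i + r)"
  shows "R n r l = 0"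
proof -
  have "coeff_at a n = 0" if a: "a dvd l" for a
    unfolding coeff_at_def
  proof (rule sum.neutral, clarify)
    fix k assume k: "int a * int (24 * k + r) = int (l div a) * n"
    show "of_int (eta_power_coeff r k) * arith_factor a (idx a k) = 0"
    proof (rule ccontr)
      assume "\<not> ?thesis"
      hence "arith_factor a (idx a k) \<noteq> 0" by auto
      then obtain i where "int a * int (24 * k + r) = int (l div a) * int (24 * i + r)"
        using index_exists[OF a] by blast
      moreover have "l div a > 0" using a l by (auto simp: dvd_div_eq_0_iff intro!: gr0I)
      ultimately have "n = int (24 * i + r)" using k by simp
      thus False using assms by blast
    qed
  qed
  thus ?thesis by (simp add: R_eq)
qed

end

section \<open>Constancy of the quotient\<close>

context eta_hecke
begin

definition hecke_coeff :: "nat \<Rightarrow> complex" where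
  "hecke_coeff i = of_real (R (int (24 * i + r)) r l)"

text \<open>The k-th term is moved to the index i of its exponent. Such an i is guaranteed only
  where \<open>arith_factor\<close> is nonzero, so the injective re-indexing is done on that support
  and zeros are filled in on both sides.\<close>

lemma coeff_at_has_sum:
  assumes a: "a dvd l" and \<tau>: "Im \<tau> > 0"
    and S: "((\<lambda>k. of_int (eta_power_coeff r k) * shift_sum a k *
       cis2 (of_nat (24 * k + r) * of_nat a * \<tau> / (24 * of_nat (l div a)))) has_sum T) UNIV"
  shows "((\<lambda>i. of_real (coeff_at a (int (24 * i + r))) * cis2 (of_nat (24 * i + r) * \<tau> / 24)) has_sum T) UNIV"
proof -
  define d where "d = l div a"
  have pos: "a > 0" "d > 0" using a l by (auto simp: d_def dvd_div_eq_0_iff intro!: gr0I)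
  define A where "A = {k. arith_factor a (idx a k) \<noteq> 0}"
  define f where "f = (\<lambda>k. SOME i. int a * int (24 * k + r) = int d * int (24 * i + r))"
  have f: "int a * int (24 * k + r) = int d * int (24 * f k + r)" if "k \<in> A" for k
  proof -
    have "\<exists>i. int a * int (24 * k + r) = int d * int (24 * i + r)"
      unfolding d_def by (rule index_exists[OF a]) (use that in \<open>simp add: A_def\<close>)
    thus ?thesis unfolding f_def by (rule someI_ex)
  qed
  have inj: "inj_on f A"
  proof (rule inj_onI)
    fix k k' assume k: "k \<in> A" "k' \<in> A" "f k = f k'"
    show "k = k'"
      by (rule index_unique[OF a f[OF k(1), unfolded d_def] f[OF k(2), folded k(3), unfolded d_def]])
  qed
  define g where "g = (\<lambda>i. of_real (coeff_at a (int (24 * i + r))) * cis2 (of_nat (24 * i + r) * \<tau> / 24))"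
  have gf: "g (f k) = of_int (eta_power_coeff r k) * shift_sum a k * cis2 (of_nat (24 * k + r) * of_nat a * \<tau> / (24 * of_nat d))"
    if k: "k \<in> A" for k
  proof -
    have "{k'. int a * int (24 * k' + r) = int d * int (24 * f k + r)} = {k}"
      using f[OF k] index_unique[OF a] unfolding d_def by blast
    hence 1: "coeff_at a (int (24 * f k + r)) = of_int (eta_power_coeff r k) * arith_factor a (idx a k)"
      unfolding coeff_at_def d_def by simp
    have "of_int (int a * int (24 * k + r)) = (of_int (int d * int (24 * f k + r)) :: complex)"
      using f[OF k] by (rule arg_cong)
    hence "of_nat (24 * f k + r) * \<tau> / 24 = of_nat (24 * k + r) * of_nat a * \<tau> / (24 * of_nat d)"
      using pos by (simp add: field_simps)
    thus ?thesis
      unfolding g_def 1 shift_sum_eq[OF a] by (simp only: of_real_mult of_real_of_int_eq)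
  qed
  have "((\<lambda>k. of_int (eta_power_coeff r k) * shift_sum a k *
       cis2 (of_nat (24 * k + r) * of_nat a * \<tau> / (24 * of_nat (l div a)))) has_sum T) UNIV \<longleftrightarrow> ((g \<circ> f) has_sum T) A"
    by (rule has_sum_cong_neutral) (auto simp: gf d_def A_def shift_sum_eq[OF a])
  with S have "((g \<circ> f) has_sum T) A" by blast
  hence "(g has_sum T) (f ` A)"
    using has_sum_reindex[OF inj] by blast
  also have "(g has_sum T) (f ` A) \<longleftrightarrow> (g has_sum T) UNIV"
  proof (rule has_sum_cong_neutral)
    fix i assume i: "i \<in> UNIV - f ` A"
    have "coeff_at a (int (24 * i + r)) = 0"
      unfolding coeff_at_def
    proof (rule sum.neutral, clarify)
      fix k assume k: "int a * int (24 * k + r) = int (l div a) * int (24 * i + r)"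
      have "k \<notin> A"
      proof
        assume "k \<in> A"
        hence "int d * int (24 * f k + r) = int d * int (24 * i + r)"
          using f[of k] k by (simp add: d_def)
        hence "f k = i" using pos by simp
        thus False using i \<open>k \<in> A\<close> by blast
      qed
      thus "of_int (eta_power_coeff r k) * arith_factor a (idx a k) = 0" by (simp add: A_def)
    qed
    thus "g i = 0" by (simp add: g_def)
  qed auto
  finally show ?thesis unfolding g_def .
qed

lemma hecke_eta_has_sum:
  assumes "Im \<tau> > 0"
  shows "((\<lambda>i. hecke_coeff i * cis2 (of_nat (24 * i + r) * \<tau> / 24)) has_sum hecke_eta \<tau>) UNIV"
proof -
  have "((\<lambda>i. \<Sum>a | a dvd l. of_real (sqrt (real a)) ^ r *
      (of_real (coeff_at a (int (24 * i + r))) * cis2 (of_nat (24 * i + r) * \<tau> / 24))) has_sum hecke_eta \<tau>) UNIV"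
    unfolding hecke_eta_eq
    by (intro has_sum_sum has_sum_cmult_right coeff_at_has_sum shift_sum_has_sum assms) auto
  also have "(\<lambda>i. \<Sum>a | a dvd l. of_real (sqrt (real a)) ^ r *
      (of_real (coeff_at a (int (24 * i + r))) * cis2 (of_nat (24 * i + r) * \<tau> / 24))) =
      (\<lambda>i. hecke_coeff i * cis2 (of_nat (24 * i + r) * \<tau> / 24))"
    unfolding hecke_coeff_def R_eq of_real_sum sum_distrib_right
    by (simp only: of_real_mult of_real_power mult.assoc)
  finally show ?thesis .
qed

definition hecke_series :: "complex \<Rightarrow> complex" where
  "hecke_series q = (\<Sum>i. hecke_coeff i * q ^ i)"

lemma hecke_eta_sums:
  assumes "Im \<tau> > 0"
  shows "(\<lambda>i. hecke_coeff i * cis2 \<tau> ^ i) sums (hecke_eta \<tau> / cis2 (of_nat r * \<tau> / 24))"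
proof -
  have "hecke_coeff i * cis2 (of_nat (24 * i + r) * \<tau> / 24) = cis2 (of_nat r * \<tau> / 24) * (hecke_coeff i * cis2 \<tau> ^ i)" for i
  proof -
    have "of_nat (24 * i + r) * \<tau> / 24 = of_nat r * \<tau> / 24 + of_nat i * \<tau>"
      by (simp add: field_simps)
    thus ?thesis by (simp only: cis2_add cis2_power mult_ac)
  qed
  hence "(\<lambda>i. cis2 (of_nat r * \<tau> / 24) * (hecke_coeff i * cis2 \<tau> ^ i)) sums hecke_eta \<tau>"
    using has_sum_imp_sums[OF hecke_eta_has_sum[OF assms]] by (simp only:)
  hence "(\<lambda>i. cis2 (of_nat r * \<tau> / 24) * (hecke_coeff i * cis2 \<tau> ^ i) / cis2 (of_nat r * \<tau> / 24)) sums
      (hecke_eta \<tau> / cis2 (of_nat r * \<tau> / 24))"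
    by (rule sums_divide)
  thus ?thesis by simp
qed

lemma qpow_1_eq_cis2: "qpow 1 \<tau> = cis2 \<tau>"
  by (simp add: qpow_def cis2_def)

lemma hecke_series_sums:
  assumes "norm q < 1"
  shows "(\<lambda>i. hecke_coeff i * q ^ i) sums hecke_series q"
proof (cases "q = 0")
  case True
  have "summable (\<lambda>i. hecke_coeff i * q ^ i)"
    by (rule summable_finite[of "{0}"]) (use True in auto)
  thus ?thesis unfolding hecke_series_def by (rule summable_sums)
next
  case False
  obtain \<tau> where "Im \<tau> > 0" "qpow 1 \<tau> = q"
    using qpow_1_surj[OF False assms] .
  hence "summable (\<lambda>i. hecke_coeff i * q ^ i)"
    using sums_summable[OF hecke_eta_sums[of \<tau>]] by (simp add: qpow_1_eq_cis2)
  thus ?thesis unfolding hecke_series_def by (rule summable_sums)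
qed

lemma hecke_eta_eq_series:
  assumes "Im \<tau> > 0"
  shows "hecke_eta \<tau> = cis2 (of_nat r * \<tau> / 24) * hecke_series (cis2 \<tau>)"
  using sums_unique2[OF hecke_eta_sums[OF assms] hecke_series_sums[OF norm_cis2_less_1[OF assms]]]
  by (simp add: field_simps)

definition hecke_quot :: "complex \<Rightarrow> complex" where
  "hecke_quot q = hecke_series q / euler_prod q ^ r"

lemma hecke_quot_holomorphic: "hecke_quot holomorphic_on ball 0 1"
proof -
  have "hecke_series holomorphic_on ball 0 1"
    by (rule power_series_holomorphic[of _ _ hecke_coeff]) (use hecke_series_sums in auto)
  thus ?thesis
    unfolding hecke_quot_def
    by (intro holomorphic_intros holomorphic_euler_prod) (auto simp: euler_prod_nonzero)
qed

lemma hecke_quot_cis2: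
  assumes "Im \<tau> > 0"
  shows "hecke_quot (cis2 \<tau>) = hecke_eta \<tau> / dedekind_eta \<tau> ^ r"
  unfolding hecke_eta_eq_series[OF assms] dedekind_eta_altdef hecke_quot_def
  by (simp add: power_mult_distrib cis2_power)

lemma hecke_quot_inversion:
  assumes "Im \<tau> > 0"
  shows "hecke_quot (cis2 (-1/\<tau>)) = hecke_quot (cis2 \<tau>)"
proof -
  have nz: "\<tau> \<noteq> 0" using assms by auto
  have im: "Im (-1/\<tau>) > 0"
    by (rule Im_inversion_pos[OF assms])
  have "csqrt (-\<i> * \<tau>) \<noteq> 0" using nz by simp
  thus ?thesis
    unfolding hecke_quot_cis2[OF im] hecke_quot_cis2[OF assms] hecke_eta_inversion[OF assms]
      dedekind_eta_inversion[OF assms] power_mult_distrib by simp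
qed

text \<open>
  Every \<open>q\<close> with \<open>|q| = exp (-\<pi>)\<close> is \<open>cis2 \<tau>\<close> with \<open>Im \<tau> = 1/2\<close> and \<open>|Re \<tau>| \<le> 1/2\<close>, and then
  \<open>Im (-1/\<tau>) \<ge> 1\<close>. So the maximum modulus on the disc of radius \<open>exp (-\<pi>)\<close> is attained in the interior.
\<close>
lemma hecke_quot_constant: "hecke_quot constant_on ball 0 1"
proof -
  define \<rho> \<rho>' where "\<rho> = exp (-pi)" and "\<rho>' = exp (-2 * pi)"
  have \<rho>: "0 < \<rho>'" "\<rho>' < \<rho>" "\<rho> < 1" by (auto simp: \<rho>_def \<rho>'_def)
  have cont: "continuous_on (cball 0 \<rho>) hecke_quot"
    by (rule holomorphic_on_imp_continuous_on[OF holomorphic_on_subset[OF hecke_quot_holomorphic]]) (use \<rho> in auto)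
  hence "continuous_on (cball 0 \<rho>') hecke_quot"
    by (rule continuous_on_subset) (use \<rho> in auto)
  hence "continuous_on (cball 0 \<rho>') (\<lambda>q. norm (hecke_quot q))"
    by (rule continuous_on_norm)
  moreover have "compact (cball (0::complex) \<rho>')" "cball (0::complex) \<rho>' \<noteq> {}" using \<rho> by auto
  ultimately obtain q1 where q1: "q1 \<in> cball 0 \<rho>'" "\<And>q. q \<in> cball 0 \<rho>' \<Longrightarrow> norm (hecke_quot q) \<le> norm (hecke_quot q1)"
    using continuous_attains_sup by metis
  have frontier: "norm (hecke_quot q) \<le> norm (hecke_quot q1)" if "norm q = \<rho>" for q
  proof -
    have qnz: "q \<noteq> 0" using that \<rho> by auto
    define \<tau> where "\<tau> = Ln q / (2 * of_real pi * \<i>)"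
    have q: "cis2 \<tau> = q" using qnz by (simp add: cis2_def \<tau>_def)
    have \<tau>_eq: "\<tau> = Complex (Im (Ln q) / (2 * pi)) (1 / 2)"
    proof -
      have "Re (Ln q) = - pi" using qnz that by (simp add: \<rho>_def)
      moreover have "\<tau> = Ln q * (- \<i> / (2 * of_real pi))" by (simp add: \<tau>_def field_simps)
      ultimately show ?thesis by (simp add: complex_eq_iff Re_divide Im_divide power2_eq_square)
    qed
    have re: "\<bar>Re \<tau>\<bar> \<le> 1 / 2"
      using mpi_less_Im_Ln[OF qnz] Im_Ln_le_pi[OF qnz] unfolding \<tau>_eq by (simp add: abs_le_iff field_simps)
    have im: "Im \<tau> = 1 / 2" by (simp add: \<tau>_eq)
    have "(Re \<tau>)\<^sup>2 \<le> (1/2)\<^sup>2" using re by (simp add: abs_le_square_iff[symmetric])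
    hence "(Re \<tau>)\<^sup>2 + (Im \<tau>)\<^sup>2 \<le> 1 / 2" by (simp add: im power2_eq_square)
    moreover have "(Re \<tau>)\<^sup>2 + (Im \<tau>)\<^sup>2 > 0" by (simp add: im add_nonneg_pos)
    ultimately have "1 \<le> (1/2) / ((Re \<tau>)\<^sup>2 + (Im \<tau>)\<^sup>2)" by (simp add: field_simps)
    also have "\<dots> = Im (-1/\<tau>)" by (simp add: Im_divide im)
    finally have "2 * pi * 1 \<le> 2 * pi * Im (-1/\<tau>)"
      by (intro mult_left_mono) auto
    hence "norm (cis2 (-1/\<tau>)) \<le> \<rho>'"
      unfolding norm_cis2 \<rho>'_def exp_le_cancel_iff by linarith
    hence "norm (hecke_quot (cis2 (-1/\<tau>))) \<le> norm (hecke_quot q1)"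
      by (intro q1) simp
    thus ?thesis using hecke_quot_inversion[of \<tau>] im q by simp
  qed
  \<comment> \<open>The bound passes from the frontier to the whole disc, which makes
    \<open>q1\<close> an interior maximum.\<close>
  have max: "norm (hecke_quot q) \<le> norm (hecke_quot q1)" if "q \<in> cball 0 \<rho>" for q
  proof (rule maximum_modulus_frontier[where S = "cball 0 \<rho>" and f = hecke_quot])
    show "hecke_quot holomorphic_on interior (cball 0 \<rho>)"
      by (rule holomorphic_on_subset[OF hecke_quot_holomorphic]) (use \<rho> in auto)
  qed (use that frontier cont in \<open>auto simp: frontier_cball\<close>)
  show ?thesis
    by (rule maximum_modulus_principle[OF hecke_quot_holomorphic, where U = "ball 0 \<rho>" and \<xi> = q1])
       (use \<rho> q1(1) max in auto)
qed

text \<open>The constant quotient is read off at index 0, where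
  \<open>eta_power_coeff r 0 = 1\<close>; \<open>hecke_coeff 0\<close> is R(r; r, l).\<close>

theorem hecke_coeff_eq: "hecke_coeff i = hecke_coeff 0 * of_int (eta_power_coeff r i)"
proof -
  obtain c where c: "\<And>q. norm q < 1 \<Longrightarrow> hecke_quot q = c"
    using hecke_quot_constant by (auto simp: constant_on_def)
  have series: "hecke_series q = c * euler_prod q ^ r" if "norm q < 1" for q
    using c[OF that] euler_prod_nonzero[OF that] by (simp add: hecke_quot_def field_simps)
  have "hecke_coeff = (\<lambda>i. c * of_int (eta_power_coeff r i))"
  proof (rule powser_unique)
    fix q :: complex assume q: "norm q < 1"
    show "(\<lambda>i. hecke_coeff i * q ^ i) sums (c * euler_prod q ^ r)"
      using hecke_series_sums[OF q] by (simp add: series q)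
    show "(\<lambda>i. c * of_int (eta_power_coeff r i) * q ^ i) sums (c * euler_prod q ^ r)"
      using sums_mult[OF eta_power_coeff_sums[OF q, of r], of c] by (simp add: mult.assoc)
  qed
  hence coeff: "hecke_coeff i = c * of_int (eta_power_coeff r i)" for i
    by (simp add: fun_eq_iff)
  show ?thesis
    unfolding coeff[of i] coeff[of 0] eta_power_coeff_0 by simp
qed

lemma R_eigenvalue: "R n r l = R (int r) r l * of_int (eta_P r ((of_int n - of_nat r) / 24))"
proof (cases "\<exists>i::nat. n = int (24 * i + r)")
  case True
  then obtain i where i: "n = int (24 * i + r)" by blast
  have "(of_int n - of_nat r) / 24 = (of_nat i :: rat)" by (simp add: i)
  hence "eta_P r ((of_int n - of_nat r) / 24) = eta_power_coeff r i"
    by (simp add: eta_P_def)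
  moreover have "complex_of_real (R n r l) = of_real (R (int r) r l * of_int (eta_power_coeff r i))"
    using hecke_coeff_eq[of i] by (simp add: hecke_coeff_def i)
  ultimately show ?thesis by (simp only: of_real_eq_iff)
next
  case False
  have "(of_int n - of_nat r) / 24 \<notin> (\<nat> :: rat set)"
  proof
    assume "(of_int n - of_nat r) / 24 \<in> (\<nat> :: rat set)"
    then obtain i where "(of_int n - of_nat r) / 24 = (of_nat i :: rat)" by (elim Nats_cases)
    hence "of_int n = (of_int (int (24 * i + r)) :: rat)" by (simp add: field_simps)
    hence "n = int (24 * i + r)" by (simp only: of_int_eq_iff)
    thus False using False by blast
  qed
  thus ?thesis using R_eq_0[OF False] by (simp add: eta_P_def)
qed

end

theorem theorem5p9:
  fixes r l :: nat and n :: int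
  assumes "r \<in> {0..24}"
    and "l > 0"
    and "24 dvd r * (l - 1)"
    and "odd r \<Longrightarrow> is_square l"
  shows "R n r l = R (int r) r l * of_int (eta_P r ((of_int n - of_nat r) / 24))"
proof -
  interpret eta_hecke r l
    by unfold_locales (use assms in auto)
  show ?thesis by (rule R_eigenvalue)
qed

end
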